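(* Let $\Lambda\subseteq\mathbb{R}^m$ be open and let $\underline{A}:\Lambda\to{\rm Mat}^+_2(\mathbb{R})^k$ be a rich smooth family of locally constant cocycles over a fixed Bernoulli or (primitive) Markov shift on $\{1,\dots,k\}$, and assume there exists $i\in\{1,\dots,k\}$ such that $\mathrm{rank}(A_i(t))=1$ for every $t\in\Lambda$. Then for every $t\in\Lambda$, either $\underline{A}(t)$ is projectively uniformly hyperbolic, or else there exists a sequence $t_n\to t$ in $\Lambda$ such that $\underline{A}(t_n)$ has a periodic null word; in particular $L_1(\underline{A}(t_n))=-\infty$ for every $n\in\mathbb{N}$.
   Context: ${\rm Mat}^+_2(\mathbb{R})$: real $2\times2$ matrices with $\det\ge0$. Base: Bernoulli shift on $X=\{1,\dots,k\}^{\mathbb Z}$ with product measure of positive weights, or Markov shift given by a primitive column-stochastic matrix $P=(p_{ij})$ ($j\to i$ admissible iff $p_{ij}>0$), $X$ the admissible sequences. Cocycle $F(\omega,v)=(\sigma\omega,A_{\omega_1}v)$, $A^n(\omega)=A_{\omega_n}\cdots A_{\omega_1}$, $L_1=\lim_n\frac1n\log\|A^n(\omega)\|$ a.e. Projectively uniformly hyperbolic: there are continuous invariant line fields $E_0(\omega),E_1(\omega)$ with $\mathbb R^2=E_0\oplus E_1$ and $n$ with $\|A^n(\omega)|_{E_0}\|<\|A^n(\omega)|_{E_1}\|$ for all $\omega$. A null word is an admissible finite word $\omega_1\dots\omega_n$ with $A_{\omega_n}\cdots A_{\omega_1}=0$; periodic means its periodic repetition is admissible. For $u,w\in\mathbb{R}^2$,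 $u\wedge w=u_1w_2-u_2w_1$. A smooth one-parameter family $\underline A(t)$, $t$ in an open interval $I$, is positively winding if the index set splits as $\mathscr{A}_{\rm inv}\sqcup\mathscr{A}_{\rm sing}$ such that: there is $c>0$ with $\frac{(A_j(t)v)\wedge(\frac{d}{dt}A_j(t)v)}{\|A_j(t)v\|^2}\ge c$ for all $j\in\mathscr{A}_{\rm inv}$, $t\in I$, $v\ne0$ (with $A_j(t)$ invertible); and for all $i\in\mathscr{A}_{\rm sing}$ and $t\in I$, $\mathrm{rank}A_i(t)=1$, $r_i(t)\wedge\frac{d}{dt}r_i(t)\ge0$ and $k_i(t)\wedge\frac{d}{dt}k_i(t)\le0$, where $r_i(t)$, $k_i(t)$ are smooth unit vectors spanning $\mathrm{Range}(A_i(t))$, $\mathrm{Ker}(A_i(t))$. The family $\underline A:\Lambda\to{\rm Mat}^+_2(\mathbb{R})^k$ is rich if through every $p_0\in\Lambda$ passes a smooth curve $\alpha:I\to\Lambda$ such that $t\mapsto\underline A(\alpha(t))$ is positively winding. *)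

theory Defs
  imports "HOL-Probability.Probability"
begin

fun Ck_on :: "nat \<Rightarrow> 'a::euclidean_space set \<Rightarrow> ('a \<Rightarrow> 'b::real_normed_vector) \<Rightarrow> bool" where
  "Ck_on 0 S f = continuous_on S f"
| "Ck_on (Suc n) S f =
     (f differentiable_on S \<and>
      (\<forall>u\<in>Basis. Ck_on n S (\<lambda>x. frechet_derivative f (at x) u)))"

definition smooth_on :: "'a::euclidean_space set \<Rightarrow> ('a \<Rightarrow> 'b::real_normed_vector) \<Rightarrow> bool" where
  "smooth_on S f \<longleftrightarrow> (\<forall>n. Ck_on n S f)"

definition open_interval :: "real set \<Rightarrow> bool" where
  "open_interval I \<longleftrightarrow> is_interval I \<and> open I \<and> I \<noteq> {}"

definition wedge :: "real^2 \<Rightarrow> real^2 \<Rightarrow> real" where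
  "wedge u w = u$1 * w$2 - u$2 * w$1"

definition is_line :: "(real^2) set \<Rightarrow> bool" where
  "is_line L \<longleftrightarrow> subspace L \<and> dim L = 1"

definition restr_norm :: "real^2^2 \<Rightarrow> (real^2) set \<Rightarrow> real" where
  "restr_norm M E = Sup {norm (M *v u) | u. u \<in> E \<and> norm u = 1}"

text \<open>P i j is the transition probability from j to i (column-stochastic).\<close>

fun mpow :: "nat \<Rightarrow> (nat \<Rightarrow> nat \<Rightarrow> real) \<Rightarrow> nat \<Rightarrow> nat \<Rightarrow> nat \<Rightarrow> real" where
  "mpow k P 0 i j = (if i = j then 1 else 0)"
| "mpow k P (Suc n) i j = (\<Sum>l\<in>{1..k}. P i l * mpow k P n l j)"

definition column_stochastic :: "nat \<Rightarrow> (nat \<Rightarrow> nat \<Rightarrow> real) \<Rightarrow> bool" where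
  "column_stochastic k P \<longleftrightarrow>
     (\<forall>i\<in>{1..k}. \<forall>j\<in>{1..k}. P i j \<ge> 0) \<and> (\<forall>j\<in>{1..k}. (\<Sum>i\<in>{1..k}. P i j) = 1)"

definition primitive :: "nat \<Rightarrow> (nat \<Rightarrow> nat \<Rightarrow> real) \<Rightarrow> bool" where
  "primitive k P \<longleftrightarrow> (\<exists>N. \<forall>i\<in>{1..k}. \<forall>j\<in>{1..k}. mpow k P N i j > 0)"

definition shift_space :: "nat \<Rightarrow> (nat \<Rightarrow> nat \<Rightarrow> real) \<Rightarrow> (int \<Rightarrow> nat) set" where
  "shift_space k P = {\<omega>. \<forall>n. \<omega> n \<in> {1..k} \<and> P (\<omega> (n + 1)) (\<omega> n) > 0}"

definition shift :: "(int \<Rightarrow> nat) \<Rightarrow> (int \<Rightarrow> nat)" where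
  "shift \<omega> = (\<lambda>n. \<omega> (n + 1))"

definition cylinder :: "int \<Rightarrow> nat list \<Rightarrow> (int \<Rightarrow> nat) set" where
  "cylinder a w = {\<omega>. \<forall>j<length w. \<omega> (a + int j) = w ! j}"

text \<open>The (stationary) Markov measure of P on the full sequence space (it is
  concentrated on shift_space k P); a Bernoulli measure with positive weights q is
  the case P i j = q i.\<close>
definition markov_measure :: "nat \<Rightarrow> (nat \<Rightarrow> nat \<Rightarrow> real) \<Rightarrow> (int \<Rightarrow> nat) measure \<Rightarrow> bool" where
  "markov_measure k P \<mu> \<longleftrightarrow>
     prob_space \<mu> \<and>
     sets \<mu> = sets (PiM (UNIV :: int set) (\<lambda>_. count_space (UNIV :: nat set))) \<and>
     (\<exists>\<pi>. (\<forall>i\<in>{1..k}. \<pi> i > 0) \<and> (\<Sum>i\<in>{1..k}. \<pi> i) = 1 \<and>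
          (\<forall>i\<in>{1..k}. (\<Sum>j\<in>{1..k}. P i j * \<pi> j) = \<pi> i) \<and>
          (\<forall>a w. w \<noteq> [] \<and> set w \<subseteq> {1..k} \<longrightarrow>
              measure \<mu> (cylinder a w) =
                \<pi> (w ! 0) * (\<Prod>j<length w - 1. P (w ! (j + 1)) (w ! j))))"

fun cocycle_pow :: "(nat \<Rightarrow> real^2^2) \<Rightarrow> (int \<Rightarrow> nat) \<Rightarrow> nat \<Rightarrow> real^2^2" where
  "cocycle_pow M \<omega> 0 = mat 1"
| "cocycle_pow M \<omega> (Suc n) = M (\<omega> (int (Suc n))) ** cocycle_pow M \<omega> n"

definition word_prod :: "(nat \<Rightarrow> real^2^2) \<Rightarrow> nat list \<Rightarrow> real^2^2" where
  "word_prod M w = foldl (\<lambda>acc i. M i ** acc) (mat 1) w"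

definition admissible_word :: "nat \<Rightarrow> (nat \<Rightarrow> nat \<Rightarrow> real) \<Rightarrow> nat list \<Rightarrow> bool" where
  "admissible_word k P w \<longleftrightarrow> w \<noteq> [] \<and> set w \<subseteq> {1..k} \<and>
     (\<forall>j. Suc j < length w \<longrightarrow> P (w ! Suc j) (w ! j) > 0)"

definition has_periodic_null_word :: "nat \<Rightarrow> (nat \<Rightarrow> nat \<Rightarrow> real) \<Rightarrow> (nat \<Rightarrow> real^2^2) \<Rightarrow> bool" where
  "has_periodic_null_word k P M \<longleftrightarrow>
     (\<exists>w. admissible_word k P w \<and> P (w ! 0) (last w) > 0 \<and> word_prod M w = 0)"

text \<open>Continuity of a line field on X: locally spanned by a continuous nonvanishing
  vector field (product topology on int => nat).\<close>
definition cont_line_field :: "(int \<Rightarrow> nat) set \<Rightarrow> ((int \<Rightarrow> nat) \<Rightarrow> (real^2) set) \<Rightarrow> bool" where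
  "cont_line_field X E \<longleftrightarrow>
     (\<forall>\<omega>\<in>X. \<exists>U. open U \<and> \<omega> \<in> U \<and>
        (\<exists>v. continuous_on (U \<inter> X) v \<and> (\<forall>\<eta>\<in>U \<inter> X. v \<eta> \<noteq> 0 \<and> E \<eta> = span {v \<eta>})))"

definition proj_unif_hyperbolic :: "nat \<Rightarrow> (nat \<Rightarrow> nat \<Rightarrow> real) \<Rightarrow> (nat \<Rightarrow> real^2^2) \<Rightarrow> bool" where
  "proj_unif_hyperbolic k P M \<longleftrightarrow>
     (let X = shift_space k P in
      \<exists>E0 E1. cont_line_field X E0 \<and> cont_line_field X E1 \<and>
        (\<forall>\<omega>\<in>X. is_line (E0 \<omega>) \<and> is_line (E1 \<omega>) \<and> E0 \<omega> \<inter> E1 \<omega> = {0} \<and>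
                (\<lambda>v. M (\<omega> 1) *v v) ` E0 \<omega> \<subseteq> E0 (shift \<omega>) \<and>
                (\<lambda>v. M (\<omega> 1) *v v) ` E1 \<omega> \<subseteq> E1 (shift \<omega>)) \<and>
        (\<exists>n. \<forall>\<omega>\<in>X. restr_norm (cocycle_pow M \<omega> n) (E0 \<omega>)
                     < restr_norm (cocycle_pow M \<omega> n) (E1 \<omega>)))"

definition elog :: "real \<Rightarrow> ereal" where
  "elog x = (if x = 0 then -\<infinity> else ereal (ln x))"

definition top_lyapunov_is :: "nat \<Rightarrow> (nat \<Rightarrow> nat \<Rightarrow> real) \<Rightarrow> (nat \<Rightarrow> real^2^2) \<Rightarrow> ereal \<Rightarrow> bool" where
  "top_lyapunov_is k P M L \<longleftrightarrow>
     (\<forall>\<mu>. markov_measure k P \<mu> \<longrightarrow>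
        (AE \<omega> in \<mu>. ((\<lambda>n. elog (norm (cocycle_pow M \<omega> n)) / ereal (real n)) \<longlongrightarrow> L) sequentially))"

definition positively_winding :: "nat \<Rightarrow> real set \<Rightarrow> (real \<Rightarrow> nat \<Rightarrow> real^2^2) \<Rightarrow> bool" where
  "positively_winding k I B \<longleftrightarrow>
     open_interval I \<and> (\<forall>j\<in>{1..k}. smooth_on I (\<lambda>t. B t j)) \<and>
     (\<exists>Ainv Asing. Ainv \<union> Asing = {1..k} \<and> Ainv \<inter> Asing = {} \<and>
       (\<exists>c>0. \<forall>j\<in>Ainv. \<forall>t\<in>I. invertible (B t j) \<and>
            (\<forall>v. v \<noteq> 0 \<longrightarrow>
               wedge (B t j *v v) (vector_derivative (\<lambda>s. B s j) (at t) *v v)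
                 / (norm (B t j *v v))\<^sup>2 \<ge> c)) \<and>
       (\<forall>i\<in>Asing. (\<forall>t\<in>I. rank (B t i) = 1) \<and>
          (\<exists>r \<kappa>. smooth_on I r \<and> smooth_on I \<kappa> \<and>
             (\<forall>t\<in>I. norm (r t) = 1 \<and> norm (\<kappa> t) = 1 \<and>
                span {r t} = range (\<lambda>v. B t i *v v) \<and>
                span {\<kappa> t} = {v. B t i *v v = 0} \<and>
                wedge (r t) (vector_derivative r (at t)) \<ge> 0 \<and>
                wedge (\<kappa> t) (vector_derivative \<kappa> (at t)) \<le> 0))))"

definition rich :: "nat \<Rightarrow> ('m::euclidean_space) set \<Rightarrow> ('m \<Rightarrow> nat \<Rightarrow> real^2^2) \<Rightarrow> bool" where
  "rich k \<Lambda> A \<longleftrightarrow>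
     (\<forall>p0\<in>\<Lambda>. \<exists>I \<alpha>. open_interval I \<and> smooth_on I \<alpha> \<and> \<alpha> ` I \<subseteq> \<Lambda> \<and> p0 \<in> \<alpha> ` I \<and>
        positively_winding k I (\<lambda>t. A (\<alpha> t)))"

end

theory Submission
  imports Defs
begin

text \<open>Follow a positively winding curve through \<open>t\<close> and suppose no parameter near \<open>t\<close> has a
  periodic null word. The directions \<open>A\<^sub>u r\<^sub>i\<close> (range of a singular letter pushed forward by an
  admissible word) turn forward with the parameter while the kernels turn backward, and the two never
  meet; so each such direction carries an arc around it of length at least a constant and less than
  \<open>pi\<close>, and every letter maps these arcs strictly into one another. The quadratic form vanishing on
  the boundary of the arc then expands by a factor \<open>1 + 2 \<sigma>\<^sup>2\<close> relative to the determinant, which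
  gives a uniform singular value gap along forward directions; singular letters have determinant \<open>0\<close>
  and merely reset the direction. Pushing kernels backward by adjugate
  matrices gives uniformly transversal backward directions; the limits of both are the invariant line
  fields. Finally, a null word occurs in almost every sequence, so the exponent is \<open>-\<infinity>\<close>.\<close>

section \<open>Plane linear algebra\<close>

text \<open>Two obstacles shape the argument. Singular letters have no inverse, so the contracted
  line cannot be found by running the cocycle backwards; the adjugate takes over, being the adjoint
  of a matrix for \<open>wedge\<close>. For the same reason growth is measured against the
  determinant. Strictness, in turn, comes only from the rate \<open>c\<close> of invertible letters,
  since ranges and kernels of singular letters are merely monotone. The arc swept by a direction
  over \<open>[s0 - eps, s0 + eps]\<close> is mapped by the letter at the fixed parameter
  \<open>s0\<close>, while the ends of the next arc use the letter at the end parameters; this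
  leaves a margin \<open>c * eps\<close> on both sides. The parameter window is twice as wide as
  that, so the advance outside the arc improves "less than pi" to "at most
  \<open>pi - 2 * d\<close>". Right after a singular letter the arc may be degenerate, so the
  estimates there start one invertible letter later, and the finitely many admissible pairs of
  singular letters are compared directly.\<close>

definition adj2 :: "real^2^2 \<Rightarrow> real^2^2" where
  "adj2 M = vector [vector [M$2$2, - (M$1$2)], vector [- (M$2$1), M$1$1]]"

lemma vec2_eq_iff: "(u::real^2) = w \<longleftrightarrow> u$1 = w$1 \<and> u$2 = w$2"
  by (simp add: vec_eq_iff forall_2)

lemma mat_vec_2: "(M *v v)$1 = M$1$1 * v$1 + M$1$2 * v$2" "(M *v v)$2 = M$2$1 * v$1 + M$2$2 * v$2"
  for M :: "real^2^2"
  by (simp_all add: matrix_vector_mult_def sum_2)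

lemma adj2_nth [simp]: "adj2 M $1$1 = M$2$2" "adj2 M $1$2 = - (M$1$2)" "adj2 M $2$1 = - (M$2$1)"
  "adj2 M $2$2 = M$1$1"
  by (simp_all add: adj2_def)

lemma adj2_mult: "adj2 (A ** B) = adj2 B ** adj2 A"
  by (simp add: vec_eq_iff forall_2 matrix_matrix_mult_def sum_2)

lemma adj2_mat_1 [simp]: "adj2 (mat 1) = mat 1"
  by (simp add: vec_eq_iff forall_2 mat_def)

lemma norm_sq_2: "(norm (v::real^2))\<^sup>2 = (v$1)\<^sup>2 + (v$2)\<^sup>2"
  by (simp only: power2_norm_eq_inner inner_vec_def sum_2) (simp add: power2_eq_square)

lemma inner_2: "inner u w = u$1 * w$1 + u$2 * w$2" for u w :: "real^2"
  by (simp add: inner_vec_def sum_2)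

lemma wedge_matrix: "wedge (M *v u) (M *v w) = det M * wedge u w"
  by (simp add: wedge_def mat_vec_2 det_2 algebra_simps)

lemma det_adj2 [simp]: "det (adj2 M) = det M"
  by (simp add: det_2)

text \<open>The adjugate is the adjoint of \<open>M\<close> for the area form: transversality of
  \<open>M *v u\<close> to \<open>h\<close> is transversality of \<open>u\<close> to the pulled back
  \<open>h\<close>, also for singular \<open>M\<close>.\<close>

lemma wedge_adj2: "wedge u (adj2 M *v h) = wedge (M *v u) h"
  by (simp add: wedge_def mat_vec_2 algebra_simps)

lemma mult_adj2: "M *v (adj2 M *v h) = det M *\<^sub>R h"
  by (simp add: vec2_eq_iff mat_vec_2 det_2 algebra_simps)

lemma adj2_mult_self: "adj2 M *v (M *v h) = det M *\<^sub>R h"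
  by (simp add: vec2_eq_iff mat_vec_2 det_2 algebra_simps)

lemma wedge_scaleR [simp]: "wedge (a *\<^sub>R u) w = a * wedge u w" "wedge u (a *\<^sub>R w) = a * wedge u w"
  by (simp_all add: wedge_def algebra_simps)

lemma wedge_add: "wedge (u + v) w = wedge u w + wedge v w" "wedge u (v + w) = wedge u v + wedge u w"
  by (simp_all add: wedge_def algebra_simps)

lemma wedge_self [simp]: "wedge u u = 0" "wedge 0 u = 0" "wedge u 0 = 0"
  by (simp_all add: wedge_def)

text \<open>Lagrange identity: with \<open>wedge\<close> as sine and \<open>inner\<close> as cosine
  this is Pythagoras.\<close>

lemma wedge_inner_sq: "(wedge u w)\<^sup>2 + (inner u w)\<^sup>2 = (norm u)\<^sup>2 * (norm w)\<^sup>2"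
  unfolding norm_sq_2 by (simp add: wedge_def inner_2 power2_eq_square algebra_simps)

lemma abs_wedge_le: "\<bar>wedge u w\<bar> \<le> norm u * norm w"
proof -
  have "(wedge u w)\<^sup>2 \<le> (norm u * norm w)\<^sup>2"
    using wedge_inner_sq[of u w] by (simp add: power_mult_distrib)
       (metis add.commute le_add_same_cancel1 zero_le_power2 order_refl add_increasing)
  then show ?thesis
    by (metis abs_ge_zero abs_of_nonneg abs_le_square_iff mult_nonneg_nonneg norm_ge_zero)
qed

lemma wedge_eq_0_imp_span:
  assumes "wedge u w = 0" "w \<noteq> 0"
  shows "u \<in> span {w}"
proof -
  have "(norm w)\<^sup>2 *\<^sub>R u = inner u w *\<^sub>R w"
    using assms(1) unfolding norm_sq_2 by (simp add: vec2_eq_iff inner_2 wedge_def power2_eq_square algebra_simps)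
  then have "(1 / (norm w)\<^sup>2) *\<^sub>R ((norm w)\<^sup>2 *\<^sub>R u) = (1 / (norm w)\<^sup>2) *\<^sub>R (inner u w *\<^sub>R w)"
    by simp
  then have "u = (inner u w / (norm w)\<^sup>2) *\<^sub>R w"
    using assms(2) by simp
  then show ?thesis by (metis span_singleton range_eqI)
qed

lemma span_imp_wedge_eq_0: "u \<in> span {w} \<Longrightarrow> wedge u w = 0"
  by (auto simp: span_singleton)

lemma tendsto_wedge [tendsto_intros]:
  "(f \<longlongrightarrow> u) F \<Longrightarrow> (g \<longlongrightarrow> w) F \<Longrightarrow> ((\<lambda>x. wedge (f x) (g x)) \<longlongrightarrow> wedge u w) F"
  unfolding wedge_def by (intro tendsto_intros)

text \<open>\<open>wedge\<close> compares lines and ignores signs. At an acute angle it controls the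
  vectors as well, because there 1 - cos is at most 1 - cos^2.\<close>

lemma norm_diff_sq_le_wedge:
  assumes "norm u = 1" "norm w = 1" "inner u w \<ge> 0"
  shows "(norm (u - w))\<^sup>2 \<le> 2 * (wedge u w)\<^sup>2"
proof -
  have le1: "inner u w \<le> 1" using norm_cauchy_schwarz[of u w] assms by simp
  have "(norm (u - w))\<^sup>2 = 2 - 2 * inner u w"
    using assms by (simp add: power2_norm_eq_inner inner_diff inner_commute norm_eq_1 algebra_simps)
  also have "\<dots> \<le> 2 - 2 * (inner u w)\<^sup>2"
    using le1 assms(3) by (simp add: power2_eq_square mult_left_le_one_le)
  also have "\<dots> = 2 * (wedge u w)\<^sup>2" using wedge_inner_sq[of u w] assms by simp
  finally show ?thesis .
qed

text \<open>The sine of an angle difference expands into two products, each containing a cosine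
  bounded by 1; this is a triangle inequality for lines.\<close>

lemma wedge_unit_triangle:
  assumes "norm x = 1" "norm e = 1" "norm f = 1" "\<bar>wedge x e\<bar> \<le> a" "\<bar>wedge x f\<bar> \<le> a"
  shows "\<bar>wedge e f\<bar> \<le> 2 * a"
proof -
  have eq: "wedge e f * (norm x)\<^sup>2 = inner x e * wedge x f - inner x f * wedge x e"
    unfolding norm_sq_2 by (simp add: wedge_def inner_2 power2_eq_square algebra_simps)
  have "\<bar>inner x e\<bar> \<le> 1" "\<bar>inner x f\<bar> \<le> 1"
    using Cauchy_Schwarz_ineq2[of x e] Cauchy_Schwarz_ineq2[of x f] assms by auto
  then have "\<bar>inner x e * wedge x f\<bar> \<le> 1 * a" "\<bar>inner x f * wedge x e\<bar> \<le> 1 * a"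
    using assms unfolding abs_mult by (intro mult_mono; simp)+
  then show ?thesis using eq assms(1) by simp
qed

section \<open>Line fields as limits of collapsing direction sets\<close>

lemma open_agree: "finite F \<Longrightarrow> open {\<eta> :: int \<Rightarrow> nat. \<forall>i\<in>F. \<eta> i = \<omega> i}"
proof -
  assume F: "finite F"
  have "{\<eta> :: int \<Rightarrow> nat. \<forall>i\<in>F. \<eta> i = \<omega> i} = (\<Inter>i\<in>F. (\<lambda>\<eta>. \<eta> i) -` {\<omega> i})" by auto
  moreover have "open ((\<lambda>\<eta> :: int \<Rightarrow> nat. \<eta> i) -` {\<omega> i})" for i
    by (rule open_vimage) (auto intro: discrete_topology_class.open_discrete)
  ultimately show ?thesis using F by auto
qed

text \<open>A unit spanning vector is fixed only up to sign, so \<open>e\<close> itself need not be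
  continuous. Near \<open>\<omega>0\<close> the sign is chosen to make an angle of at most pi/2 with
  \<open>e \<omega>0\<close>; nearby vectors then have nonnegative inner products, and the wedge
  bound controls their distance.\<close>

lemma cont_line_field_span:
  fixes e :: "(int \<Rightarrow> nat) \<Rightarrow> real^2" and d :: "nat \<Rightarrow> real"
  assumes norm_e: "\<And>\<omega>. \<omega> \<in> X \<Longrightarrow> norm (e \<omega>) = 1" and d: "d \<longlonglongrightarrow> 0"
    and close: "\<And>n \<omega> \<eta>. \<omega> \<in> X \<Longrightarrow> \<eta> \<in> X \<Longrightarrow> \<forall>i\<in>{- int (Suc n)..int (Suc n)}. \<eta> i = \<omega> i \<Longrightarrow>
      \<bar>wedge (e \<omega>) (e \<eta>)\<bar> \<le> d n"
  shows "cont_line_field X (\<lambda>\<omega>. span {e \<omega>})"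
  unfolding cont_line_field_def
proof
  fix \<omega>0 assume \<omega>0: "\<omega>0 \<in> X"
  define U where "U N \<omega> = {\<eta> :: int \<Rightarrow> nat. \<forall>i\<in>{- int (Suc N)..int (Suc N)}. \<eta> i = \<omega> i}" for N \<omega>
  have U: "open (U N \<omega>)" "\<omega> \<in> U N \<omega>" for N \<omega>
    using open_agree[of "{- int (Suc N)..int (Suc N)}" \<omega>] by (auto simp: U_def)
  have ev: "eventually (\<lambda>n. d n < a) sequentially" if "a > 0" for a
    using d that by (rule order_tendstoD)
  \<comment> \<open>A sine of at most 1/2 forces a cosine of at least 1/2 on this
    neighbourhood.\<close>
  obtain N where N: "d N < 1/2"
    using eventually_happens[OF ev[of "1/2"]] by auto
  define v where "v \<eta> = (if inner (e \<eta>) (e \<omega>0) \<ge> 0 then e \<eta> else - e \<eta>)" for \<eta>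
  have wedge_v: "\<bar>wedge (v \<eta>) (v \<zeta>)\<bar> = \<bar>wedge (e \<eta>) (e \<zeta>)\<bar>" for \<eta> \<zeta>
    by (auto simp: v_def wedge_def algebra_simps)
  have norm_v: "norm (v \<eta>) = 1" if "\<eta> \<in> X" for \<eta>
    using norm_e[OF that] by (simp add: v_def)
  have v0: "v \<omega>0 = e \<omega>0" by (simp add: v_def)
  have inner_v: "inner (v \<eta>) (e \<omega>0) \<ge> 0" for \<eta> by (simp add: v_def)
  have pos: "inner (v \<eta>) (v \<zeta>) \<ge> 0" if "\<eta> \<in> U N \<omega>0 \<inter> X" "\<zeta> \<in> U N \<omega>0 \<inter> X" for \<eta> \<zeta>
  proof -
    have small: "\<bar>wedge (v \<eta>) (e \<omega>0)\<bar> \<le> 1/2" if "\<eta> \<in> U N \<omega>0 \<inter> X" for \<eta>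
    proof -
      have "\<bar>wedge (e \<eta>) (e \<omega>0)\<bar> \<le> d N"
        using that \<omega>0 by (intro close) (auto simp: U_def)
      then show ?thesis using N wedge_v[of \<eta> \<omega>0] by (simp add: v0)
    qed
    have large: "inner (v \<eta>) (e \<omega>0) \<ge> 1/2" if "\<eta> \<in> U N \<omega>0 \<inter> X" for \<eta>
    proof -
      have "(wedge (v \<eta>) (e \<omega>0))\<^sup>2 \<le> (1/2)\<^sup>2"
        using power_mono[OF small[OF that], of 2] by simp
      then have "(inner (v \<eta>) (e \<omega>0))\<^sup>2 \<ge> (1/2)\<^sup>2"
        using wedge_inner_sq[of "v \<eta>" "e \<omega>0"] norm_v[of \<eta>] norm_e[OF \<omega>0] that
        by (simp add: power2_eq_square)
      then show ?thesis using inner_v by (rule power2_le_imp_le)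
    qed
    \<comment> \<open>Addition formula for the cosine: the product of cosines is at least 1/4, the
      product of sines at most 1/4 in absolute value.\<close>
    have "inner (v \<eta>) (v \<zeta>) * (norm (e \<omega>0))\<^sup>2 = inner (v \<eta>) (e \<omega>0) * inner (v \<zeta>) (e \<omega>0)
        + wedge (v \<eta>) (e \<omega>0) * wedge (v \<zeta>) (e \<omega>0)"
      unfolding norm_sq_2 by (simp add: wedge_def inner_2 power2_eq_square algebra_simps)
    moreover have "inner (v \<eta>) (e \<omega>0) * inner (v \<zeta>) (e \<omega>0) \<ge> (1/2) * (1/2)"
      using large[OF that(1)] large[OF that(2)] by (intro mult_mono) auto
    moreover have "\<bar>wedge (v \<eta>) (e \<omega>0) * wedge (v \<zeta>) (e \<omega>0)\<bar> \<le> (1/2) * (1/2)"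
      using small[OF that(1)] small[OF that(2)] unfolding abs_mult by (intro mult_mono) auto
    ultimately show ?thesis using norm_e[OF \<omega>0] by simp
  qed
  have "continuous_on (U N \<omega>0 \<inter> X) v"
    unfolding continuous_on_topological
  proof (intro ballI allI impI)
    fix \<eta> B assume \<eta>: "\<eta> \<in> U N \<omega>0 \<inter> X" and B: "open B" "v \<eta> \<in> B"
    then obtain \<epsilon> where \<epsilon>: "\<epsilon> > 0" "ball (v \<eta>) \<epsilon> \<subseteq> B" by (meson open_contains_ball)
    obtain n where n: "d n < \<epsilon>/2"
      using eventually_happens[OF ev[of "\<epsilon>/2"]] \<epsilon> by auto
    have "v \<zeta> \<in> B" if \<zeta>: "\<zeta> \<in> U N \<omega>0 \<inter> X" "\<zeta> \<in> U n \<eta>" for \<zeta>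
    proof -
      have w: "\<bar>wedge (v \<eta>) (v \<zeta>)\<bar> \<le> \<epsilon>/2"
        using close[of \<eta> \<zeta> n] \<eta> \<zeta> n by (auto simp: U_def wedge_v)
      have "(norm (v \<eta> - v \<zeta>))\<^sup>2 \<le> 2 * (wedge (v \<eta>) (v \<zeta>))\<^sup>2"
        using \<eta> \<zeta> pos by (intro norm_diff_sq_le_wedge norm_v) auto
      also have "\<dots> \<le> 2 * (\<epsilon>/2)\<^sup>2"
        using w power_mono[OF w, of 2] by simp
      also have "\<dots> < \<epsilon>\<^sup>2" using \<epsilon> by (simp add: power2_eq_square)
      finally have "norm (v \<eta> - v \<zeta>) < \<epsilon>" using \<epsilon>(1) by (meson less_eq_real_def power2_less_imp_less)
      then show ?thesis using \<epsilon>(2) by (auto simp: dist_norm)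
    qed
    then show "\<exists>A. open A \<and> \<eta> \<in> A \<and> (\<forall>y\<in>U N \<omega>0 \<inter> X. y \<in> A \<longrightarrow> v y \<in> B)"
      by (intro exI[of _ "U n \<eta>"] conjI U) blast
  qed
  moreover have "v \<eta> \<noteq> 0 \<and> span {e \<eta>} = span {v \<eta>}" if "\<eta> \<in> X" for \<eta>
  proof -
    have "span {- e \<eta>} = span {e \<eta>}"
      using span_neg[OF span_base[of "- e \<eta>" "{- e \<eta>}"]] span_neg[OF span_base[of "e \<eta>" "{e \<eta>}"]]
      by (intro equalityI span_minimal) auto
    then show ?thesis using norm_v[OF that] by (auto simp: v_def)
  qed
  ultimately show "\<exists>U. open U \<and> \<omega>0 \<in> U \<and> (\<exists>v. continuous_on (U \<inter> X) v \<and>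
      (\<forall>\<eta>\<in>U \<inter> X. v \<eta> \<noteq> 0 \<and> span {e \<eta>} = span {v \<eta>}))"
    by (intro exI[of _ "U N \<omega>0"] conjI U exI[of _ v]) auto
qed

text \<open>Compactness of the circle gives a limit along a subsequence, and that is enough: the
  sets decrease, so late terms of the subsequence lie in every \<open>D n\<close>. The approximating
  sequence is returned too, because invariance and transversality of the limit are proved by passing
  to it.\<close>

lemma collapsing_directions:
  fixes D :: "nat \<Rightarrow> (real^2) set" and c :: "nat \<Rightarrow> real"
  assumes ne: "\<And>n. D n \<noteq> {}" and nz: "\<And>n. 0 \<notin> D n" and dec: "\<And>n. D (Suc n) \<subseteq> D n"
    and small: "\<And>n x y. x \<in> D n \<Longrightarrow> y \<in> D n \<Longrightarrow> \<bar>wedge x y\<bar> \<le> c n * norm x * norm y"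
  obtains e x where "norm e = 1" "\<And>n. x n \<in> D n" "(\<lambda>n. x n /\<^sub>R norm (x n)) \<longlonglongrightarrow> e"
    "\<And>n y. y \<in> D n \<Longrightarrow> \<bar>wedge y e\<bar> \<le> c n * norm y"
proof -
  define y where "y n = (SOME x. x \<in> D n)" for n
  have y: "y n \<in> D n" for n using ne[of n] by (simp add: y_def some_in_eq)
  define u where "u n = y n /\<^sub>R norm (y n)" for n
  have u: "u n \<in> sphere 0 1" for n
    using y[of n] nz[of n] by (cases "y n = 0") (auto simp: u_def)
  obtain e r where e: "e \<in> sphere 0 1" and r: "strict_mono r" and lim: "(u \<circ> r) \<longlonglongrightarrow> e"
    using compact_imp_seq_compact[OF compact_sphere[of "0 :: real^2" 1]] u unfolding seq_compact_def by blast
  have anti: "D n \<subseteq> D m" if "m \<le> n" for m n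
    using lift_Suc_antimono_le[of D, OF dec that] .
  have rn: "y (r m) \<in> D n" if "m \<ge> n" for m n
    using y[of "r m"] anti[of n "r m"] seq_suble[OF r, of m] that by auto
  show ?thesis
  proof (rule that[of e "y \<circ> r"])
    show "norm e = 1" using e by simp
    show "(y \<circ> r) n \<in> D n" for n using rn[of n n] by simp
    show "(\<lambda>n. (y \<circ> r) n /\<^sub>R norm ((y \<circ> r) n)) \<longlonglongrightarrow> e" using lim by (simp add: u_def o_def)
    show "\<bar>wedge z e\<bar> \<le> c n * norm z" if z: "z \<in> D n" for n z
    proof (rule tendsto_upperbound)
      show "(\<lambda>m. \<bar>wedge z ((u \<circ> r) m)\<bar>) \<longlonglongrightarrow> \<bar>wedge z e\<bar>" by (intro tendsto_intros lim)
      have "\<bar>wedge z ((u \<circ> r) m)\<bar> \<le> c n * norm z" if "m \<ge> n" for m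
      proof -
        have "y (r m) \<noteq> 0" using rn[OF that] nz by metis
        then show ?thesis
          using small[OF z rn[OF that]] by (simp add: u_def abs_mult field_simps)
      qed
      then show "\<forall>\<^sub>F m in sequentially. \<bar>wedge z ((u \<circ> r) m)\<bar> \<le> c n * norm z"
        by (auto simp: eventually_sequentially)
    qed simp
  qed
qed

text \<open>Two directions that lie in the same sets up to depth \<open>n\<close> are \<open>2 c n\<close>-close, which
  turns local constancy of the sets into continuity of the limit line.\<close>

lemma collapsing_line_field:
  fixes D :: "nat \<Rightarrow> (int \<Rightarrow> nat) \<Rightarrow> (real^2) set" and c :: "nat \<Rightarrow> real"
  assumes ne: "\<And>n \<omega>. \<omega> \<in> X \<Longrightarrow> D n \<omega> \<noteq> {}" and nz: "\<And>n \<omega>. \<omega> \<in> X \<Longrightarrow> 0 \<notin> D n \<omega>"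
    and dec: "\<And>n \<omega>. \<omega> \<in> X \<Longrightarrow> D (Suc n) \<omega> \<subseteq> D n \<omega>"
    and small: "\<And>n \<omega> x y. \<omega> \<in> X \<Longrightarrow> x \<in> D n \<omega> \<Longrightarrow> y \<in> D n \<omega> \<Longrightarrow> \<bar>wedge x y\<bar> \<le> c n * norm x * norm y"
    and c: "c \<longlonglongrightarrow> 0"
    and loc: "\<And>n \<omega> \<eta>. \<omega> \<in> X \<Longrightarrow> \<eta> \<in> X \<Longrightarrow> \<forall>i\<in>{- int (Suc n)..int (Suc n)}. \<eta> i = \<omega> i \<Longrightarrow> D n \<eta> = D n \<omega>"
  obtains e where "cont_line_field X (\<lambda>\<omega>. span {e \<omega>})" "\<And>\<omega>. \<omega> \<in> X \<Longrightarrow> norm (e \<omega>) = 1"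
    "\<And>\<omega> n y. \<omega> \<in> X \<Longrightarrow> y \<in> D n \<omega> \<Longrightarrow> \<bar>wedge y (e \<omega>)\<bar> \<le> c n * norm y"
    "\<And>\<omega>. \<omega> \<in> X \<Longrightarrow> \<exists>x. (\<forall>n. x n \<in> D n \<omega>) \<and> (\<lambda>n. x n /\<^sub>R norm (x n)) \<longlonglongrightarrow> e \<omega>"
proof -
  have "\<exists>e. \<omega> \<in> X \<longrightarrow> norm e = 1 \<and> (\<forall>n. \<forall>y\<in>D n \<omega>. \<bar>wedge y e\<bar> \<le> c n * norm y) \<and>
      (\<exists>x. (\<forall>n. x n \<in> D n \<omega>) \<and> (\<lambda>n. x n /\<^sub>R norm (x n)) \<longlonglongrightarrow> e)" for \<omega>
  proof (cases "\<omega> \<in> X")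
    case True
    show ?thesis
      by (rule collapsing_directions[of "\<lambda>n. D n \<omega>" c, OF ne[OF True] nz[OF True] dec[OF True] small[OF True]])
        blast+
  qed simp
  then have "\<exists>e. \<forall>\<omega>. \<omega> \<in> X \<longrightarrow> norm (e \<omega>) = 1 \<and> (\<forall>n. \<forall>y\<in>D n \<omega>. \<bar>wedge y (e \<omega>)\<bar> \<le> c n * norm y) \<and>
      (\<exists>x. (\<forall>n. x n \<in> D n \<omega>) \<and> (\<lambda>n. x n /\<^sub>R norm (x n)) \<longlonglongrightarrow> e \<omega>)"
    by (intro choice) blast
  then obtain e where e: "\<And>\<omega>. \<omega> \<in> X \<Longrightarrow> norm (e \<omega>) = 1"
    "\<And>\<omega> n y. \<omega> \<in> X \<Longrightarrow> y \<in> D n \<omega> \<Longrightarrow> \<bar>wedge y (e \<omega>)\<bar> \<le> c n * norm y"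
    "\<And>\<omega>. \<omega> \<in> X \<Longrightarrow> \<exists>x. (\<forall>n. x n \<in> D n \<omega>) \<and> (\<lambda>n. x n /\<^sub>R norm (x n)) \<longlonglongrightarrow> e \<omega>"
    by blast
  have "cont_line_field X (\<lambda>\<omega>. span {e \<omega>})"
  proof (rule cont_line_field_span[where d = "\<lambda>n. 2 * c n"])
    show "(\<lambda>n. 2 * c n) \<longlonglongrightarrow> 0" using tendsto_mult_right_zero[OF c] by simp
    fix n \<omega> \<eta> assume *: "\<omega> \<in> X" "\<eta> \<in> X" "\<forall>i\<in>{- int (Suc n)..int (Suc n)}. \<eta> i = \<omega> i"
    obtain x where x: "x \<in> D n \<omega>" using ne[OF *(1)] by blast
    have x0: "x \<noteq> 0" using x nz[OF *(1)] by metis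
    have le: "\<bar>wedge x (e \<omega>)\<bar> \<le> c n * norm x" "\<bar>wedge x (e \<eta>)\<bar> \<le> c n * norm x"
      using e(2)[OF *(1) x] e(2)[of \<eta> x n] * x loc[OF *] by auto
    show "\<bar>wedge (e \<omega>) (e \<eta>)\<bar> \<le> 2 * c n"
      by (rule wedge_unit_triangle[of "x /\<^sub>R norm x"])
        (use x0 e(1) * le in \<open>auto simp: abs_mult field_simps\<close>)
  qed (use e in auto)
  then show ?thesis using e by (intro that) auto
qed

section \<open>A criterion for projective uniform hyperbolicity\<close>

lemma cocycle_pow_Suc_shift:
  "cocycle_pow M \<omega> (Suc n) = cocycle_pow M (shift \<omega>) n ** M (\<omega> 1)"
proof (induction n)
  case (Suc n)
  have "cocycle_pow M \<omega> (Suc (Suc n)) = M (\<omega> (int (Suc (Suc n)))) ** (cocycle_pow M (shift \<omega>) n ** M (\<omega> 1))"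
    by (simp only: cocycle_pow.simps(2)[of M \<omega> "Suc n"] Suc)
  also have "\<dots> = cocycle_pow M (shift \<omega>) (Suc n) ** M (\<omega> 1)"
    by (simp add: matrix_mul_assoc shift_def algebra_simps)
  finally show ?case .
qed simp

lemma cocycle_pow_cong:
  "(\<And>i. i \<in> {1..int n} \<Longrightarrow> \<omega> i = \<eta> i) \<Longrightarrow> cocycle_pow M \<omega> n = cocycle_pow M \<eta> n"
  by (induction n) auto

lemma det_cocycle_pow_nonneg:
  "(\<And>i. det (M (\<omega> i)) \<ge> 0) \<Longrightarrow> det (cocycle_pow M \<omega> n) \<ge> 0"
  by (induction n) (auto simp: det_mul)

lemma restr_norm_span:
  assumes "norm e = 1"
  shows "restr_norm A (span {e}) = norm (A *v e)"
proof -
  have "{norm (A *v u) | u. u \<in> span {e} \<and> norm u = 1} = {norm (A *v e)}"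
  proof (intro equalityI subsetI)
    fix r assume "r \<in> {norm (A *v u) | u. u \<in> span {e} \<and> norm u = 1}"
    then obtain a where "r = norm (A *v (a *\<^sub>R e))" "norm (a *\<^sub>R e) = 1"
      by (auto simp: span_singleton)
    then show "r \<in> {norm (A *v e)}" using assms by (simp add: matrix_vector_mult_scaleR)
  qed (use assms in \<open>auto intro: span_base exI[of _ e]\<close>)
  then show ?thesis by (simp add: restr_norm_def)
qed

lemma is_line_span: "norm e = 1 \<Longrightarrow> is_line (span {e})"
  by (auto simp: is_line_def dim_singleton)

lemma image_span_subset:
  assumes "(A :: real^2^2) *v e \<in> span {f}"
  shows "(\<lambda>v. A *v v) ` span {e} \<subseteq> span {f}"
proof -
  have "A *v (a *\<^sub>R e) \<in> span {f}" for a
    unfolding matrix_vector_mult_scaleR by (rule span_mul[OF assms])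
  then show ?thesis by (auto simp: span_singleton)
qed

text \<open>The error is relative to the norm of the image, so the conclusion survives when
  \<open>A\<close> kills the limit direction.\<close>

lemma wedge_limit_eq_0:
  assumes x: "\<And>n. x n \<noteq> 0" and lim: "(\<lambda>n. x n /\<^sub>R norm (x n)) \<longlonglongrightarrow> e" and c: "c \<longlonglongrightarrow> 0"
    and le: "\<And>n. \<bar>wedge (A *v x n) f\<bar> \<le> c n * norm (A *v x n)"
  shows "wedge (A *v e) f = 0"
proof -
  let ?u = "\<lambda>n. x n /\<^sub>R norm (x n)"
  have Au: "(\<lambda>n. A *v ?u n) \<longlonglongrightarrow> A *v e"
    by (rule bounded_linear.tendsto[OF matrix_vector_mul_bounded_linear lim])
  have "\<bar>wedge (A *v e) f\<bar> \<le> 0 * norm (A *v e)"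
  proof (rule LIMSEQ_le)
    show "(\<lambda>n. \<bar>wedge (A *v ?u n) f\<bar>) \<longlonglongrightarrow> \<bar>wedge (A *v e) f\<bar>" by (intro tendsto_intros Au)
    show "(\<lambda>n. c n * norm (A *v ?u n)) \<longlonglongrightarrow> 0 * norm (A *v e)" by (intro tendsto_intros Au c)
    have "\<bar>wedge (A *v ?u n) f\<bar> \<le> c n * norm (A *v ?u n)" for n
      using le[of n] x[of n] by (simp add: matrix_vector_mult_scaleR abs_mult field_simps)
    then show "\<exists>N. \<forall>n\<ge>N. \<bar>wedge (A *v ?u n) f\<bar> \<le> c n * norm (A *v ?u n)" by blast
  qed
  then show ?thesis by simp
qed

text \<open>Turns a growth estimate for squared norms of single vectors into one for the product of
  two norms, the quantity that bounds an area.\<close>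

lemma geometric_mean_le:
  assumes "0 \<le> (d::real)" "d * x\<^sup>2 \<le> c * X\<^sup>2" "d * y\<^sup>2 \<le> c * Y\<^sup>2" "0 \<le> c" "0 \<le> X" "0 \<le> Y"
  shows "d * (x * y) \<le> c * (X * Y)"
proof (rule power2_le_imp_le)
  have "(d * (x * y))\<^sup>2 = (d * x\<^sup>2) * (d * y\<^sup>2)" by (simp add: power2_eq_square algebra_simps)
  also have "\<dots> \<le> (c * X\<^sup>2) * (c * Y\<^sup>2)" by (rule mult_mono) (use assms in auto)
  also have "\<dots> = (c * (X * Y))\<^sup>2" by (simp add: power2_eq_square algebra_simps)
  finally show "(d * (x * y))\<^sup>2 \<le> (c * (X * Y))\<^sup>2" .
qed (use assms in auto)

lemma wedge_normalized:
  assumes "dl * norm x * norm y \<le> \<bar>wedge x y\<bar>" "x \<noteq> 0" "y \<noteq> 0"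
  shows "dl \<le> \<bar>wedge (x /\<^sub>R norm x) (y /\<^sub>R norm y)\<bar>"
  using assms by (simp add: abs_mult field_simps)

text \<open>\<open>G j\<close> consists of vectors living right after letter \<open>j\<close> has been applied, \<open>H i\<close> of vectors living
  right before letter \<open>i\<close> is applied; adjugates pull the latter back even through singular letters.\<close>

locale splitting_data =
  fixes k :: nat and P :: "nat \<Rightarrow> nat \<Rightarrow> real" and M :: "nat \<Rightarrow> real^2^2"
    and G H :: "nat \<Rightarrow> (real^2) set" and K lam dl :: real
  assumes det_nonneg: "\<And>i. i \<in> {1..k} \<Longrightarrow> det (M i) \<ge> 0"
    and lam: "0 < lam" "lam < 1" and K_pos: "K > 0" and dl_pos: "dl > 0"
    and G_ne: "\<And>j. j \<in> {1..k} \<Longrightarrow> G j \<noteq> {}" and H_ne: "\<And>j. j \<in> {1..k} \<Longrightarrow> H j \<noteq> {}"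
    and G_nz: "\<And>j v. v \<in> G j \<Longrightarrow> v \<noteq> 0" and H_nz: "\<And>j v. v \<in> H j \<Longrightarrow> v \<noteq> 0"
    and G_step: "\<And>i j v. i \<in> {1..k} \<Longrightarrow> j \<in> {1..k} \<Longrightarrow> P i j > 0 \<Longrightarrow> v \<in> G j \<Longrightarrow> M i *v v \<in> G i"
    and H_step: "\<And>i j h. i \<in> {1..k} \<Longrightarrow> j \<in> {1..k} \<Longrightarrow> P i j > 0 \<Longrightarrow> h \<in> H i \<Longrightarrow> adj2 (M j) *v h \<in> H j"
    and growth: "\<And>\<omega> n v. \<omega> \<in> shift_space k P \<Longrightarrow> v \<in> G (\<omega> 0) \<Longrightarrow>
      det (cocycle_pow M \<omega> n) * (norm v)\<^sup>2 \<le> K * lam ^ n * (norm (cocycle_pow M \<omega> n *v v))\<^sup>2"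
    and transv: "\<And>i j v h. i \<in> {1..k} \<Longrightarrow> j \<in> {1..k} \<Longrightarrow> P i j > 0 \<Longrightarrow> v \<in> G j \<Longrightarrow> h \<in> H i \<Longrightarrow>
      dl * norm v * norm h \<le> \<bar>wedge v h\<bar>"
begin

abbreviation "X \<equiv> shift_space k P"
abbreviation "C \<equiv> cocycle_pow M"

section \<open>Approximating direction sets of the two line fields\<close>

definition sh :: "int \<Rightarrow> (int \<Rightarrow> nat) \<Rightarrow> int \<Rightarrow> nat" where "sh a \<omega> = (\<lambda>n. \<omega> (n + a))"

text \<open>Approximates the dominating line at \<open>\<omega>\<close>: directions launched
  \<open>n\<close> steps in the past and pushed to time 0.\<close>

definition D1 :: "nat \<Rightarrow> (int \<Rightarrow> nat) \<Rightarrow> (real^2) set" where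
  "D1 n \<omega> = (\<lambda>g. C (sh (- int n) \<omega>) n *v g) ` G (\<omega> (- int n))"

text \<open>Approximates the dominated line from the future. The index is \<open>n + 1\<close>
  because \<open>C \<omega> n\<close> has read the letters 1 to \<open>n\<close>, and
  \<open>H i\<close> lives just before letter \<open>i\<close>.\<close>

definition D0 :: "nat \<Rightarrow> (int \<Rightarrow> nat) \<Rightarrow> (real^2) set" where
  "D0 n \<omega> = (\<lambda>h. adj2 (C \<omega> n) *v h) ` H (\<omega> (int n + 1))"

lemma X_letter: "\<omega> \<in> X \<Longrightarrow> \<omega> n \<in> {1..k}" "\<omega> \<in> X \<Longrightarrow> P (\<omega> (n + 1)) (\<omega> n) > 0"
  unfolding shift_space_def by blast+

lemma sh_X: "\<omega> \<in> X \<Longrightarrow> sh a \<omega> \<in> X"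
proof -
  assume "\<omega> \<in> X"
  then have "\<omega> (n + a) \<in> {1..k} \<and> P (\<omega> (n + a + 1)) (\<omega> (n + a)) > 0" for n
    unfolding shift_space_def by blast
  then show ?thesis by (simp add: shift_space_def sh_def algebra_simps)
qed

lemma shift_X: "\<omega> \<in> X \<Longrightarrow> shift \<omega> \<in> X"
  using sh_X[of \<omega> 1] by (simp add: sh_def shift_def)

lemma detC: "\<omega> \<in> X \<Longrightarrow> det (C \<omega> n) \<ge> 0"
  by (intro det_cocycle_pow_nonneg det_nonneg X_letter)

lemma G_cocycle: "\<omega> \<in> X \<Longrightarrow> v \<in> G (\<omega> 0) \<Longrightarrow> C \<omega> n *v v \<in> G (\<omega> (int n))"
proof (induction n)
  case (Suc n)
  have "M (\<omega> (int n + 1)) *v (C \<omega> n *v v) \<in> G (\<omega> (int n + 1))"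
    using Suc X_letter by (intro G_step[of _ "\<omega> (int n)"]) auto
  then show ?case by (simp add: matrix_vector_mul_assoc algebra_simps)
qed simp

lemma H_cocycle: "\<omega> \<in> X \<Longrightarrow> h \<in> H (\<omega> (int n + 1)) \<Longrightarrow> adj2 (C \<omega> n) *v h \<in> H (\<omega> 1)"
proof (induction n arbitrary: h)
  case (Suc n)
  have "adj2 (M (\<omega> (int n + 1))) *v h \<in> H (\<omega> (int n + 1))"
    using Suc.prems X_letter(2)[of \<omega> "int n + 1"] X_letter(1)[of \<omega>]
    by (intro H_step[of "\<omega> (int n + 2)"]) (auto simp: algebra_simps)
  then have "adj2 (C \<omega> n) *v (adj2 (M (\<omega> (int n + 1))) *v h) \<in> H (\<omega> 1)"
    by (intro Suc.IH Suc.prems)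
  then show ?case by (simp add: adj2_mult matrix_vector_mul_assoc algebra_simps)
qed simp

lemma D1_G: "\<omega> \<in> X \<Longrightarrow> x \<in> D1 n \<omega> \<Longrightarrow> x \<in> G (\<omega> 0)"
  using G_cocycle[OF sh_X, of \<omega> _ "- int n" n] by (auto simp: D1_def sh_def)

lemma D0_H: "\<omega> \<in> X \<Longrightarrow> x \<in> D0 n \<omega> \<Longrightarrow> x \<in> H (\<omega> 1)"
  using H_cocycle by (auto simp: D0_def)

lemma D1_shift: "x \<in> D1 n \<omega> \<Longrightarrow> M (\<omega> 1) *v x \<in> D1 (Suc n) (shift \<omega>)"
proof -
  have eq: "sh (- int (Suc n)) (shift \<omega>) = sh (- int n) \<omega>" "shift \<omega> (- int (Suc n)) = \<omega> (- int n)"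
    "sh (- int n) \<omega> (int (Suc n)) = \<omega> 1"
    by (auto simp: sh_def shift_def fun_eq_iff algebra_simps)
  assume "x \<in> D1 n \<omega>"
  then show ?thesis unfolding D1_def eq cocycle_pow.simps(2)
    by (auto simp: matrix_vector_mul_assoc)
qed

text \<open>Applying \<open>M (\<omega> 1)\<close> to such an \<open>x\<close> gives a determinant
  multiple of \<open>y\<close>. This makes the limit line invariant even when that letter is
  singular.\<close>

lemma D0_shift:
  assumes "x \<in> D0 (Suc n) \<omega>"
  obtains y where "y \<in> D0 n (shift \<omega>)" "x = adj2 (M (\<omega> 1)) *v y"
proof -
  obtain h where h: "h \<in> H (\<omega> (int (Suc n) + 1))" "x = adj2 (C \<omega> (Suc n)) *v h"
    using assms by (auto simp: D0_def)
  show ?thesis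
  proof (rule that)
    show "adj2 (C (shift \<omega>) n) *v h \<in> D0 n (shift \<omega>)"
      using h by (auto simp: D0_def shift_def algebra_simps)
    show "x = adj2 (M (\<omega> 1)) *v (adj2 (C (shift \<omega>) n) *v h)"
      by (simp only: h(2) cocycle_pow_Suc_shift adj2_mult matrix_vector_mul_assoc)
  qed
qed

text \<open>The oldest letter can be absorbed into the starting vector, which stays in the family
  \<open>G\<close>.\<close>

lemma D1_dec:
  assumes "\<omega> \<in> X" shows "D1 (Suc n) \<omega> \<subseteq> D1 n \<omega>"
proof
  fix x assume "x \<in> D1 (Suc n) \<omega>"
  then obtain g where g: "g \<in> G (\<omega> (- int (Suc n)))" "x = C (sh (- int (Suc n)) \<omega>) (Suc n) *v g"
    by (auto simp: D1_def)
  have "M (\<omega> (- int n)) *v g \<in> G (\<omega> (- int n))"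
    using g X_letter(2)[OF assms, of "- int (Suc n)"] X_letter(1)[OF assms] by (intro G_step) auto
  moreover have "shift (sh (- int (Suc n)) \<omega>) = sh (- int n) \<omega>" "sh (- int (Suc n)) \<omega> 1 = \<omega> (- int n)"
    by (auto simp: sh_def shift_def fun_eq_iff algebra_simps)
  ultimately show "x \<in> D1 n \<omega>"
    by (auto simp: D1_def g(2) cocycle_pow_Suc_shift matrix_vector_mul_assoc[symmetric] simp del: cocycle_pow.simps)
qed

lemma D0_dec:
  assumes "\<omega> \<in> X" shows "D0 (Suc n) \<omega> \<subseteq> D0 n \<omega>"
proof
  fix x assume "x \<in> D0 (Suc n) \<omega>"
  then obtain h where h: "h \<in> H (\<omega> (int n + 2))" "x = adj2 (C \<omega> (Suc n)) *v h"
    by (auto simp: D0_def algebra_simps)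
  have "adj2 (M (\<omega> (int n + 1))) *v h \<in> H (\<omega> (int n + 1))"
    using h X_letter(2)[OF assms, of "int n + 1"] X_letter(1)[OF assms]
    by (intro H_step[of "\<omega> (int n + 2)"]) (auto simp: algebra_simps)
  then show "x \<in> D0 n \<omega>"
    by (auto simp: D0_def h(2) adj2_mult matrix_vector_mul_assoc[symmetric] algebra_simps)
qed

text \<open>Areas are multiplied by the determinant, while each squared length grows by at least the
  determinant divided by \<open>K * lam ^ n\<close>; relative area therefore collapses.\<close>

lemma D1_small:
  assumes "\<omega> \<in> X" "x \<in> D1 n \<omega>" "y \<in> D1 n \<omega>"
  shows "\<bar>wedge x y\<bar> \<le> K * lam ^ n * norm x * norm y"
proof -
  let ?A = "C (sh (- int n) \<omega>) n"
  obtain g g' where g: "g \<in> G (sh (- int n) \<omega> 0)" "g' \<in> G (sh (- int n) \<omega> 0)" "x = ?A *v g" "y = ?A *v g'"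
    using assms by (auto simp: D1_def sh_def)
  have d: "det ?A \<ge> 0" by (intro detC sh_X assms)
  have "\<bar>wedge x y\<bar> = det ?A * \<bar>wedge g g'\<bar>" using d by (simp add: g wedge_matrix abs_mult)
  also have "\<dots> \<le> det ?A * (norm g * norm g')" using d abs_wedge_le by (intro mult_left_mono) auto
  also have "\<dots> \<le> K * lam ^ n * (norm x * norm y)"
    using d growth[OF sh_X[OF assms(1)]] g lam K_pos by (intro geometric_mean_le) auto
  finally show ?thesis by (simp add: mult.assoc)
qed

text \<open>Growth of forward vectors transfers to adjugate pullbacks by duality, at the price of
  two factors \<open>dl\<close>.\<close>

lemma D0_small:
  assumes "\<omega> \<in> X" "x \<in> D0 n \<omega>" "y \<in> D0 n \<omega>"
  shows "\<bar>wedge x y\<bar> \<le> K / dl\<^sup>2 * lam ^ n * norm x * norm y"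
proof -
  let ?A = "C \<omega> n"
  obtain h h' where h: "h \<in> H (\<omega> (int n + 1))" "h' \<in> H (\<omega> (int n + 1))" "x = adj2 ?A *v h" "y = adj2 ?A *v h'"
    using assms by (auto simp: D0_def)
  have d: "det ?A \<ge> 0" by (intro detC assms)
  obtain v where v: "v \<in> G (\<omega> 0)" using G_ne X_letter assms by blast
  have v0: "norm v > 0" using G_nz[OF v] by simp
  \<comment> \<open>\<open>h\<close> is paired with a forward image: \<open>wedge\<close> of
    \<open>?A *v v\<close> and \<open>h\<close> is at least \<open>dl\<close> times the norms, and
    moving \<open>?A\<close> across bounds it by the norms of \<open>v\<close> and the pullback. So
    the pullback of \<open>h\<close> grows at least like \<open>?A *v v\<close>.\<close>
  have dual: "det ?A * (norm h)\<^sup>2 \<le> K / dl\<^sup>2 * lam ^ n * (norm (adj2 ?A *v h))\<^sup>2" if h: "h \<in> H (\<omega> (int n + 1))" for h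
  proof -
    have "dl * norm (?A *v v) * norm h \<le> \<bar>wedge (?A *v v) h\<bar>"
      using X_letter assms h v G_cocycle by (intro transv[of "\<omega> (int n + 1)" "\<omega> (int n)"]) auto
    also have "\<dots> \<le> norm v * norm (adj2 ?A *v h)"
      unfolding wedge_adj2[symmetric] by (rule abs_wedge_le)
    finally have 1: "(dl * norm (?A *v v) * norm h)\<^sup>2 \<le> (norm v * norm (adj2 ?A *v h))\<^sup>2"
      using dl_pos by (intro power_mono) auto
    have "(norm v)\<^sup>2 * dl\<^sup>2 * (det ?A * (norm h)\<^sup>2) = dl\<^sup>2 * (norm h)\<^sup>2 * (det ?A * (norm v)\<^sup>2)" by simp
    also have "\<dots> \<le> dl\<^sup>2 * (norm h)\<^sup>2 * (K * lam ^ n * (norm (?A *v v))\<^sup>2)"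
      using growth[OF assms(1) v] by (intro mult_left_mono) auto
    also have "\<dots> = K * lam ^ n * (dl * norm (?A *v v) * norm h)\<^sup>2" by (simp add: power_mult_distrib)
    also have "\<dots> \<le> K * lam ^ n * (norm v * norm (adj2 ?A *v h))\<^sup>2"
      using 1 K_pos lam by (intro mult_left_mono) auto
    finally have "(norm v)\<^sup>2 * (dl\<^sup>2 * (det ?A * (norm h)\<^sup>2)) \<le> (norm v)\<^sup>2 * (K * lam ^ n * (norm (adj2 ?A *v h))\<^sup>2)"
      by (simp add: power_mult_distrib mult_ac)
    then have "dl\<^sup>2 * (det ?A * (norm h)\<^sup>2) \<le> K * lam ^ n * (norm (adj2 ?A *v h))\<^sup>2"
      using v0 by simp
    then show ?thesis using dl_pos by (simp add: field_simps)
  qed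
  have "\<bar>wedge x y\<bar> = det ?A * \<bar>wedge h h'\<bar>" using d by (simp add: h wedge_matrix abs_mult)
  also have "\<dots> \<le> det ?A * (norm h * norm h')" using d abs_wedge_le by (intro mult_left_mono) auto
  also have "\<dots> \<le> K / dl\<^sup>2 * lam ^ n * (norm x * norm y)"
    using d dual h lam K_pos by (intro geometric_mean_le) auto
  finally show ?thesis by (simp add: mult.assoc)
qed

theorem splitting_hyperbolic: "proj_unif_hyperbolic k P M"
proof -
  have lamn: "(\<lambda>n. a * lam ^ n) \<longlonglongrightarrow> 0" for a
    using lam by (intro tendsto_mult_right_zero LIMSEQ_power_zero) auto
  have ne1: "D1 n \<omega> \<noteq> {}" and ne0: "D0 n \<omega> \<noteq> {}" if "\<omega> \<in> X" for n \<omega>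
    using G_ne H_ne X_letter that by (auto simp: D1_def D0_def)
  have nz1: "0 \<notin> D1 n \<omega>" and nz0: "0 \<notin> D0 n \<omega>" if "\<omega> \<in> X" for n \<omega>
    using D1_G D0_H G_nz H_nz that by blast+
  \<comment> \<open>The window reaches \<open>n + 1\<close> because \<open>D0 n\<close> reads that
    letter through \<open>H\<close>.\<close>
  have loc1: "D1 n \<eta> = D1 n \<omega>" and loc0: "D0 n \<eta> = D0 n \<omega>"
    if "\<forall>i\<in>{- int (Suc n)..int (Suc n)}. \<eta> i = \<omega> i" for n \<omega> \<eta>
  proof -
    have "\<eta> (- int n) = \<omega> (- int n)" "\<eta> (int n + 1) = \<omega> (int n + 1)" using that by auto
    moreover have "C (sh (- int n) \<eta>) n = C (sh (- int n) \<omega>) n" "C \<eta> n = C \<omega> n"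
      using that by (auto intro!: cocycle_pow_cong simp: sh_def)
    ultimately show "D1 n \<eta> = D1 n \<omega>" "D0 n \<eta> = D0 n \<omega>" by (auto simp: D1_def D0_def)
  qed
  obtain e1 where cont1: "cont_line_field X (\<lambda>\<omega>. span {e1 \<omega>})"
    and norm1: "\<And>\<omega>. \<omega> \<in> X \<Longrightarrow> norm (e1 \<omega>) = 1"
    and near1: "\<And>\<omega> n y. \<omega> \<in> X \<Longrightarrow> y \<in> D1 n \<omega> \<Longrightarrow> \<bar>wedge y (e1 \<omega>)\<bar> \<le> K * lam ^ n * norm y"
    and lim1: "\<And>\<omega>. \<omega> \<in> X \<Longrightarrow> \<exists>x. (\<forall>n. x n \<in> D1 n \<omega>) \<and> (\<lambda>n. x n /\<^sub>R norm (x n)) \<longlonglongrightarrow> e1 \<omega>"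
    by (rule collapsing_line_field[of X D1 "\<lambda>n. K * lam ^ n"])
      (use ne1 nz1 D1_dec D1_small lamn loc1 in auto)
  obtain e0 where cont0: "cont_line_field X (\<lambda>\<omega>. span {e0 \<omega>})"
    and norm0: "\<And>\<omega>. \<omega> \<in> X \<Longrightarrow> norm (e0 \<omega>) = 1"
    and near0: "\<And>\<omega> n y. \<omega> \<in> X \<Longrightarrow> y \<in> D0 n \<omega> \<Longrightarrow> \<bar>wedge y (e0 \<omega>)\<bar> \<le> K / dl\<^sup>2 * lam ^ n * norm y"
    and lim0: "\<And>\<omega>. \<omega> \<in> X \<Longrightarrow> \<exists>x. (\<forall>n. x n \<in> D0 n \<omega>) \<and> (\<lambda>n. x n /\<^sub>R norm (x n)) \<longlonglongrightarrow> e0 \<omega>"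
    by (rule collapsing_line_field[of X D0 "\<lambda>n. K / dl\<^sup>2 * lam ^ n"])
      (use ne0 nz0 D0_dec D0_small lamn[of "K / dl\<^sup>2"] loc0 in auto)
  have lines: "is_line (span {e0 \<omega>}) \<and> is_line (span {e1 \<omega>}) \<and> span {e0 \<omega>} \<inter> span {e1 \<omega>} = {0} \<and>
      (\<lambda>v. M (\<omega> 1) *v v) ` span {e0 \<omega>} \<subseteq> span {e0 (shift \<omega>)} \<and>
      (\<lambda>v. M (\<omega> 1) *v v) ` span {e1 \<omega>} \<subseteq> span {e1 (shift \<omega>)}" if \<omega>: "\<omega> \<in> X" for \<omega>
  proof -
    obtain x where x: "\<And>n. x n \<in> D1 n \<omega>" "(\<lambda>n. x n /\<^sub>R norm (x n)) \<longlonglongrightarrow> e1 \<omega>" using lim1[OF \<omega>] by auto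
    obtain y where y: "\<And>n. y n \<in> D0 n \<omega>" "(\<lambda>n. y n /\<^sub>R norm (y n)) \<longlonglongrightarrow> e0 \<omega>" using lim0[OF \<omega>] by auto
    have x0: "x n \<noteq> 0" and y0: "y n \<noteq> 0" for n using x(1)[of n] y(1)[of n] nz1[OF \<omega>, of n] nz0[OF \<omega>, of n] by auto
    \<comment> \<open>Both approximating sequences are transversal at the junction of letters 0 and
      1, and the uniform angle survives the limit.\<close>
    have "dl \<le> \<bar>wedge (e1 \<omega>) (e0 \<omega>)\<bar>"
    proof (rule tendsto_lowerbound)
      show "(\<lambda>n. \<bar>wedge (x n /\<^sub>R norm (x n)) (y n /\<^sub>R norm (y n))\<bar>) \<longlonglongrightarrow> \<bar>wedge (e1 \<omega>) (e0 \<omega>)\<bar>"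
        by (intro tendsto_intros x y)
      have "dl \<le> \<bar>wedge (x n /\<^sub>R norm (x n)) (y n /\<^sub>R norm (y n))\<bar>" for n
        using X_letter[OF \<omega>, of 0] X_letter(1)[OF \<omega>, of 1] D1_G[OF \<omega> x(1)[of n]] D0_H[OF \<omega> y(1)[of n]]
        by (intro wedge_normalized transv[of "\<omega> 1" "\<omega> 0"] x0 y0) auto
      then show "\<forall>\<^sub>F n in sequentially. dl \<le> \<bar>wedge (x n /\<^sub>R norm (x n)) (y n /\<^sub>R norm (y n))\<bar>" by simp
    qed simp
    then have w: "wedge (e1 \<omega>) (e0 \<omega>) \<noteq> 0" using dl_pos by auto
    have int: "span {e0 \<omega>} \<inter> span {e1 \<omega>} = {0}"
    proof -
      have "z = 0" if z: "z \<in> span {e0 \<omega>}" "z \<in> span {e1 \<omega>}" for z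
      proof -
        obtain a where a: "z = a *\<^sub>R e1 \<omega>" using z(2) by (auto simp: span_singleton)
        have "a * wedge (e1 \<omega>) (e0 \<omega>) = 0" using span_imp_wedge_eq_0[OF z(1)] by (simp add: a)
        then show ?thesis using w a by simp
      qed
      then show ?thesis by (auto simp: span_zero)
    qed
    have "wedge (M (\<omega> 1) *v e1 \<omega>) (e1 (shift \<omega>)) = 0"
    proof (rule wedge_limit_eq_0[OF x0 x(2)])
      show "(\<lambda>n. K * lam * lam ^ n) \<longlonglongrightarrow> 0" by (rule lamn)
      show "\<bar>wedge (M (\<omega> 1) *v x n) (e1 (shift \<omega>))\<bar> \<le> K * lam * lam ^ n * norm (M (\<omega> 1) *v x n)" for n
        using near1[OF shift_X[OF \<omega>] D1_shift[OF x(1)[of n]]] by simp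
    qed
    then have inv1: "(\<lambda>v. M (\<omega> 1) *v v) ` span {e1 \<omega>} \<subseteq> span {e1 (shift \<omega>)}"
      using norm1[OF shift_X[OF \<omega>]] by (intro image_span_subset wedge_eq_0_imp_span) auto
    \<comment> \<open>The sequence is advanced by one because \<open>D0_shift\<close> loses one
      level.\<close>
    have "wedge (M (\<omega> 1) *v e0 \<omega>) (e0 (shift \<omega>)) = 0"
    proof (rule wedge_limit_eq_0[of "\<lambda>n. y (Suc n)"])
      show "(\<lambda>n. y (Suc n) /\<^sub>R norm (y (Suc n))) \<longlonglongrightarrow> e0 \<omega>" using LIMSEQ_Suc[OF y(2)] .
      show "(\<lambda>n. K / dl\<^sup>2 * lam ^ n) \<longlonglongrightarrow> 0" by (rule lamn)
      show "\<bar>wedge (M (\<omega> 1) *v y (Suc n)) (e0 (shift \<omega>))\<bar> \<le> K / dl\<^sup>2 * lam ^ n * norm (M (\<omega> 1) *v y (Suc n))" for n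
      proof -
        obtain z where z: "z \<in> D0 n (shift \<omega>)" "y (Suc n) = adj2 (M (\<omega> 1)) *v z"
          by (rule D0_shift[OF y(1)[of "Suc n"]])
        show ?thesis
          using mult_left_mono[OF near0[OF shift_X[OF \<omega>] z(1)], of "\<bar>det (M (\<omega> 1))\<bar>"]
          by (simp add: z(2) mult_adj2 abs_mult mult_ac)
      qed
    qed (use y0 in auto)
    then have inv0: "(\<lambda>v. M (\<omega> 1) *v v) ` span {e0 \<omega>} \<subseteq> span {e0 (shift \<omega>)}"
      using norm0[OF shift_X[OF \<omega>]] by (intro image_span_subset wedge_eq_0_imp_span) auto
    show ?thesis using int inv0 inv1 is_line_span norm0[OF \<omega>] norm1[OF \<omega>] by blast
  qed
  have "\<forall>\<^sub>F n in sequentially. K / dl * lam ^ n < 1"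
    using lamn by (rule order_tendstoD) simp
  \<comment> \<open>The ratio of the two restricted norms will be bounded by
    \<open>K / dl * lam ^ n\<close>, so this \<open>n\<close> serves all sequences at once.\<close>
  then obtain n where n: "K / dl * lam ^ n < 1" using eventually_happens by fastforce
  have dom: "restr_norm (C \<omega> n) (span {e0 \<omega>}) < restr_norm (C \<omega> n) (span {e1 \<omega>})" if \<omega>: "\<omega> \<in> X" for \<omega>
  proof -
    let ?A = "C \<omega> n"
    obtain x where x: "\<And>n. x n \<in> D1 n \<omega>" "(\<lambda>n. x n /\<^sub>R norm (x n)) \<longlonglongrightarrow> e1 \<omega>" using lim1[OF \<omega>] by auto
    obtain y where y: "\<And>n. y n \<in> D0 n \<omega>" "(\<lambda>n. y n /\<^sub>R norm (y n)) \<longlonglongrightarrow> e0 \<omega>" using lim0[OF \<omega>] by auto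
    let ?u = "\<lambda>n. x n /\<^sub>R norm (x n)" and ?w = "\<lambda>n. y n /\<^sub>R norm (y n)"
    have x0: "x n \<noteq> 0" and y0: "y n \<noteq> 0" for n using x(1)[of n] y(1)[of n] nz1[OF \<omega>, of n] nz0[OF \<omega>, of n] by auto
    have xG: "x m \<in> G (\<omega> 0)" for m using D1_G[OF \<omega> x(1)] .
    have T1: "\<omega> 1 \<in> {1..k}" "\<omega> 0 \<in> {1..k}" "P (\<omega> 1) (\<omega> 0) > 0"
      and Tn: "\<omega> (int n + 1) \<in> {1..k}" "\<omega> (int n) \<in> {1..k}" "P (\<omega> (int n + 1)) (\<omega> (int n)) > 0"
      using X_letter[OF \<omega>, of 0] X_letter(1)[OF \<omega>, of 1] X_letter[OF \<omega>, of "int n"] X_letter(1)[OF \<omega>, of "int n + 1"]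
      by auto
    have Au: "(\<lambda>m. ?A *v ?u m) \<longlonglongrightarrow> ?A *v e1 \<omega>"
      by (rule bounded_linear.tendsto[OF matrix_vector_mul_bounded_linear x(2)])
    have Aw: "(\<lambda>m. ?A *v ?w m) \<longlonglongrightarrow> ?A *v e0 \<omega>"
      by (rule bounded_linear.tendsto[OF matrix_vector_mul_bounded_linear y(2)])
    have grow: "det ?A \<le> K * lam ^ n * (norm (?A *v e1 \<omega>))\<^sup>2"
    proof (rule tendsto_lowerbound)
      show "(\<lambda>m. K * lam ^ n * (norm (?A *v ?u m))\<^sup>2) \<longlonglongrightarrow> K * lam ^ n * (norm (?A *v e1 \<omega>))\<^sup>2"
        by (intro tendsto_intros Au)
      have "det ?A \<le> K * lam ^ n * (norm (?A *v ?u m))\<^sup>2" for m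
        using growth[OF \<omega> xG[of m], of n] x0[of m]
        by (simp add: matrix_vector_mult_scaleR power_mult_distrib power2_eq_square field_simps)
      then show "\<forall>\<^sub>F m in sequentially. det ?A \<le> K * lam ^ n * (norm (?A *v ?u m))\<^sup>2" by simp
    qed simp
    \<comment> \<open>The images of the unit vectors span an area of at most \<open>det ?A\<close>,
      but by transversality at time \<open>n\<close> at least \<open>dl\<close> times the product of
      their lengths.\<close>
    have area: "dl * (norm (?A *v e1 \<omega>) * norm (?A *v e0 \<omega>)) \<le> det ?A"
    proof (rule tendsto_upperbound)
      show "(\<lambda>m. dl * (norm (?A *v ?u m) * norm (?A *v ?w m))) \<longlonglongrightarrow> dl * (norm (?A *v e1 \<omega>) * norm (?A *v e0 \<omega>))"
        by (intro tendsto_intros Au Aw)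
      have "dl * (norm (?A *v ?u m) * norm (?A *v ?w m)) \<le> det ?A" if "m \<ge> n" for m
      proof -
        \<comment> \<open>Only for \<open>m \<ge> n\<close> is \<open>y m\<close> an adjugate image
          under \<open>?A\<close>, so that \<open>?A *v y m\<close> is a multiple of a vector of
          \<open>H\<close>.\<close>
        have "y m \<in> D0 n \<omega>" using y(1)[of m] lift_Suc_antimono_le[of "\<lambda>n. D0 n \<omega>", OF D0_dec[OF \<omega>] that] by auto
        then obtain h where h: "h \<in> H (\<omega> (int n + 1))" "y m = adj2 ?A *v h" by (auto simp: D0_def)
        have Ay: "?A *v y m = det ?A *\<^sub>R h" by (simp add: h(2) mult_adj2)
        have d: "det ?A \<ge> 0" by (rule detC[OF \<omega>])
        have "dl * (norm (?A *v x m) * norm (?A *v y m)) = det ?A * (dl * norm (?A *v x m) * norm h)"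
          using d by (simp add: Ay)
        also have "\<dots> \<le> det ?A * \<bar>wedge (?A *v x m) h\<bar>"
          using d G_cocycle[OF \<omega> xG] h by (intro mult_left_mono transv[OF Tn]) auto
        also have "\<dots> = \<bar>wedge (?A *v x m) (?A *v y m)\<bar>" using d by (simp add: Ay abs_mult)
        also have "\<dots> = det ?A * \<bar>wedge (x m) (y m)\<bar>" using d by (simp add: wedge_matrix abs_mult)
        also have "\<dots> \<le> det ?A * (norm (x m) * norm (y m))" using d abs_wedge_le by (intro mult_left_mono) auto
        finally show ?thesis using x0[of m] y0[of m]
          by (simp add: matrix_vector_mult_scaleR field_simps)
      qed
      then show "\<forall>\<^sub>F m in sequentially. dl * (norm (?A *v ?u m) * norm (?A *v ?w m)) \<le> det ?A"
        by (auto simp: eventually_sequentially)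
    qed simp
    \<comment> \<open>Strict domination needs this: if \<open>?A\<close> killed
      \<open>e1 \<omega>\<close>, the wedge with a pullback \<open>adj2 ?A *v h\<close> would
      vanish, against transversality.\<close>
    have "?A *v e1 \<omega> \<noteq> 0"
    proof
      assume 0: "?A *v e1 \<omega> = 0"
      obtain h where h: "h \<in> H (\<omega> (int n + 1))" using H_ne[OF Tn(1)] by auto
      let ?h = "adj2 ?A *v h"
      have hH: "?h \<in> H (\<omega> 1)" by (rule H_cocycle[OF \<omega> h])
      have "dl * norm ?h \<le> \<bar>wedge (e1 \<omega>) ?h\<bar>"
      proof (rule tendsto_lowerbound)
        show "(\<lambda>m. \<bar>wedge (?u m) ?h\<bar>) \<longlonglongrightarrow> \<bar>wedge (e1 \<omega>) ?h\<bar>" by (intro tendsto_intros x)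
        have "dl * norm ?h \<le> \<bar>wedge (?u m) ?h\<bar>" for m
          using transv[OF T1 xG[of m] hH] x0[of m] by (simp add: abs_mult field_simps)
        then show "\<forall>\<^sub>F m in sequentially. dl * norm ?h \<le> \<bar>wedge (?u m) ?h\<bar>" by simp
      qed simp
      then have "dl * norm ?h \<le> 0" by (simp add: wedge_adj2 0)
      then show False using dl_pos H_nz[OF hH] by (simp add: mult_le_0_iff)
    qed
    then have e1: "norm (?A *v e1 \<omega>) > 0" by simp
    have "norm (?A *v e1 \<omega>) * (dl * norm (?A *v e0 \<omega>)) \<le> norm (?A *v e1 \<omega>) * (K * lam ^ n * norm (?A *v e1 \<omega>))"
      using area grow by (simp add: power2_eq_square mult_ac)
    then have "dl * norm (?A *v e0 \<omega>) \<le> K * lam ^ n * norm (?A *v e1 \<omega>)" using e1 by simp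
    then have "norm (?A *v e0 \<omega>) \<le> K / dl * lam ^ n * norm (?A *v e1 \<omega>)" using dl_pos by (simp add: field_simps)
    also have "\<dots> < 1 * norm (?A *v e1 \<omega>)" using n e1 by (rule mult_strict_right_mono)
    finally show ?thesis by (simp add: restr_norm_span norm0[OF \<omega>] norm1[OF \<omega>])
  qed
  show ?thesis
    unfolding proj_unif_hyperbolic_def Let_def
    by (rule exI[of _ "\<lambda>\<omega>. span {e0 \<omega>}"], rule exI[of _ "\<lambda>\<omega>. span {e1 \<omega>}"])
      (intro conjI cont0 cont1 ballI lines exI[of _ n] dom)
qed

end

section \<open>Angles of planar curves\<close>

definition dir :: "real \<Rightarrow> real^2" where
  "dir \<theta> = vector [cos \<theta>, sin \<theta>]"

lemma dir_nth [simp]: "dir \<theta> $ 1 = cos \<theta>" "dir \<theta> $ 2 = sin \<theta>"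
  by (simp_all add: dir_def)

lemma norm_dir [simp]: "norm (dir \<theta>) = 1"
proof -
  have "(norm (dir \<theta>))\<^sup>2 = 1" unfolding norm_sq_2 by simp
  then show ?thesis using norm_ge_zero[of "dir \<theta>"] by (simp add: power2_eq_1_iff)
qed

lemma dir_nonzero [simp]: "dir \<theta> \<noteq> 0"
  using norm_dir[of \<theta>] by (metis norm_zero zero_neq_one)

lemma wedge_dir: "wedge (dir a) (dir b) = sin (b - a)"
  by (simp add: wedge_def sin_diff)

lemma inner_dir: "inner (dir a) (dir b) = cos (b - a)"
  by (simp add: inner_2 cos_diff algebra_simps)

lemma continuous_on_vec2:
  fixes f :: "'a::topological_space \<Rightarrow> real^2"
  assumes "continuous_on S (\<lambda>x. f x $ 1)" "continuous_on S (\<lambda>x. f x $ 2)"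
  shows "continuous_on S f"
proof -
  have "continuous_on S (\<lambda>x. f x $ i)" for i using assms exhaust_2[of i] by auto
  then have "continuous_on S (\<lambda>x. \<chi> i. f x $ i)" by (rule continuous_on_vec_lambda)
  then show ?thesis by simp
qed

lemma continuous_on_dir [continuous_intros]:
  fixes f :: "'a::t2_space \<Rightarrow> real"
  shows "continuous_on S f \<Longrightarrow> continuous_on S (\<lambda>x. dir (f x))"
  by (rule continuous_on_vec2) (auto intro!: continuous_intros)

text \<open>The imaginary part of a continuous complex logarithm, which exists because a convex set
  is contractible.\<close>

lemma angle_lift:
  fixes f :: "'a::real_normed_vector \<Rightarrow> real^2"
  assumes "convex S" "continuous_on S f" "\<And>x. x \<in> S \<Longrightarrow> f x \<noteq> 0"
  obtains \<phi> where "continuous_on S \<phi>" "\<And>x. x \<in> S \<Longrightarrow> f x = norm (f x) *\<^sub>R dir (\<phi> x)"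
proof -
  have "continuous_on S (\<lambda>x. Complex (f x $ 1) (f x $ 2))"
    using assms(2) by (intro continuous_intros)
  moreover have "Complex (f x $ 1) (f x $ 2) \<noteq> 0" if "x \<in> S" for x
    using assms(3)[OF that] by (auto simp: vec2_eq_iff complex_eq_iff)
  ultimately obtain g where g: "continuous_on S g" "\<And>x. x \<in> S \<Longrightarrow> Complex (f x $ 1) (f x $ 2) = exp (g x)"
    using continuous_logarithm_on_contractible[OF _ convex_imp_contractible[OF assms(1)]] by blast
  show ?thesis
  proof (rule that[of "\<lambda>x. Im (g x)"])
    show "continuous_on S (\<lambda>x. Im (g x))" using g(1) by (intro continuous_intros)
    fix x assume x: "x \<in> S"
    have eq: "f x $ 1 = exp (Re (g x)) * cos (Im (g x))" "f x $ 2 = exp (Re (g x)) * sin (Im (g x))"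
      using g(2)[OF x] by (simp_all add: complex_eq_iff Re_exp Im_exp)
    then have "f x = exp (Re (g x)) *\<^sub>R dir (Im (g x))" by (simp add: vec2_eq_iff)
    then show "f x = norm (f x) *\<^sub>R dir (Im (g x))" by simp
  qed
qed

text \<open>Near \<open>s\<close> the angle is its value at \<open>s\<close> plus the arctangent of
  \<open>wedge\<close> over \<open>inner\<close>. The wedge vanishes at \<open>s\<close>, so only
  the derivative of the numerator contributes there.\<close>

lemma angle_has_derivative:
  fixes f :: "real \<Rightarrow> real^2"
  assumes f': "(f has_vector_derivative f') (at s)" and \<phi>: "isCont \<phi> s" and nz: "f s \<noteq> 0"
    and ev: "\<forall>\<^sub>F x in nhds s. f x = norm (f x) *\<^sub>R dir (\<phi> x)"
  shows "(\<phi> has_real_derivative wedge (f s) f' / (norm (f s))\<^sup>2) (at s)"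
proof -
  have fs: "f s = norm (f s) *\<^sub>R dir (\<phi> s)" using eventually_nhds_x_imp_x[OF ev] .
  have d: "((\<lambda>x. f x $ i) has_real_derivative f' $ i) (at s)" for i
    using bounded_linear.has_vector_derivative[OF bounded_linear_vec_nth f', of i]
    by (simp add: has_real_derivative_iff_has_vector_derivative)
  have dw: "((\<lambda>x. wedge (f s) (f x)) has_real_derivative wedge (f s) f') (at s)"
    unfolding wedge_def by (auto intro!: derivative_eq_intros d)
  have di: "((\<lambda>x. inner (f s) (f x)) has_real_derivative inner (f s) f') (at s)"
    unfolding inner_2 by (auto intro!: derivative_eq_intros d)
  have ns: "inner (f s) (f s) \<noteq> 0" using nz by simp
  have D: "((\<lambda>x. \<phi> s + arctan (wedge (f s) (f x) / inner (f s) (f x))) has_real_derivative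
      wedge (f s) f' / (norm (f s))\<^sup>2) (at s)"
    unfolding power2_norm_eq_inner using ns by (auto intro!: derivative_eq_intros dw di)
  have "isCont f s" using f' by (simp add: has_vector_derivative_continuous)
  then have "(f \<longlongrightarrow> f s) (nhds s)" by (simp add: continuous_at tendsto_at_iff_tendsto_nhds)
  then have "\<forall>\<^sub>F x in nhds s. f x \<noteq> 0" using nz by (rule tendsto_imp_eventually_ne)
  moreover have "\<forall>\<^sub>F x in nhds s. \<bar>\<phi> x - \<phi> s\<bar> < pi / 2"
  proof -
    have "((\<lambda>x. \<bar>\<phi> x - \<phi> s\<bar>) \<longlongrightarrow> \<bar>\<phi> s - \<phi> s\<bar>) (nhds s)"
      using \<phi> by (intro tendsto_intros) (simp add: continuous_at tendsto_at_iff_tendsto_nhds)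
    then show ?thesis by (rule order_tendstoD) auto
  qed
  ultimately have "\<forall>\<^sub>F x in nhds s. \<phi> x = \<phi> s + arctan (wedge (f s) (f x) / inner (f s) (f x))"
    using ev
  proof eventually_elim
    case (elim x)
    have w: "wedge (f s) (f x) = norm (f s) * norm (f x) * sin (\<phi> x - \<phi> s)"
      by (subst fs, subst elim(3)) (simp add: wedge_dir)
    have i: "inner (f s) (f x) = norm (f s) * norm (f x) * cos (\<phi> x - \<phi> s)"
      by (subst fs, subst elim(3)) (simp add: inner_dir)
    have "wedge (f s) (f x) / inner (f s) (f x) = tan (\<phi> x - \<phi> s)"
      unfolding w i using nz elim(1) by (simp add: tan_def)
    moreover have "arctan (tan (\<phi> x - \<phi> s)) = \<phi> x - \<phi> s" using elim(2) by (intro arctan_tan) linarith+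
    ultimately show ?case by simp
  qed
  then show ?thesis using D by (subst DERIV_cong_ev[OF refl _ refl]) auto
qed

lemma angle_lift_has_derivative:
  fixes f :: "real \<Rightarrow> real^2"
  assumes "open I" and \<phi>: "continuous_on I \<phi>" and f': "(f has_vector_derivative f') (at s)"
    and lift: "\<And>s. s \<in> I \<Longrightarrow> f s = norm (f s) *\<^sub>R dir (\<phi> s)" and nz: "f s \<noteq> 0" and s: "s \<in> I"
  shows "(\<phi> has_real_derivative wedge (f s) f' / (norm (f s))\<^sup>2) (at s)"
proof (rule angle_has_derivative[OF f' _ nz])
  show "isCont \<phi> s" using assms by (simp add: continuous_on_eq_continuous_at)
  show "\<forall>\<^sub>F y in nhds s. f y = norm (f y) *\<^sub>R dir (\<phi> y)"
    using lift eventually_nhds_in_open[OF assms(1) s] by (auto elim: eventually_mono)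
qed

lemma angle_increase:
  fixes f :: "real \<Rightarrow> real^2"
  assumes I: "is_interval I" "open I" and \<phi>: "continuous_on I \<phi>"
    and f': "\<And>s. s \<in> I \<Longrightarrow> (f has_vector_derivative f' s) (at s)"
    and lift: "\<And>s. s \<in> I \<Longrightarrow> f s = norm (f s) *\<^sub>R dir (\<phi> s)" and nz: "\<And>s. s \<in> I \<Longrightarrow> f s \<noteq> 0"
    and rate: "\<And>s. s \<in> I \<Longrightarrow> wedge (f s) (f' s) / (norm (f s))\<^sup>2 \<ge> c"
    and s: "s \<in> I" "s' \<in> I" "s \<le> s'"
  shows "\<phi> s' - \<phi> s \<ge> c * (s' - s)"
proof -
  have "\<phi> s - c * s \<le> \<phi> s' - c * s'"
  proof (rule DERIV_nonneg_imp_nondecreasing[OF s(3), of "\<lambda>x. \<phi> x - c * x"])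
    fix x assume "s \<le> x" "x \<le> s'"
    then have x: "x \<in> I" using I(1) s unfolding is_interval_1 by blast
    have "(\<phi> has_real_derivative wedge (f x) (f' x) / (norm (f x))\<^sup>2) (at x)"
      by (rule angle_lift_has_derivative[OF I(2) \<phi> f'[OF x] lift nz[OF x] x])
    then have "((\<lambda>x. \<phi> x - c * x) has_real_derivative wedge (f x) (f' x) / (norm (f x))\<^sup>2 - c) (at x)"
      by (auto intro!: derivative_eq_intros)
    then show "\<exists>y. ((\<lambda>x. \<phi> x - c * x) has_real_derivative y) (at x) \<and> y \<ge> 0"
      using rate[OF x] by (intro exI conjI) auto
  qed
  then show ?thesis by (simp add: algebra_simps)
qed

lemma smooth_on_has_vector_derivative:
  fixes f :: "real \<Rightarrow> 'b::real_normed_vector"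
  assumes "smooth_on I f" "open I" "s \<in> I"
  shows "(f has_vector_derivative vector_derivative f (at s)) (at s)"
proof -
  have "Ck_on (Suc 0) I f" using assms(1) unfolding smooth_on_def by (rule spec)
  then have "f differentiable_on I" by simp
  then have "f differentiable (at s within I)" using assms(3) unfolding differentiable_on_def by (rule bspec)
  then have "f differentiable at s" by (simp only: at_within_open[OF assms(3,2)])
  then show ?thesis by (simp add: vector_derivative_works)
qed

lemma smooth_on_imp_continuous_on: "smooth_on S f \<Longrightarrow> continuous_on S f"
  unfolding smooth_on_def by (drule spec[of _ 0]) simp

lemma open_interval_convex: "open_interval I \<Longrightarrow> convex I \<and> is_interval I \<and> open I"
  by (simp add: open_interval_def is_interval_convex)

lemma unit_curve_angle:
  fixes r :: "real \<Rightarrow> real^2"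
  assumes I: "open_interval I" and r: "smooth_on I r" and unit: "\<And>s. s \<in> I \<Longrightarrow> norm (r s) = 1"
  shows "\<exists>\<phi>. continuous_on I \<phi> \<and>
    (\<forall>s\<in>I. r s = dir (\<phi> s) \<and> (\<phi> has_real_derivative wedge (r s) (vector_derivative r (at s))) (at s))"
proof -
  note I' = open_interval_convex[OF I]
  have nz: "r s \<noteq> 0" if "s \<in> I" for s using unit[OF that] by auto
  obtain \<phi> where \<phi>: "continuous_on I \<phi>" "\<And>s. s \<in> I \<Longrightarrow> r s = norm (r s) *\<^sub>R dir (\<phi> s)"
    by (rule angle_lift[OF _ smooth_on_imp_continuous_on[OF r] nz]) (use I' in blast)+
  have "r s = dir (\<phi> s) \<and> (\<phi> has_real_derivative wedge (r s) (vector_derivative r (at s))) (at s)" if s: "s \<in> I" for s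
  proof
    show "r s = dir (\<phi> s)" using \<phi>(2)[OF s] unit[OF s] by (metis scaleR_one)
    have "(\<phi> has_real_derivative wedge (r s) (vector_derivative r (at s)) / (norm (r s))\<^sup>2) (at s)"
      by (rule angle_lift_has_derivative[OF _ \<phi>(1) smooth_on_has_vector_derivative[OF r _ s] \<phi>(2) nz[OF s] s])
        (use I' in auto)
    then show "(\<phi> has_real_derivative wedge (r s) (vector_derivative r (at s))) (at s)" by (simp add: unit[OF s])
  qed
  then show ?thesis using \<phi>(1) by blast
qed

lemma matrix_vector_bounded_linear_left: "bounded_linear (\<lambda>A :: real^2^2. A *v v)"
  by (intro linear_conv_bounded_linear[THEN iffD1] linearI)
    (simp_all add: matrix_vector_mult_add_rdistrib scaleR_matrix_vector_assoc)

lemma continuous_on_matrix_vector_mult: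
  fixes A :: "'a::topological_space \<Rightarrow> real^2^2"
  assumes "continuous_on S A" "continuous_on S v"
  shows "continuous_on S (\<lambda>x. A x *v v x)"
  by (rule continuous_on_vec2; simp add: mat_vec_2; intro continuous_intros assms)

text \<open>\<open>F s\<close> lifts the projective action of \<open>B s\<close> to the universal cover of the projective line.\<close>

lemma invertible_letter_lift:
  fixes B :: "real \<Rightarrow> real^2^2"
  assumes I: "open_interval I" and B: "smooth_on I B"
    and inv: "\<And>s. s \<in> I \<Longrightarrow> invertible (B s)" and det: "\<And>s. s \<in> I \<Longrightarrow> det (B s) \<ge> 0"
    and rate: "\<And>s v. s \<in> I \<Longrightarrow> v \<noteq> 0 \<Longrightarrow>
      wedge (B s *v v) (vector_derivative B (at s) *v v) / (norm (B s *v v))\<^sup>2 \<ge> c"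
  obtains F where "continuous_on (I \<times> UNIV) (\<lambda>(s, \<theta>). F s \<theta>)"
    "\<And>s \<theta>. s \<in> I \<Longrightarrow> B s *v dir \<theta> = norm (B s *v dir \<theta>) *\<^sub>R dir (F s \<theta>)"
    "\<And>s s' \<theta>. s \<in> I \<Longrightarrow> s' \<in> I \<Longrightarrow> s \<le> s' \<Longrightarrow> F s' \<theta> - F s \<theta> \<ge> c * (s' - s)"
    "\<And>s \<theta> \<theta>'. s \<in> I \<Longrightarrow> \<theta> \<le> \<theta>' \<Longrightarrow> F s \<theta> \<le> F s \<theta>'"
    "\<And>s \<theta>. s \<in> I \<Longrightarrow> F s (\<theta> + pi) \<ge> F s \<theta> + pi"
proof -
  note I' = open_interval_convex[OF I]
  have nz: "B s *v v \<noteq> 0" if "s \<in> I" "v \<noteq> 0" for s v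
    using inv[OF that(1)] that(2) by (metis invertible_def matrix_left_invertible_ker)
  have "convex (I \<times> (UNIV :: real set))" using I' by (intro convex_Times) auto
  moreover have "continuous_on (I \<times> UNIV) (\<lambda>x. B (fst x) *v dir (snd x))"
    by (intro continuous_on_matrix_vector_mult continuous_on_dir continuous_intros
        continuous_on_compose2[OF smooth_on_imp_continuous_on[OF B]]) auto
  ultimately obtain \<phi> where \<phi>: "continuous_on (I \<times> UNIV) \<phi>"
    "\<And>x. x \<in> I \<times> UNIV \<Longrightarrow> B (fst x) *v dir (snd x) = norm (B (fst x) *v dir (snd x)) *\<^sub>R dir (\<phi> x)"
    by (rule angle_lift) (use nz in auto)
  define F where "F s \<theta> = \<phi> (s, \<theta>)" for s \<theta>
  have F: "B s *v dir \<theta> = norm (B s *v dir \<theta>) *\<^sub>R dir (F s \<theta>)" if "s \<in> I" for s \<theta>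
    using \<phi>(2)[of "(s, \<theta>)"] that by (simp add: F_def)
  have cont: "continuous_on (I \<times> UNIV) (\<lambda>(s, \<theta>). F s \<theta>)" using \<phi>(1) by (simp add: F_def case_prod_unfold)
  have cs: "continuous_on I (\<lambda>s. F s \<theta>)" for \<theta>
    unfolding F_def by (rule continuous_on_compose2[OF \<phi>(1)]) (auto intro!: continuous_intros)
  have ct: "continuous_on UNIV (F s)" if "s \<in> I" for s
    unfolding F_def by (rule continuous_on_compose2[OF \<phi>(1)]) (use that in \<open>auto intro!: continuous_intros\<close>)
  have mono: "F s \<theta> \<le> F s \<theta>'" if s: "s \<in> I" and "\<theta> \<le> \<theta>'" for s \<theta> \<theta>'
  proof -
    \<comment> \<open>\<open>angle_increase\<close> in the angle variable: the derivative of
      \<open>dir\<close> is a quarter turn, so the rate is \<open>det (B s)\<close> over a squared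
      norm.\<close>
    have "F s \<theta>' - F s \<theta> \<ge> 0 * (\<theta>' - \<theta>)"
    proof (rule angle_increase[of UNIV "F s" "\<lambda>\<theta>. B s *v dir \<theta>" "\<lambda>\<theta>. B s *v dir (\<theta> + pi / 2)"])
      show "((\<lambda>\<theta>. B s *v dir \<theta>) has_vector_derivative B s *v dir (x + pi / 2)) (at x)" for x
      proof (rule bounded_linear.has_vector_derivative[OF matrix_vector_mul_bounded_linear])
        have eq: "dir = (\<lambda>x. cos x *\<^sub>R axis 1 1 + sin x *\<^sub>R axis 2 1)"
          by (auto simp: fun_eq_iff vec2_eq_iff axis_def)
        have "((\<lambda>x. cos x *\<^sub>R axis 1 1 + sin x *\<^sub>R axis 2 1 :: real^2) has_vector_derivative
            (- sin x) *\<^sub>R axis 1 1 + cos x *\<^sub>R axis 2 1) (at x)"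
          by (auto intro!: derivative_eq_intros)
        then show "(dir has_vector_derivative dir (x + pi / 2)) (at x)"
          by (simp add: eq cos_add sin_add)
      qed
      show "wedge (B s *v dir x) (B s *v dir (x + pi / 2)) / (norm (B s *v dir x))\<^sup>2 \<ge> 0" for x
        using det[OF s] by (simp add: wedge_matrix wedge_dir)
      show "B s *v dir x = norm (B s *v dir x) *\<^sub>R dir (F s x)" for x by (rule F[OF s])
    qed (use ct s nz that in auto)
    then show ?thesis by simp
  qed
  have period: "F s (\<theta> + pi) \<ge> F s \<theta> + pi" if s: "s \<in> I" for s \<theta>
  proof (rule ccontr)
    assume "\<not> ?thesis"
    \<comment> \<open>The image of the opposite vector is opposite, so the increment is an odd
      multiple of pi; monotonicity and the assumption confine it to \<open>[0, pi)\<close>, which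
      contains none.\<close>
    then have small: "0 \<le> F s (\<theta> + pi) - F s \<theta>" "F s (\<theta> + pi) - F s \<theta> < pi" using mono[OF s, of \<theta> "\<theta> + pi"] by auto
    have neg: "dir (\<theta> + pi) = (-1) *\<^sub>R dir \<theta>" by (simp add: vec2_eq_iff)
    let ?n = "norm (B s *v dir \<theta>)"
    have n: "?n > 0" using nz[OF s] by simp
    have eq: "B s *v dir (\<theta> + pi) = (-1) *\<^sub>R (B s *v dir \<theta>)" unfolding neg by (rule matrix_vector_mult_scaleR)
    have opp: "d' = - d" if "b = n *\<^sub>R d" "(-1) *\<^sub>R b = n *\<^sub>R d'" "n > 0" for b d d' :: "real^2" and n :: real
    proof -
      have "n *\<^sub>R d' = n *\<^sub>R (- d)" using that by simp
      then show ?thesis using that(3) by (metis less_irrefl scaleR_cancel_left)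
    qed
    have "norm (B s *v dir (\<theta> + pi)) = ?n" unfolding eq by simp
    then have "B s *v dir (\<theta> + pi) = ?n *\<^sub>R dir (F s (\<theta> + pi))" using F[OF s, of "\<theta> + pi"] by metis
    then have "dir (F s (\<theta> + pi)) = - dir (F s \<theta>)"
      unfolding eq by (rule opp[OF F[OF s] _ n])
    then have "inner (dir (F s \<theta>)) (dir (F s (\<theta> + pi))) = - 1"
      by (simp add: power2_norm_eq_inner[symmetric])
    then have "cos (F s (\<theta> + pi) - F s \<theta>) = cos pi" by (simp add: inner_dir)
    then have "F s (\<theta> + pi) - F s \<theta> = pi" by (rule cos_inj_pi[rotated 4]) (use small in auto)
    then show False using small by simp
  qed
  show ?thesis
  proof (rule that[OF cont F _ mono period])
    show "F s' \<theta> - F s \<theta> \<ge> c * (s' - s)" if "s \<in> I" "s' \<in> I" "s \<le> s'" for s s' \<theta>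
    proof (rule angle_increase[of I "\<lambda>s. F s \<theta>" "\<lambda>s. B s *v dir \<theta>" "\<lambda>s. vector_derivative B (at s) *v dir \<theta>"])
      show "((\<lambda>s. B s *v dir \<theta>) has_vector_derivative vector_derivative B (at x) *v dir \<theta>) (at x)" if "x \<in> I" for x
        by (rule bounded_linear.has_vector_derivative[OF matrix_vector_bounded_linear_left
            smooth_on_has_vector_derivative[OF B]]) (use I' that in auto)
      show "B x *v dir \<theta> = norm (B x *v dir \<theta>) *\<^sub>R dir (F x \<theta>)" if "x \<in> I" for x by (rule F[OF that])
    qed (use I' cs nz rate that in auto)
  qed
qed

section \<open>Sine margins and expansion of the cone form\<close>

lemma sin_ge_margin:
  assumes "0 \<le> d" "d \<le> x" "x \<le> pi - d"
  shows "sin d \<le> sin x"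
proof (cases "x \<le> pi / 2")
  case True
  then show ?thesis using assms by (intro sin_monotone_2pi_le) auto
next
  case False
  then have "sin d \<le> sin (pi - x)" using assms by (intro sin_monotone_2pi_le) auto
  then show ?thesis by simp
qed

text \<open>By the intermediate value property a connected set without zeros of the sine stays
  between two consecutive multiples of pi. Every avoidance statement becomes quantitative through
  this.\<close>

lemma avoids_multiples_of_pi:
  assumes "connected U" "\<And>x. x \<in> U \<Longrightarrow> sin x \<noteq> (0::real)" "x0 \<in> U"
  obtains m :: int where "\<forall>x\<in>U. m * pi < x \<and> x < (real_of_int m + 1) * pi"
proof -
  have no: "real_of_int n * pi \<notin> U" for n using assms(2) sin_zero_iff_int2 by blast
  define m where "m = \<lfloor>x0 / pi\<rfloor>"
  have "real_of_int m \<le> x0 / pi" "x0 / pi \<le> real_of_int m + 1" unfolding m_def by linarith+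
  then have "real_of_int m * pi \<le> x0 / pi * pi" "x0 / pi * pi \<le> (real_of_int m + 1) * pi"
    by (intro mult_right_mono; simp)+
  then have m: "real_of_int m * pi \<le> x0" "x0 \<le> (real_of_int m + 1) * pi" by simp_all
  show ?thesis
  proof (rule that[of m], rule ballI)
    fix x assume x: "x \<in> U"
    have "\<not> x \<le> m * pi" using connectedD_interval[OF assms(1) x assms(3), of "m * pi"] m no by blast
    moreover have "\<not> (real_of_int m + 1) * pi \<le> x"
      using connectedD_interval[OF assms(1) assms(3) x, of "(m + 1) * pi"] m no[of "m + 1"] by auto
    ultimately show "m * pi < x \<and> x < (real_of_int m + 1) * pi" by linarith
  qed
qed

lemma abs_sin_ge_margin:
  assumes "0 \<le> d" "real_of_int m * pi + d \<le> x" "x \<le> (real_of_int m + 1) * pi - d"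
  shows "sin d \<le> \<bar>sin x\<bar>"
proof -
  have "sin d \<le> sin (x - m * pi)" using assms by (intro sin_ge_margin) (auto simp: algebra_simps)
  also have "\<dots> = sin x * cos (pi * m)" by (simp add: sin_diff mult.commute[of _ pi])
  also have "\<dots> \<le> \<bar>sin x\<bar>" by (cases "even m") (auto simp: abs_ge_minus_self)
  finally show ?thesis .
qed

lemma polar_form:
  obtains \<eta> where "(h :: real^2) = norm h *\<^sub>R dir \<eta>"
proof (cases "h = 0")
  case False
  obtain \<phi> where "\<And>x. x \<in> {0::real} \<Longrightarrow> h = norm h *\<^sub>R dir (\<phi> x)"
    using angle_lift[of "{0::real}" "\<lambda>_. h"] False by auto
  then show ?thesis using that by blast
qed (use that in auto)

text \<open>The product of the two coordinates in a unimodular basis \<open>(p, q)\<close> is a quadratic form that a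
  matrix mapping the cone \<open>(p, q)\<close> strictly into \<open>(p', q')\<close> expands by more than its determinant.\<close>

lemma cone_form_expansion:
  fixes A :: "real^2^2"
  assumes D: "wedge p q > 0" and D': "wedge p' q' > 0" "wedge p' q' \<le> 1" and det: "det A \<ge> 0" and unit: "norm p = 1" "norm q = 1"
    and xy: "wedge x q * wedge p x \<ge> 0" and \<sigma>: "\<sigma> > 0"
    and a: "wedge (A *v p) q' \<ge> 0" and b: "wedge (A *v q) q' \<ge> \<sigma> * norm (A *v q)"
    and c: "wedge p' (A *v p) \<ge> \<sigma> * norm (A *v p)" and d: "wedge p' (A *v q) \<ge> 0"
  shows "(1 + 2 * \<sigma>\<^sup>2) * det A * (wedge x q * wedge p x / wedge p q)
    \<le> wedge (A *v x) q' * wedge p' (A *v x) / wedge p' q'"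
proof -
  define D0 D1 where "D0 = wedge p q" and "D1 = wedge p' q'"
  define u v where "u = wedge x q" and "v = wedge p x"
  define a' b' c' d' where "a' = wedge (A *v p) q'" and "b' = wedge (A *v q) q'"
    and "c' = wedge p' (A *v p)" and "d' = wedge p' (A *v q)"
  \<comment> \<open>Cramer's rule in the basis \<open>(p, q)\<close>.\<close>
  have x: "D0 *\<^sub>R x = u *\<^sub>R p + v *\<^sub>R q"
    by (simp add: D0_def u_def v_def vec2_eq_iff wedge_def algebra_simps)
  have "D0 *\<^sub>R (A *v x) = u *\<^sub>R (A *v p) + v *\<^sub>R (A *v q)"
    using arg_cong[OF x, of "\<lambda>z. A *v z"] by (simp add: matrix_vector_right_distrib matrix_vector_mult_scaleR)
  then have 1: "D0 * wedge (A *v x) q' = u * a' + v * b'" and 2: "D0 * wedge p' (A *v x) = u * c' + v * d'"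
    unfolding a'_def b'_def c'_def d'_def by (metis wedge_scaleR wedge_add)+
  \<comment> \<open>Plucker relation for \<open>A *v p\<close>, \<open>A *v q\<close>,
    \<open>p'\<close>, \<open>q'\<close>.\<close>
  have pl: "a' * d' = b' * c' + det A * D0 * D1"
    unfolding a'_def b'_def c'_def d'_def D0_def D1_def wedge_matrix[symmetric]
    by (simp add: wedge_def algebra_simps)
  have "\<sigma>\<^sup>2 * (det A * D0) * D1 \<le> \<sigma>\<^sup>2 * (det A * D0) * 1"
    using det D D' by (intro mult_left_mono) (auto simp: D0_def D1_def)
  also have "det A * D0 \<le> norm (A *v p) * norm (A *v q)"
    unfolding D0_def wedge_matrix[symmetric] using abs_wedge_le[of "A *v p" "A *v q"] by linarith
  then have "\<sigma>\<^sup>2 * (det A * D0) * 1 \<le> \<sigma>\<^sup>2 * (norm (A *v p) * norm (A *v q)) * 1"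
    by (intro mult_left_mono mult_right_mono) auto
  also have "\<dots> = (\<sigma> * norm (A *v q)) * (\<sigma> * norm (A *v p))" by (simp add: power2_eq_square)
  also have "\<dots> \<le> b' * c'" using b c \<sigma> unfolding b'_def c'_def by (intro mult_mono) (auto intro: order_trans[rotated])
  finally have bc: "\<sigma>\<^sup>2 * det A * D0 * D1 \<le> b' * c'" by (simp add: mult_ac)
  have nn: "a' \<ge> 0" "b' \<ge> 0" "c' \<ge> 0" "d' \<ge> 0"
    using a d order_trans[OF _ b] order_trans[OF _ c] \<sigma> by (auto simp: a'_def b'_def c'_def d'_def)
  \<comment> \<open>By \<open>pl\<close> the mixed coefficient \<open>a' * d' + b' * c'\<close>
    equals \<open>2 * b' * c' + det A * D0 * D1\<close>; the strict margins bound
    \<open>b' * c'\<close> below and give the excess \<open>2 * \<sigma>\<^sup>2\<close>.\<close>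
  have "u * v * ((1 + 2 * \<sigma>\<^sup>2) * det A * D0 * D1) \<le> u * v * (a' * d' + b' * c')"
    using xy bc pl by (intro mult_left_mono) (auto simp: u_def v_def algebra_simps)
  also have "\<dots> \<le> u\<^sup>2 * (a' * c') + v\<^sup>2 * (b' * d') + u * v * (a' * d' + b' * c')"
    using nn by simp
  also have "\<dots> = (D0 * wedge (A *v x) q') * (D0 * wedge p' (A *v x))"
    unfolding 1 2 by (simp add: power2_eq_square algebra_simps)
  finally have "D0 * (u * v * ((1 + 2 * \<sigma>\<^sup>2) * det A) * D1) \<le> D0 * (D0 * (wedge (A *v x) q' * wedge p' (A *v x)))"
    by (simp add: mult_ac)
  then have "u * v * ((1 + 2 * \<sigma>\<^sup>2) * det A) * D1 \<le> D0 * (wedge (A *v x) q' * wedge p' (A *v x))"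
    using D by (simp add: D0_def)
  then show ?thesis using D D' unfolding D0_def[symmetric] D1_def[symmetric] u_def[symmetric] v_def[symmetric]
    by (simp add: field_simps)
qed

text \<open>Makes constants uniform over the finitely many letters: since \<open>\<psi>\<close> is
  nonnegative a constant may be enlarged, here to 1 plus the sum of all absolute values.\<close>

lemma uniform_bound:
  fixes \<phi> \<psi> :: "'a \<Rightarrow> 'b \<Rightarrow> real"
  assumes "finite S" "\<And>j. j \<in> S \<Longrightarrow> \<exists>K. \<forall>v. \<phi> j v \<le> K * \<psi> j v" "\<And>j v. \<psi> j v \<ge> 0"
  obtains K where "K > 0" "\<And>j v. j \<in> S \<Longrightarrow> \<phi> j v \<le> K * \<psi> j v"
proof -
  obtain f where f: "\<And>j v. j \<in> S \<Longrightarrow> \<phi> j v \<le> f j * \<psi> j v" using assms(2) by metis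
  show ?thesis
  proof (rule that[of "1 + (\<Sum>j\<in>S. \<bar>f j\<bar>)"])
    show "1 + (\<Sum>j\<in>S. \<bar>f j\<bar>) > 0" by (simp add: add_pos_nonneg sum_nonneg)
    fix j v assume j: "j \<in> S"
    have "f j \<le> 1 + (\<Sum>j\<in>S. \<bar>f j\<bar>)" using member_le_sum[OF j, of "\<lambda>j. \<bar>f j\<bar>"] assms(1) by auto
    then have "f j * \<psi> j v \<le> (1 + (\<Sum>j\<in>S. \<bar>f j\<bar>)) * \<psi> j v" using assms(3) by (intro mult_right_mono) auto
    then show "\<phi> j v \<le> (1 + (\<Sum>j\<in>S. \<bar>f j\<bar>)) * \<psi> j v" using f[OF j, of v] by linarith
  qed
qed

section \<open>Admissible words and their closing up\<close>

lemma admissible_word_iff: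
  "admissible_word k P w \<longleftrightarrow> w \<noteq> [] \<and> set w \<subseteq> {1..k} \<and> successively (\<lambda>a b. P b a > 0) w"
  by (auto simp: admissible_word_def successively_conv_nth)

lemma admissible_word_append:
  assumes "admissible_word k P u" "admissible_word k P v" "P (hd v) (last u) > 0"
  shows "admissible_word k P (u @ v)"
  using assms by (auto simp: admissible_word_iff successively_append_iff)

lemma word_prod_append: "word_prod M (u @ v) = word_prod M v ** word_prod M u"
proof -
  let ?f = "\<lambda>acc i. M i ** acc"
  have "foldl ?f A v = foldl ?f (mat 1) v ** A" for A :: "real^2^2"
  proof (induction v arbitrary: A)
    case (Cons i v)
    have "foldl ?f A (i # v) = foldl ?f (M i ** A) v" by simp
    also have "\<dots> = foldl ?f (mat 1) v ** (M i ** A)" by (rule Cons.IH)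
    also have "\<dots> = (foldl ?f (mat 1) v ** (M i ** mat 1)) ** A" by (simp add: matrix_mul_assoc)
    also have "\<dots> = foldl ?f (M i ** mat 1) v ** A" by (simp only: Cons.IH[of "M i ** mat 1"])
    also have "\<dots> = foldl ?f (mat 1) (i # v) ** A" by simp
    finally show ?case .
  qed simp
  from this[of "word_prod M u"] show ?thesis by (simp only: word_prod_def foldl_append)
qed

lemma word_prod_singleton: "word_prod M [i] = M i"
  by (simp add: word_prod_def)

definition admissible_step :: "nat \<Rightarrow> (nat \<Rightarrow> nat \<Rightarrow> real) \<Rightarrow> nat \<Rightarrow> nat \<Rightarrow> bool" where
  "admissible_step k P j i \<longleftrightarrow> j \<in> {1..k} \<and> i \<in> {1..k} \<and> P i j > 0"

text \<open>The word leaves out the final letter \<open>j\<close> and only requires that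
  \<open>j\<close> may follow; this fits the wrap-around condition of a periodic word.\<close>

lemma step_path_word:
  assumes "(admissible_step k P)\<^sup>+\<^sup>+ i j"
  shows "\<exists>x. admissible_word k P (i # x) \<and> P j (last (i # x)) > 0"
  using assms
proof (induction rule: tranclp_induct)
  case (base j)
  then show ?case by (intro exI[of _ "[]"]) (auto simp: admissible_step_def admissible_word_def)
next
  case (step j j')
  then obtain x where x: "admissible_word k P (i # x)" "P j (last (i # x)) > 0" by blast
  have "admissible_word k P ((i # x) @ [j])"
    using x step.hyps by (intro admissible_word_append) (auto simp: admissible_step_def admissible_word_def)
  then show ?case using step.hyps by (intro exI[of _ "x @ [j]"]) (auto simp: admissible_step_def)
qed

text \<open>A null word stays null when extended, so a path from its last letter back to its first
  makes it periodic.\<close>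

lemma periodic_null_wordI:
  assumes w: "admissible_word k P w" "word_prod M w = 0" and conn: "\<And>i j. i \<in> {1..k} \<Longrightarrow> j \<in> {1..k} \<Longrightarrow> (admissible_step k P)\<^sup>+\<^sup>+ i j"
  shows "has_periodic_null_word k P M"
proof -
  have "w \<noteq> []" "set w \<subseteq> {1..k}" using w by (auto simp: admissible_word_def)
  then have w': "w \<noteq> []" "w ! 0 \<in> {1..k}" "last w \<in> {1..k}"
    by (auto intro!: subsetD[of "set w" "{1..k}"] simp del: atLeastAtMost_iff)
  obtain x where x: "admissible_word k P (last w # x)" "P (w ! 0) (last (last w # x)) > 0"
    using step_path_word[OF conn[OF w'(3,2)]] by blast
  have "admissible_word k P (w @ x)"
    using w(1) x(1) by (cases x) (auto simp: admissible_word_iff successively_append_iff)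
  moreover have "P ((w @ x) ! 0) (last (w @ x)) > 0" using x(2) w'(1) by (cases x) (auto simp: nth_append)
  moreover have "word_prod M (w @ x) = 0" by (simp add: word_prod_append w(2))
  ultimately show ?thesis unfolding has_periodic_null_word_def by blast
qed

section \<open>Winding families without null words\<close>

text \<open>The winding hypotheses after passing to lifted angles: \<open>F\<close> for invertible
  letters, \<open>rho\<close> for ranges and \<open>kap\<close> for kernels. Derivative conditions
  survive only as monotonicity, with a strict rate for \<open>F\<close> alone. Null words are
  excluded on radius \<open>2 * eps\<close>; arcs will use radius \<open>eps\<close>, and the rest
  is reserve.\<close>

locale winding_data =
  fixes k :: nat and P :: "nat \<Rightarrow> nat \<Rightarrow> real" and B :: "real \<Rightarrow> nat \<Rightarrow> real^2^2"
    and I :: "real set" and Ainv Asing :: "nat set" and c eps s0 :: real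
    and F :: "nat \<Rightarrow> real \<Rightarrow> real \<Rightarrow> real" and rho kap :: "nat \<Rightarrow> real \<Rightarrow> real"
  assumes eps: "eps > 0" and J: "{s0 - 2 * eps..s0 + 2 * eps} \<subseteq> I" and c: "c > 0"
    and letters: "Ainv \<union> Asing = {1..k}" "Ainv \<inter> Asing = {}" "Asing \<noteq> {}"
    and conn: "\<And>i j. i \<in> {1..k} \<Longrightarrow> j \<in> {1..k} \<Longrightarrow> (admissible_step k P)\<^sup>+\<^sup>+ i j"
    and det_nonneg: "\<And>j. j \<in> {1..k} \<Longrightarrow> det (B s0 j) \<ge> 0"
    and inv: "\<And>j. j \<in> Ainv \<Longrightarrow> invertible (B s0 j)"
    and F_cont: "\<And>j. j \<in> Ainv \<Longrightarrow> continuous_on (I \<times> UNIV) (\<lambda>(s, \<theta>). F j s \<theta>)"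
    and F_lift: "\<And>j s \<theta>. j \<in> Ainv \<Longrightarrow> s \<in> I \<Longrightarrow> B s j *v dir \<theta> = norm (B s j *v dir \<theta>) *\<^sub>R dir (F j s \<theta>)"
    and F_rate: "\<And>j s s' \<theta>. j \<in> Ainv \<Longrightarrow> s \<in> I \<Longrightarrow> s' \<in> I \<Longrightarrow> s \<le> s' \<Longrightarrow> F j s' \<theta> - F j s \<theta> \<ge> c * (s' - s)"
    and F_mono: "\<And>j s \<theta> \<theta>'. j \<in> Ainv \<Longrightarrow> s \<in> I \<Longrightarrow> \<theta> \<le> \<theta>' \<Longrightarrow> F j s \<theta> \<le> F j s \<theta>'"
    and F_period: "\<And>j s \<theta>. j \<in> Ainv \<Longrightarrow> s \<in> I \<Longrightarrow> F j s (\<theta> + pi) \<ge> F j s \<theta> + pi"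
    and rho_cont: "\<And>j. j \<in> Asing \<Longrightarrow> continuous_on I (rho j)"
    and rho_mono: "\<And>j s s'. j \<in> Asing \<Longrightarrow> s \<in> I \<Longrightarrow> s' \<in> I \<Longrightarrow> s \<le> s' \<Longrightarrow> rho j s \<le> rho j s'"
    and rho_range: "\<And>j s. j \<in> Asing \<Longrightarrow> s \<in> I \<Longrightarrow> span {dir (rho j s)} = range (\<lambda>v. B s j *v v)"
    and kap_cont: "\<And>j. j \<in> Asing \<Longrightarrow> continuous_on I (kap j)"
    and kap_anti: "\<And>j s s'. j \<in> Asing \<Longrightarrow> s \<in> I \<Longrightarrow> s' \<in> I \<Longrightarrow> s \<le> s' \<Longrightarrow> kap j s' \<le> kap j s"
    and kap_ker: "\<And>j s. j \<in> Asing \<Longrightarrow> s \<in> I \<Longrightarrow> span {dir (kap j s)} = {v. B s j *v v = 0}"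
    and no_null: "\<And>s. s \<in> {s0 - 2 * eps..s0 + 2 * eps} \<Longrightarrow> \<not> has_periodic_null_word k P (B s)"
begin

section \<open>Forward trajectories of singular ranges\<close>

abbreviation "T \<equiv> admissible_step k P"
abbreviation "lo \<equiv> s0 - 2 * eps"
abbreviation "hi \<equiv> s0 + 2 * eps"
abbreviation "sm \<equiv> s0 - eps"
abbreviation "sp \<equiv> s0 + eps"
abbreviation "M \<equiv> B s0"

text \<open>\<open>traj j f\<close>: \<open>f s\<close> is a lifted angle of the range of a singular letter pushed forward, at
  parameter \<open>s\<close>, by a word of invertible letters ending in \<open>j\<close>.\<close>

inductive traj :: "nat \<Rightarrow> (real \<Rightarrow> real) \<Rightarrow> bool" where
  base: "j \<in> Asing \<Longrightarrow> traj j (rho j)"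
| step: "traj j f \<Longrightarrow> T j i \<Longrightarrow> i \<in> Ainv \<Longrightarrow> traj i (\<lambda>s. F i s (f s))"

lemma params: "s0 \<in> I" "lo \<in> I" "hi \<in> I" "sm \<in> I" "sp \<in> I" "s \<in> {lo..hi} \<Longrightarrow> s \<in> I"
  using J eps by auto

lemma traj_letter: "traj j f \<Longrightarrow> j \<in> {1..k}"
  by (erule traj.cases) (use letters in \<open>auto simp: admissible_step_def\<close>)

text \<open>One word serves all parameters at once. This is the bridge from angles to null
  words.\<close>

lemma traj_word:
  "traj j f \<Longrightarrow> \<exists>w. admissible_word k P w \<and> last w = j \<and> (\<forall>s\<in>I. \<forall>v. word_prod (B s) w *v v \<in> span {dir (f s)})"
proof (induction rule: traj.induct)
  case (base j)
  have "admissible_word k P [j]" using base letters by (auto simp: admissible_word_def)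
  moreover have "word_prod (B s) [j] *v v \<in> span {dir (rho j s)}" if "s \<in> I" for s v
    using rho_range[OF base that] by (auto simp: word_prod_singleton)
  ultimately show ?case by (intro exI[of _ "[j]"]) auto
next
  case (step j f i)
  then obtain w where w: "admissible_word k P w" "last w = j"
    "\<And>s v. s \<in> I \<Longrightarrow> word_prod (B s) w *v v \<in> span {dir (f s)}" by blast
  have "admissible_word k P (w @ [i])"
    using w step by (intro admissible_word_append) (auto simp: admissible_step_def admissible_word_def)
  moreover have "word_prod (B s) (w @ [i]) *v v \<in> span {dir (F i s (f s))}" if s: "s \<in> I" for s v
  proof -
    obtain a where a: "word_prod (B s) w *v v = a *\<^sub>R dir (f s)"
      using w(3)[OF s, of v] by (auto simp: span_singleton)
    have "word_prod (B s) (w @ [i]) *v v = a *\<^sub>R (B s i *v dir (f s))"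
      by (simp add: word_prod_append word_prod_singleton matrix_vector_mul_assoc[symmetric] a matrix_vector_mult_scaleR)
    also have "B s i *v dir (f s) \<in> span {dir (F i s (f s))}"
      by (subst F_lift[OF step.hyps(3) s]) (intro span_mul span_base, simp)
    then have "a *\<^sub>R (B s i *v dir (f s)) \<in> span {dir (F i s (f s))}" by (rule span_mul)
    finally show ?thesis .
  qed
  ultimately show ?case by (intro exI[of _ "w @ [i]"]) auto
qed

lemma traj_cont: "traj j f \<Longrightarrow> continuous_on I f"
proof (induction rule: traj.induct)
  case (step j f i)
  have "continuous_on I (\<lambda>s. (\<lambda>(s, \<theta>). F i s \<theta>) (s, f s))"
    by (rule continuous_on_compose2[OF F_cont[OF step.hyps(3)]]) (auto intro!: continuous_intros step.IH)
  then show ?case by simp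
qed (rule rho_cont)

lemma traj_mono: "traj j f \<Longrightarrow> s \<in> I \<Longrightarrow> s' \<in> I \<Longrightarrow> s \<le> s' \<Longrightarrow> f s \<le> f s'"
proof (induction rule: traj.induct)
  case (step j f i)
  have "F i s (f s) \<le> F i s (f s')" using step by (intro F_mono) auto
  also have "\<dots> \<le> F i s' (f s')"
    using F_rate[OF step.hyps(3) step.prems, of "f s'"] c step.prems mult_nonneg_nonneg[of c "s' - s"] by linarith
  finally show ?case .
qed (rule rho_mono)

text \<open>The last letter alone contributes the rate \<open>c\<close>; the earlier part is only
  known to be monotone. A bare \<open>rho j\<close> may stand still, hence the restriction to
  \<open>Ainv\<close>.\<close>

lemma traj_rate: 
  assumes "traj j f" "j \<in> Ainv" "s \<in> I" "s' \<in> I" "s \<le> s'"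
  shows "f s' - f s \<ge> c * (s' - s)"
  using assms
proof (cases rule: traj.cases)
  case (step j' g)
  have "g s \<le> g s'" using traj_mono[OF step(2)] assms by auto
  then have "F j s' (g s) \<le> F j s' (g s')" using assms by (intro F_mono) auto
  then show ?thesis using F_rate[OF assms(2-5), of "g s"] step by simp
qed (use letters in auto)

text \<open>If the direction met the kernel of \<open>i\<close>, appending \<open>i\<close> to the
  word of the trajectory would give a null word, which can be closed up to a periodic one.\<close>

lemma traj_avoids_kernel:
  assumes "traj j f" "T j i" "i \<in> Asing" "s \<in> {lo..hi}"
  shows "sin (f s - kap i s) \<noteq> 0"
proof
  assume 0: "sin (f s - kap i s) = 0"
  have s: "s \<in> I" using params assms by auto
  have "dir (f s) \<in> span {dir (kap i s)}"
    using 0 by (intro wedge_eq_0_imp_span) (auto simp: wedge_dir sin_diff mult.commute)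
  then have ker: "B s i *v dir (f s) = 0" using kap_ker[OF assms(3) s] by auto
  obtain w where w: "admissible_word k P w" "last w = j"
    "\<And>v. word_prod (B s) w *v v \<in> span {dir (f s)}" using traj_word[OF assms(1)] s by blast
  have "admissible_word k P (w @ [i])"
    using w assms by (intro admissible_word_append) (auto simp: admissible_step_def admissible_word_def)
  moreover have "word_prod (B s) (w @ [i]) = 0"
  proof -
    have "word_prod (B s) (w @ [i]) *v v = 0 *v v" for v
    proof -
      obtain a where a: "word_prod (B s) w *v v = a *\<^sub>R dir (f s)"
        using w(3)[of v] by (auto simp: span_singleton)
      show ?thesis
        by (simp add: word_prod_append word_prod_singleton matrix_vector_mul_assoc[symmetric] a
            matrix_vector_mult_scaleR ker)
    qed
    then show ?thesis by (simp only: matrix_eq) blast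
  qed
  ultimately show False using periodic_null_wordI[OF _ _ conn] no_null[OF assms(4)] by blast
qed

text \<open>The point is that one \<open>m\<close> works for the whole window, so values at
  different parameters can be compared.\<close>

lemma traj_band:
  assumes "traj j f" "T j i" "i \<in> Asing"
  obtains m :: int where "\<And>s. s \<in> {lo..hi} \<Longrightarrow> m * pi < f s - kap i s \<and> f s - kap i s < (real_of_int m + 1) * pi"
proof -
  have "continuous_on {lo..hi} (\<lambda>s. f s - kap i s)"
    by (rule continuous_on_subset[OF _ J]) (intro continuous_intros traj_cont[OF assms(1)] kap_cont assms)
  then have U: "connected ((\<lambda>s. f s - kap i s) ` {lo..hi})" by (rule connected_continuous_image) simp
  have sinU: "sin x \<noteq> 0" if x: "x \<in> (\<lambda>s. f s - kap i s) ` {lo..hi}" for x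
  proof -
    obtain s where "x = f s - kap i s" "s \<in> {lo..hi}" using x by (rule imageE)
    then show ?thesis using traj_avoids_kernel[OF assms] by simp
  qed
  have mem: "f s0 - kap i s0 \<in> (\<lambda>s. f s - kap i s) ` {lo..hi}" by (intro imageI) (use eps in simp)
  obtain m :: int where "\<forall>x\<in>(\<lambda>s. f s - kap i s) ` {lo..hi}. m * pi < x \<and> x < (real_of_int m + 1) * pi"
    by (rule avoids_multiples_of_pi[OF U sinU mem])
  then show ?thesis by (intro that[of m]) blast
qed

text \<open>An arc of length \<open>pi\<close> stays one under further letters, so it would eventually sweep over a kernel.\<close>

lemma arc_less_pi:
  assumes "traj j f"
  shows "f hi < f lo + pi"
proof -
  \<comment> \<open>The difference \<open>f s - kap i s\<close> grows by less than pi across the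
    window, and \<open>kap\<close> does not increase, so \<open>f\<close> alone also grows by less
    than pi.\<close>
  have base: "f hi < f lo + pi" if t: "traj j f" "T j i" "i \<in> Asing" for j i f
  proof -
    obtain m :: int where "\<And>s. s \<in> {lo..hi} \<Longrightarrow> m * pi < f s - kap i s \<and> f s - kap i s < (real_of_int m + 1) * pi"
      by (rule traj_band[OF t]) blast
    from this[of lo] this[of hi] kap_anti[OF t(3), of lo hi] params eps show ?thesis by (auto simp: algebra_simps)
  qed
  \<comment> \<open>A singular letter lies ahead of every letter; the bound is carried backwards
    along the path to it.\<close>
  obtain i where i: "i \<in> Asing" "T\<^sup>+\<^sup>+ j i" using letters conn traj_letter[OF assms] by blast
  from i(2) have "\<forall>f. traj j f \<longrightarrow> f hi < f lo + pi"
  proof (induction rule: converse_tranclp_induct)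
    case (base j)
    then show ?case using \<open>\<And>j i f. traj j f \<Longrightarrow> T j i \<Longrightarrow> i \<in> Asing \<Longrightarrow> f hi < f lo + pi\<close> i by blast
  next
    case (step j j')
    show ?case
    proof (intro allI impI)
      fix f assume f: "traj j f"
      show "f hi < f lo + pi"
      proof (cases "j' \<in> Asing")
        case True
        then show ?thesis using base f step by blast
      next
        case False
        then have j': "j' \<in> Ainv" using step letters by (auto simp: admissible_step_def)
        show ?thesis
        proof (rule ccontr)
          assume "\<not> f hi < f lo + pi"
          then have "F j' hi (f lo + pi) \<le> F j' hi (f hi)" using j' params by (intro F_mono) auto
          moreover have "F j' hi (f lo + pi) \<ge> F j' hi (f lo) + pi" using j' params by (intro F_period) auto
          moreover have "F j' hi (f lo) \<ge> F j' lo (f lo)"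
            using F_rate[OF j' params(2,3), of "f lo"] mult_pos_pos[OF c eps] eps by (simp add: algebra_simps)
          moreover have "F j' hi (f hi) < F j' lo (f lo) + pi"
            using step.IH traj.step[OF f step.hyps(1) j'] by blast
          ultimately show False by linarith
        qed
      qed
    qed
  qed
  then show ?thesis using assms by blast
qed

section \<open>Margins and the cone form along trajectories\<close>

definition "d = min (c * eps) (pi / 4)"
definition "\<sigma> = sin d"

text \<open>\<open>c * eps\<close> is the advance of a trajectory over a quarter of the window; the
  cap \<open>pi / 4\<close> keeps \<open>d\<close> where the sine increases.\<close>

lemma d: "0 < d" "d \<le> c * eps" "d \<le> pi / 4"
  using c eps by (auto simp: d_def)

lemma \<sigma>: "0 < \<sigma>" "\<sigma> \<le> 1"
  using d pi_gt_zero unfolding \<sigma>_def by (auto intro!: sin_gt_zero)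

text \<open>The arc over the whole window is shorter than pi, and each outer quarter already takes
  \<open>d\<close> of it; this leaves at most \<open>pi - 2 * d\<close> for the inner arc.\<close>

lemma traj_margins:
  assumes "traj j f" "j \<in> Ainv"
  shows "f s0 - f sm \<ge> d" "f sp - f s0 \<ge> d" "f sp - f sm \<le> pi - 2 * d"
    "f hi - f s0 \<ge> 2 * d" "f s0 - f lo \<ge> 2 * d"
proof -
  note r = traj_rate[OF assms]
  have "f s0 - f sm \<ge> c * eps" "f sp - f s0 \<ge> c * eps" "f hi - f sp \<ge> c * eps" "f sm - f lo \<ge> c * eps"
    using r[of sm s0] r[of s0 sp] r[of sp hi] r[of lo sm] params eps by (auto simp: algebra_simps)
  then show "f s0 - f sm \<ge> d" "f sp - f s0 \<ge> d" "f sp - f sm \<le> pi - 2 * d"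
    "f hi - f s0 \<ge> 2 * d" "f s0 - f lo \<ge> 2 * d" using d arc_less_pi[OF assms(1)] by linarith+
qed

lemma sin_ge_\<sigma>: "d \<le> x \<Longrightarrow> x \<le> pi - d \<Longrightarrow> \<sigma> \<le> sin x"
  unfolding \<sigma>_def using d by (intro sin_ge_margin) auto

text \<open>Dividing once by the wedge amounts to rescaling the basis to area one, so expansions of
  \<open>Q\<close> compare directly with determinants.\<close>

definition Q :: "(real \<Rightarrow> real) \<Rightarrow> real^2 \<Rightarrow> real" where
  "Q f x = wedge x (dir (f sp)) * wedge (dir (f sm)) x / wedge (dir (f sm)) (dir (f sp))"

abbreviation "\<Lambda> \<equiv> 1 + 2 * \<sigma>\<^sup>2"

text \<open>The direction at \<open>s0\<close> keeps distance \<open>d\<close> from both ends of its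
  arc, so there \<open>Q\<close> is comparable with the squared norm.\<close>

lemma Q_dir:
  assumes "traj j f" "j \<in> Ainv"
  shows "\<sigma>\<^sup>2 * r\<^sup>2 \<le> Q f (r *\<^sub>R dir (f s0))" "Q f (r *\<^sub>R dir (f s0)) \<le> r\<^sup>2 / \<sigma>"
proof -
  note m = traj_margins[OF assms]
  define x y z where "x = sin (f sp - f s0)" and "y = sin (f s0 - f sm)" and "z = sin (f sp - f sm)"
  have xyz: "\<sigma> \<le> x" "\<sigma> \<le> y" "\<sigma> \<le> z" "x \<le> 1" "y \<le> 1" "z \<le> 1"
    unfolding x_def y_def z_def using m d by (auto intro!: sin_ge_\<sigma>)
  have Q: "Q f (r *\<^sub>R dir (f s0)) = r\<^sup>2 * (x * y / z)"
    by (simp add: Q_def wedge_dir x_def y_def z_def power2_eq_square)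
  have z0: "z > 0" using xyz \<sigma> by linarith
  have "\<sigma>\<^sup>2 * z \<le> \<sigma> * \<sigma> * 1" using xyz \<sigma> by (simp add: power2_eq_square)
  also have "\<dots> \<le> x * y" using mult_mono[OF xyz(1,2)] xyz \<sigma> by simp
  finally have 1: "\<sigma>\<^sup>2 \<le> x * y / z" using z0 by (simp add: pos_le_divide_eq)
  have "x * y \<le> 1" using mult_mono[OF xyz(4,5)] xyz \<sigma> by simp
  then have "x * y / z \<le> 1 / \<sigma>" using xyz \<sigma> z0 by (intro frac_le) auto
  then show "Q f (r *\<^sub>R dir (f s0)) \<le> r\<^sup>2 / \<sigma>"
    unfolding Q using mult_left_mono[of "x * y / z" "1 / \<sigma>" "r\<^sup>2"] by simp
  show "\<sigma>\<^sup>2 * r\<^sup>2 \<le> Q f (r *\<^sub>R dir (f s0))"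
    unfolding Q using mult_left_mono[OF 1, of "r\<^sup>2"] by (simp add: mult.commute)
qed

lemma Q_step:
  assumes f: "traj j f" "j \<in> Ainv" and i: "T j i" "i \<in> Ainv"
  shows "\<Lambda> * det (M i) * Q f (r *\<^sub>R dir (f s0)) \<le> Q (\<lambda>s. F i s (f s)) (M i *v (r *\<^sub>R dir (f s0)))"
proof -
  let ?g = "\<lambda>s. F i s (f s)" and ?x = "r *\<^sub>R dir (f s0)"
  have g: "traj i ?g" by (rule traj.step[OF f(1) i])
  note m = traj_margins[OF f] and mg = traj_margins[OF g i(2)]
  \<comment> \<open>The new arc uses the letter at \<open>sm\<close> and \<open>sp\<close>, the
    image of the old one the letter at \<open>s0\<close>; the rate in the parameter separates their
    ends by at least \<open>d\<close>.\<close>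
  have le: "?g sm + d \<le> F i s0 (f sm)" "F i s0 (f sp) + d \<le> ?g sp" "F i s0 (f sm) \<le> F i s0 (f sp)"
    using F_rate[OF i(2) params(4,1), of "f sm"] F_rate[OF i(2) params(1,5), of "f sp"]
      F_mono[OF i(2) params(1), of "f sm" "f sp"] m d eps by (auto simp: algebra_simps)
  have lift: "M i *v dir (f sm) = norm (M i *v dir (f sm)) *\<^sub>R dir (F i s0 (f sm))"
    "M i *v dir (f sp) = norm (M i *v dir (f sp)) *\<^sub>R dir (F i s0 (f sp))"
    using F_lift[OF i(2) params(1)] by blast+
  have wl: "wedge (M i *v dir (f sm)) (dir t) = norm (M i *v dir (f sm)) * sin (t - F i s0 (f sm))"
    "wedge (M i *v dir (f sp)) (dir t) = norm (M i *v dir (f sp)) * sin (t - F i s0 (f sp))"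
    "wedge (dir t) (M i *v dir (f sm)) = norm (M i *v dir (f sm)) * sin (F i s0 (f sm) - t)"
    "wedge (dir t) (M i *v dir (f sp)) = norm (M i *v dir (f sp)) * sin (F i s0 (f sp) - t)" for t
    by (subst lift, simp add: wedge_dir)+
  have s: "\<sigma> \<le> sin (?g sp - F i s0 (f sm))" "\<sigma> \<le> sin (?g sp - F i s0 (f sp))"
    "\<sigma> \<le> sin (F i s0 (f sm) - ?g sm)" "\<sigma> \<le> sin (F i s0 (f sp) - ?g sm)" "\<sigma> \<le> sin (?g sp - ?g sm)"
    "\<sigma> \<le> sin (f sp - f sm)" "\<sigma> \<le> sin (f sp - f s0)" "\<sigma> \<le> sin (f s0 - f sm)"
    by (rule sin_ge_\<sigma>; use le m mg d in linarith)+
  show ?thesis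
    unfolding Q_def
  proof (rule cone_form_expansion)
    show "wedge (dir (f sm)) (dir (f sp)) > 0" "wedge (dir (?g sm)) (dir (?g sp)) > 0"
      "wedge (dir (?g sm)) (dir (?g sp)) \<le> 1"
      using s \<sigma> by (auto simp: wedge_dir)
    show "det (M i) \<ge> 0" using det_nonneg[of i] i letters by blast
    show "wedge ?x (dir (f sp)) * wedge (dir (f sm)) ?x \<ge> 0"
    proof -
      have "wedge ?x (dir (f sp)) * wedge (dir (f sm)) ?x = r\<^sup>2 * (sin (f sp - f s0) * sin (f s0 - f sm))"
        by (simp add: wedge_dir power2_eq_square)
      also have "\<dots> \<ge> 0" using s \<sigma> by (intro mult_nonneg_nonneg) auto
      finally show ?thesis .
    qed
    show "\<sigma> * norm (M i *v dir (f sp)) \<le> wedge (M i *v dir (f sp)) (dir (?g sp))"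
      "\<sigma> * norm (M i *v dir (f sm)) \<le> wedge (dir (?g sm)) (M i *v dir (f sm))"
      unfolding wl mult.commute[of \<sigma>] by (intro mult_left_mono s norm_ge_zero)+
    have "0 \<le> sin (?g sp - F i s0 (f sm))" "0 \<le> sin (F i s0 (f sp) - ?g sm)" using s(1,4) \<sigma>(1) by linarith+
    then show "0 \<le> wedge (M i *v dir (f sm)) (dir (?g sp))" "0 \<le> wedge (dir (?g sm)) (M i *v dir (f sp))"
      unfolding wl by (auto intro!: mult_nonneg_nonneg)
  qed (use \<sigma> in auto)
qed

section \<open>Backward directions and transversality\<close>

definition G :: "nat \<Rightarrow> (real^2) set" where
  "G j = {r *\<^sub>R dir (f s0) | r f. r \<noteq> 0 \<and> traj j f}"

text \<open>Backward counterpart of \<open>traj\<close>, kept at the single parameter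
  \<open>s0\<close>: in transversality arguments only the forward direction is moved.\<close>

inductive btraj :: "nat \<Rightarrow> real^2 \<Rightarrow> bool" where
  base: "i \<in> Asing \<Longrightarrow> r \<noteq> 0 \<Longrightarrow> btraj i (r *\<^sub>R dir (kap i s0))"
| step: "btraj i h \<Longrightarrow> T j i \<Longrightarrow> j \<in> Ainv \<Longrightarrow> btraj j (adj2 (M j) *v h)"

lemma det_inv: "j \<in> Ainv \<Longrightarrow> det (M j) > 0"
  using inv[of j] det_nonneg[of j] letters invertible_det_nz[of "M j"] by force

lemma det_sing: "j \<in> Asing \<Longrightarrow> det (M j) = 0"
proof (rule ccontr)
  assume j: "j \<in> Asing" "det (M j) \<noteq> 0"
  have "M j *v dir (kap j s0) = 0" using kap_ker[OF j(1) params(1)] span_base[of "dir (kap j s0)"] by auto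
  then show False using j(2) adj2_mult_self[of "M j" "dir (kap j s0)"] by simp
qed

lemma inv_nz: "j \<in> Ainv \<Longrightarrow> v \<noteq> 0 \<Longrightarrow> M j *v v \<noteq> 0"
  using det_inv[of j] adj2_mult_self[of "M j" v] by auto

lemma adj2_inv_nz: "j \<in> Ainv \<Longrightarrow> v \<noteq> 0 \<Longrightarrow> adj2 (M j) *v v \<noteq> 0"
  using det_inv[of j] mult_adj2[of "M j" v] by auto

lemma btraj_nz: "btraj i h \<Longrightarrow> h \<noteq> 0"
  by (induction rule: btraj.induct) (auto simp: adj2_inv_nz)

text \<open>Mixed parameters (\<open>s\<close> up to letter \<open>j\<close>, \<open>s0\<close> afterwards) produce directions that, by the intermediate
  value theorem, are also reached with a single parameter.\<close>

lemma traj_btraj_transversal: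
  "btraj i h \<Longrightarrow> traj j f \<Longrightarrow> T j i \<Longrightarrow> s \<in> {lo..hi} \<Longrightarrow> wedge (dir (f s)) h \<noteq> 0"
proof (induction arbitrary: j f s rule: btraj.induct)
  case (base i r)
  obtain m :: int where m: "\<And>s. s \<in> {lo..hi} \<Longrightarrow> m * pi < f s - kap i s \<and> f s - kap i s < (real_of_int m + 1) * pi"
    by (rule traj_band[OF base.prems(1,2) base.hyps(1)]) blast
  have sI: "s \<in> I" using base params by blast
  have s0J: "s0 \<in> {lo..hi}" using eps by auto
  \<comment> \<open>By monotonicity the mixed difference lies between the pure differences at
    \<open>s\<close> and at \<open>s0\<close>, both in the band of the same
    \<open>m\<close>.\<close>
  have "m * pi < f s - kap i s0 \<and> f s - kap i s0 < (real_of_int m + 1) * pi"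
  proof (cases "s \<le> s0")
    case True
    then show ?thesis
      using m[OF base.prems(3)] m[OF s0J] kap_anti[OF base.hyps(1) sI params(1)]
        traj_mono[OF base.prems(1) sI params(1)] by linarith
  next
    case False
    then show ?thesis
      using m[OF base.prems(3)] m[OF s0J] kap_anti[OF base.hyps(1) params(1) sI]
        traj_mono[OF base.prems(1) params(1) sI] by linarith
  qed
  then have "sin (f s - kap i s0) \<noteq> 0"
  proof (intro notI)
    assume "sin (f s - kap i s0) = 0"
    then obtain n :: int where n: "f s - kap i s0 = n * pi" using sin_zero_iff_int2 by blast
    assume "m * pi < f s - kap i s0 \<and> f s - kap i s0 < (real_of_int m + 1) * pi"
    then have "real_of_int m < real_of_int n" "real_of_int n < real_of_int (m + 1)" unfolding n by auto
    then have "m < n" "n < m + 1" by (simp_all only: of_int_less_iff)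
    then show False by linarith
  qed
  then have "sin (kap i s0 - f s) \<noteq> 0" by (metis minus_diff_eq neg_equal_0_iff_equal sin_minus)
  then show ?case using base.hyps by (simp add: wedge_dir)
next
  case (step i h j')
  have sI: "s \<in> I" using step params by blast
  let ?g = "\<lambda>s. F j' s (f s)"
  have g: "traj j' ?g" by (rule traj.step[OF step.prems(1,2) step.hyps(3)])
  have "continuous_on {lo..hi} ?g" by (rule continuous_on_subset[OF traj_cont[OF g] J])
  then have U: "connected (?g ` {lo..hi})" by (rule connected_continuous_image) simp
  have "F j' lo (f lo) \<le> F j' s0 (f lo)"
    using F_rate[OF step.hyps(3) params(2,1), of "f lo"] mult_pos_pos[OF c eps] eps by (simp add: algebra_simps)
  also have "\<dots> \<le> F j' s0 (f s)"
    using step.prems(3) by (intro F_mono step.hyps params traj_mono[OF step.prems(1)] sI) auto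
  finally have ge: "?g lo \<le> F j' s0 (f s)" .
  have "F j' s0 (f s) \<le> F j' s0 (f hi)"
    using step.prems(3) by (intro F_mono step.hyps params traj_mono[OF step.prems(1)] sI) auto
  also have "\<dots> \<le> F j' hi (f hi)"
    using F_rate[OF step.hyps(3) params(1,3), of "f hi"] mult_pos_pos[OF c eps] eps by (simp add: algebra_simps)
  finally have le: "F j' s0 (f s) \<le> ?g hi" .
  have "?g lo \<in> ?g ` {lo..hi}" "?g hi \<in> ?g ` {lo..hi}" by (intro imageI; use eps in simp)+
  then have "F j' s0 (f s) \<in> ?g ` {lo..hi}" by (rule connectedD_interval[OF U _ _ ge le])
  then obtain s' where s': "F j' s0 (f s) = ?g s'" "s' \<in> {lo..hi}" by (rule imageE)
  have n1: "wedge (dir (?g s')) h \<noteq> 0" by (rule step.IH[OF g step.hyps(2) s'(2)])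
  have e1: "wedge (dir (f s)) (adj2 (M j') *v h) = wedge (M j' *v dir (f s)) h" by (rule wedge_adj2)
  have e2: "wedge (M j' *v dir (f s)) h = norm (M j' *v dir (f s)) * wedge (dir (F j' s0 (f s))) h"
    using arg_cong[OF F_lift[OF step.hyps(3) params(1), of "f s"], of "\<lambda>z. wedge z h"] unfolding wedge_scaleR .
  have n2: "norm (M j' *v dir (f s)) \<noteq> 0" unfolding norm_eq_zero by (rule inv_nz[OF step.hyps(3) dir_nonzero])
  show ?case unfolding e1 e2 s'(1) mult_eq_0_iff using n1 n2 by blast
qed

text \<open>No parameter of the window makes \<open>f s\<close> parallel to \<open>h\<close>, and
  \<open>f\<close> moves by at least \<open>2 * d\<close> on either side of \<open>s0\<close>; so at
  \<open>s0\<close> the two lines stay apart.\<close>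

lemma traj_btraj_angle:
  assumes "btraj i h" "traj j f" "T j i" "j \<in> Ainv"
  shows "\<sigma> * norm h \<le> \<bar>wedge (dir (f s0)) h\<bar>"
proof -
  obtain \<eta> where \<eta>: "h = norm h *\<^sub>R dir \<eta>" by (rule polar_form)
  have w: "wedge (dir (f s)) h = norm h * sin (\<eta> - f s)" for s by (subst \<eta>) (simp add: wedge_dir)
  have "continuous_on {lo..hi} (\<lambda>s. \<eta> - f s)"
    by (intro continuous_intros continuous_on_subset[OF traj_cont[OF assms(2)] J])
  then have U: "connected ((\<lambda>s. \<eta> - f s) ` {lo..hi})" by (rule connected_continuous_image) simp
  have sinU: "sin x \<noteq> 0" if x: "x \<in> (\<lambda>s. \<eta> - f s) ` {lo..hi}" for x
  proof -
    obtain s where s: "s \<in> {lo..hi}" "x = \<eta> - f s" using x by blast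
    show ?thesis using traj_btraj_transversal[OF assms(1-3) s(1)] unfolding w s(2) by simp
  qed
  have mem: "\<eta> - f s0 \<in> (\<lambda>s. \<eta> - f s) ` {lo..hi}" by (intro imageI) (use eps in simp)
  obtain m :: int where m: "\<forall>x\<in>(\<lambda>s. \<eta> - f s) ` {lo..hi}. m * pi < x \<and> x < (real_of_int m + 1) * pi"
    by (rule avoids_multiples_of_pi[OF U sinU mem])
  have "\<eta> - f hi \<in> (\<lambda>s. \<eta> - f s) ` {lo..hi}" "\<eta> - f lo \<in> (\<lambda>s. \<eta> - f s) ` {lo..hi}"
    by (intro imageI; use eps in simp)+
  then have "m * pi < \<eta> - f hi" "\<eta> - f lo < (real_of_int m + 1) * pi" using m by blast+
  then have "\<sigma> \<le> \<bar>sin (\<eta> - f s0)\<bar>"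
    unfolding \<sigma>_def using traj_margins[OF assms(2,4)] d
    by (intro abs_sin_ge_margin[of _ m]) linarith+
  then show ?thesis unfolding w by (simp add: abs_mult mult.commute mult_left_mono)
qed

definition H :: "nat \<Rightarrow> (real^2) set" where
  "H i = {h. btraj i h}"

abbreviation "C \<equiv> cocycle_pow M"

lemma inv_or_sing: "j \<in> {1..k} \<Longrightarrow> j \<in> Ainv \<or> j \<in> Asing"
  using letters by blast

lemma sing_letter: "j \<in> Asing \<Longrightarrow> j \<in> {1..k}" and inv_letter: "j \<in> Ainv \<Longrightarrow> j \<in> {1..k}"
  using letters by blast+

lemma G_I: "r \<noteq> 0 \<Longrightarrow> traj j f \<Longrightarrow> r *\<^sub>R dir (f s0) \<in> G j"
  unfolding G_def by blast

text \<open>A singular letter resets the direction to its range; the image is nonzero because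
  trajectories avoid kernels.\<close>

lemma G_step:
  assumes "T j i" "v \<in> G j"
  shows "M i *v v \<in> G i"
proof -
  obtain r f where v: "v = r *\<^sub>R dir (f s0)" "r \<noteq> 0" "traj j f" using assms(2) by (auto simp: G_def)
  have "i \<in> Ainv \<or> i \<in> Asing" using assms(1) inv_or_sing by (simp add: admissible_step_def)
  then show ?thesis
  proof
    assume i: "i \<in> Ainv"
    let ?g = "\<lambda>s. F i s (f s)"
    have "M i *v v = r *\<^sub>R (M i *v dir (f s0))" unfolding v(1) by (rule matrix_vector_mult_scaleR)
    also have "M i *v dir (f s0) = norm (M i *v dir (f s0)) *\<^sub>R dir (?g s0)" by (rule F_lift[OF i params(1)])
    finally have "M i *v v = (r * norm (M i *v dir (f s0))) *\<^sub>R dir (?g s0)" by (simp only: scaleR_scaleR)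
    moreover have "r * norm (M i *v dir (f s0)) \<noteq> 0" using v(2) inv_nz[OF i dir_nonzero] by simp
    moreover have "traj i ?g" by (rule traj.step[OF v(3) assms(1) i])
    ultimately show ?thesis using G_I[of _ i ?g] by simp
  next
    assume i: "i \<in> Asing"
    have "M i *v v \<in> span {dir (rho i s0)}" using rho_range[OF i params(1)] by blast
    then obtain a where a: "M i *v v = a *\<^sub>R dir (rho i s0)" by (auto simp: span_singleton)
    have "a \<noteq> 0"
    proof
      assume "a = 0"
      then have "M i *v dir (f s0) = 0" using a v(2) by (simp add: v(1) matrix_vector_mult_scaleR)
      then have "dir (f s0) \<in> span {dir (kap i s0)}" using kap_ker[OF i params(1)] by blast
      then have "sin (f s0 - kap i s0) = 0"
        using span_imp_wedge_eq_0[of "dir (f s0)" "dir (kap i s0)"] by (simp add: wedge_dir sin_diff mult.commute)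
      then show False using traj_avoids_kernel[OF v(3) assms(1) i, of s0] eps by simp
    qed
    then show ?thesis unfolding a by (rule G_I[OF _ traj.base[OF i]])
  qed
qed

text \<open>For singular \<open>j\<close> the adjugate maps into the kernel of \<open>M j\<close>.
  The result is nonzero since \<open>h\<close> is transversal to the range of
  \<open>M j\<close>.\<close>

lemma H_step:
  assumes "T j i" "h \<in> H i"
  shows "adj2 (M j) *v h \<in> H j"
proof -
  have h: "btraj i h" using assms(2) by (simp add: H_def)
  have "j \<in> Ainv \<or> j \<in> Asing" using assms(1) inv_or_sing by (simp add: admissible_step_def)
  then show ?thesis
  proof
    assume j: "j \<in> Ainv"
    show ?thesis using btraj.step[OF h assms(1) j] by (simp add: H_def)
  next
    assume j: "j \<in> Asing"
    have "M j *v (adj2 (M j) *v h) = 0" by (simp add: mult_adj2 det_sing[OF j])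
    then have "adj2 (M j) *v h \<in> span {dir (kap j s0)}" using kap_ker[OF j params(1)] by blast
    then obtain a where a: "adj2 (M j) *v h = a *\<^sub>R dir (kap j s0)" by (auto simp: span_singleton)
    have "dir (rho j s0) \<in> range (\<lambda>v. M j *v v)"
      using rho_range[OF j params(1)] span_base[of "dir (rho j s0)" "{dir (rho j s0)}"] by blast
    then obtain u where u: "dir (rho j s0) = M j *v u" by blast
    have "wedge (M j *v u) h \<noteq> 0"
      using traj_btraj_transversal[OF h traj.base[OF j] assms(1), of s0] eps by (simp add: u)
    then have "a \<noteq> 0" using wedge_adj2[of u "M j" h] by (auto simp: a)
    then show ?thesis using btraj.base[OF j] by (simp add: H_def a)
  qed
qed

lemma traj_exists:
  assumes "j \<in> {1..k}"
  shows "\<exists>f. traj j f"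
proof -
  obtain i where i: "i \<in> Asing" using letters by blast
  have "T\<^sup>+\<^sup>+ i j" using conn sing_letter[OF i] assms by blast
  then show ?thesis
  proof (induction rule: tranclp_induct)
    case (base j)
    then have "j \<in> Ainv \<or> j \<in> Asing" using inv_or_sing by (simp add: admissible_step_def)
    then show ?case using traj.base[OF i] traj.step[OF traj.base[OF i] base] traj.base[of j] by blast
  next
    case (step j j')
    then have "j' \<in> Ainv \<or> j' \<in> Asing" using inv_or_sing by (simp add: admissible_step_def)
    then show ?case using traj.base[of j'] traj.step step by blast
  qed
qed

lemma btraj_exists:
  assumes "i \<in> {1..k}"
  shows "\<exists>h. btraj i h"
proof -
  obtain j where j: "j \<in> Asing" using letters by blast
  have b: "\<exists>h. btraj i h" if "i \<in> Asing" for i using btraj.base[OF that, of 1] by auto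
  have "T\<^sup>+\<^sup>+ i j" using conn sing_letter[OF j] assms by blast
  then show ?thesis
  proof (induction rule: converse_tranclp_induct)
    case (base i)
    then have "i \<in> Ainv \<or> i \<in> Asing" using inv_or_sing by (simp add: admissible_step_def)
    then show ?case using b[OF j] b btraj.step base by blast
  next
    case (step i i')
    then have "i \<in> Ainv \<or> i \<in> Asing" using inv_or_sing by (simp add: admissible_step_def)
    then show ?case using b btraj.step step by blast
  qed
qed

section \<open>Uniform growth and transversality constants\<close>

lemma shift_space_step: "\<omega> \<in> shift_space k P \<Longrightarrow> T (\<omega> n) (\<omega> (n + 1))"
  unfolding shift_space_def admissible_step_def by blast

lemma Q_growth:
  assumes "\<omega> \<in> shift_space k P" "traj (\<omega> 0) f" "\<omega> 0 \<in> Ainv" "\<forall>i\<in>{1..n}. \<omega> (int i) \<in> Ainv"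
  shows "\<omega> (int n) \<in> Ainv \<and> (\<exists>g r'. traj (\<omega> (int n)) g \<and> C \<omega> n *v (r *\<^sub>R dir (f s0)) = r' *\<^sub>R dir (g s0) \<and>
    \<Lambda> ^ n * det (C \<omega> n) * Q f (r *\<^sub>R dir (f s0)) \<le> Q g (C \<omega> n *v (r *\<^sub>R dir (f s0))))"
  using assms(4)
proof (induction n)
  case 0
  show ?case using assms by auto
next
  case (Suc n)
  let ?x = "r *\<^sub>R dir (f s0)" and ?i = "\<omega> (int n + 1)"
  obtain g r' where g: "\<omega> (int n) \<in> Ainv" "traj (\<omega> (int n)) g" "C \<omega> n *v ?x = r' *\<^sub>R dir (g s0)"
    "\<Lambda> ^ n * det (C \<omega> n) * Q f ?x \<le> Q g (C \<omega> n *v ?x)"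
    using Suc by auto
  have "\<omega> (int (Suc n)) \<in> Ainv" using Suc.prems by (rule bspec) simp
  then have i: "?i \<in> Ainv" by (simp add: add.commute)
  have T: "T (\<omega> (int n)) ?i" by (rule shift_space_step[OF assms(1)])
  let ?h = "\<lambda>s. F ?i s (g s)"
  have eq: "C \<omega> (Suc n) *v ?x = M ?i *v (r' *\<^sub>R dir (g s0))"
    using g(3) by (simp add: matrix_vector_mul_assoc[symmetric] add.commute)
  have "M ?i *v (r' *\<^sub>R dir (g s0)) = r' *\<^sub>R (M ?i *v dir (g s0))" by (rule matrix_vector_mult_scaleR)
  also have "M ?i *v dir (g s0) = norm (M ?i *v dir (g s0)) *\<^sub>R dir (?h s0)" by (rule F_lift[OF i params(1)])
  finally have h: "C \<omega> (Suc n) *v ?x = (r' * norm (M ?i *v dir (g s0))) *\<^sub>R dir (?h s0)"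
    unfolding eq by (simp only: scaleR_scaleR)
  have dnn: "0 \<le> \<Lambda> * det (M ?i)" using det_inv[OF i] by (simp add: add_nonneg_nonneg)
  have "\<Lambda> ^ Suc n * det (C \<omega> (Suc n)) * Q f ?x = \<Lambda> * det (M ?i) * (\<Lambda> ^ n * det (C \<omega> n) * Q f ?x)"
    by (simp add: det_mul mult_ac add.commute)
  also have "\<dots> \<le> \<Lambda> * det (M ?i) * Q g (r' *\<^sub>R dir (g s0))"
    using g(4) dnn unfolding g(3) by (rule mult_left_mono)
  also have "\<dots> \<le> Q ?h (C \<omega> (Suc n) *v ?x)" unfolding eq by (rule Q_step[OF g(2,1) T i])
  finally have le: "\<Lambda> ^ Suc n * det (C \<omega> (Suc n)) * Q f ?x \<le> Q ?h (C \<omega> (Suc n) *v ?x)" .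
  have "traj (\<omega> (int (Suc n))) ?h" using traj.step[OF g(2) T i] by (simp add: add.commute)
  then show ?case using le h \<open>\<omega> (int (Suc n)) \<in> Ainv\<close> by blast
qed

lemma det_C_sing:
  assumes "\<omega> (int i) \<in> Asing" "i \<in> {1..n}"
  shows "det (C \<omega> n) = 0"
  using assms(2)
proof (induction n)
  case (Suc n)
  then show ?case using det_sing[OF assms(1)] by (cases "i = Suc n") (auto simp: det_mul)
qed simp

text \<open>If a singular letter occurs among the first \<open>n\<close>, the determinant is 0 and
  nothing remains to prove. Otherwise \<open>Q_dir\<close> is used at both ends, and its losses
  \<open>\<sigma>\<^sup>2\<close> and \<open>1 / \<sigma>\<close> give the cube.\<close>

lemma growth_inv:
  assumes "\<omega> \<in> shift_space k P" "v \<in> G (\<omega> 0)" "\<omega> 0 \<in> Ainv"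
  shows "det (C \<omega> n) * (norm v)\<^sup>2 \<le> (1 / \<sigma>) ^ 3 * (1 / \<Lambda>) ^ n * (norm (C \<omega> n *v v))\<^sup>2"
proof (cases "\<forall>i\<in>{1..n}. \<omega> (int i) \<in> Ainv")
  case True
  obtain r f where v: "v = r *\<^sub>R dir (f s0)" "r \<noteq> 0" "traj (\<omega> 0) f" using assms(2) by (auto simp: G_def)
  obtain g r' where g: "\<omega> (int n) \<in> Ainv" "traj (\<omega> (int n)) g" "C \<omega> n *v v = r' *\<^sub>R dir (g s0)"
    "\<Lambda> ^ n * det (C \<omega> n) * Q f v \<le> Q g (C \<omega> n *v v)"
    using Q_growth[OF assms(1) v(3) assms(3) True, of r] unfolding v(1) by blast
  have dC: "det (C \<omega> n) \<ge> 0"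
    using assms(1) det_nonneg by (intro det_cocycle_pow_nonneg) (auto simp: shift_space_def)
  have \<Lambda>0: "\<Lambda> > 0" by (simp add: add_pos_nonneg)
  have "\<Lambda> ^ n * det (C \<omega> n) * (\<sigma>\<^sup>2 * r\<^sup>2) \<le> \<Lambda> ^ n * det (C \<omega> n) * Q f v"
    using Q_dir(1)[OF v(3) assms(3), of r] dC \<Lambda>0 unfolding v(1) by (intro mult_left_mono mult_nonneg_nonneg) auto
  also have "\<dots> \<le> Q g (C \<omega> n *v v)" by (rule g(4))
  also have "\<dots> \<le> r'\<^sup>2 / \<sigma>" unfolding g(3) by (rule Q_dir(2)[OF g(2,1)])
  finally have "\<Lambda> ^ n * det (C \<omega> n) * (\<sigma>\<^sup>2 * r\<^sup>2) \<le> r'\<^sup>2 / \<sigma>" .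
  then have "(1 / \<sigma>)\<^sup>2 * (1 / \<Lambda>) ^ n * (\<Lambda> ^ n * det (C \<omega> n) * (\<sigma>\<^sup>2 * r\<^sup>2)) \<le> (1 / \<sigma>)\<^sup>2 * (1 / \<Lambda>) ^ n * (r'\<^sup>2 / \<sigma>)"
    using \<Lambda>0 by (intro mult_left_mono) auto
  moreover have "(1 / \<sigma>)\<^sup>2 * (1 / \<Lambda>) ^ n * (\<Lambda> ^ n * det (C \<omega> n) * (\<sigma>\<^sup>2 * r\<^sup>2)) = det (C \<omega> n) * r\<^sup>2"
    using \<sigma> \<Lambda>0 by (simp add: power_divide)
  moreover have "(1 / \<sigma>)\<^sup>2 * (1 / \<Lambda>) ^ n * (r'\<^sup>2 / \<sigma>) = (1 / \<sigma>) ^ 3 * (1 / \<Lambda>) ^ n * r'\<^sup>2"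
    by (simp add: power2_eq_square power3_eq_cube)
  moreover have "(norm v)\<^sup>2 = r\<^sup>2" "(norm (C \<omega> n *v v))\<^sup>2 = r'\<^sup>2" unfolding g(3) by (simp_all add: v(1))
  ultimately show ?thesis by simp
next
  case False
  then obtain i where "i \<in> {1..n}" "\<omega> (int i) \<notin> Ainv" by blast
  moreover have "\<omega> (int i) \<in> {1..k}" using assms(1) unfolding shift_space_def by blast
  ultimately have "det (C \<omega> n) = 0" using det_C_sing inv_or_sing by blast
  then show ?thesis using \<sigma> by (simp add: add_nonneg_nonneg)
qed

text \<open>After a singular letter the arc has no margin, so one further letter is read before
  \<open>growth_inv\<close> applies. This costs the one-letter constant \<open>K1\<close> and one
  factor \<open>\<Lambda>\<close>.\<close>

lemma growth:
  obtains K where "K > 0"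
    "\<And>\<omega> n v. \<omega> \<in> shift_space k P \<Longrightarrow> v \<in> G (\<omega> 0) \<Longrightarrow>
      det (C \<omega> n) * (norm v)\<^sup>2 \<le> K * (1 / \<Lambda>) ^ n * (norm (C \<omega> n *v v))\<^sup>2"
proof -
  have fin: "finite {1..k}" by simp
  have "\<exists>K. \<forall>v. det (M j) * (norm v)\<^sup>2 \<le> K * (norm (M j *v v))\<^sup>2" if "j \<in> {1..k}" for j
  proof (cases "det (M j) = 0")
    case False
    then have d: "det (M j) > 0" using det_nonneg[OF that] by simp
    let ?o = "onorm (\<lambda>v. adj2 (M j) *v v)"
    have "det (M j) * (norm v)\<^sup>2 \<le> ?o\<^sup>2 / det (M j) * (norm (M j *v v))\<^sup>2" for v
    proof -
      have "det (M j) * norm v = norm (adj2 (M j) *v (M j *v v))" using d by (simp add: adj2_mult_self)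
      also have "\<dots> \<le> ?o * norm (M j *v v)" by (rule onorm[OF matrix_vector_mul_bounded_linear])
      finally have "(det (M j) * norm v)\<^sup>2 \<le> (?o * norm (M j *v v))\<^sup>2" using d by (intro power_mono) auto
      then have "det (M j) * (det (M j) * (norm v)\<^sup>2) \<le> ?o\<^sup>2 * (norm (M j *v v))\<^sup>2"
        by (simp add: power2_eq_square mult_ac)
      then show ?thesis using d by (simp add: field_simps)
    qed
    then show ?thesis by blast
  qed (auto intro: exI[of _ 0])
  then obtain K1 where K1: "K1 > 0" "\<And>j v. j \<in> {1..k} \<Longrightarrow> det (M j) * (norm v)\<^sup>2 \<le> K1 * (norm (M j *v v))\<^sup>2"
    using uniform_bound[OF fin, of "\<lambda>j v. det (M j) * (norm v)\<^sup>2" "\<lambda>j v. (norm (M j *v v))\<^sup>2"] by (metis zero_le_power2)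
  have \<Lambda>: "\<Lambda> \<ge> 1" by simp
  have \<sigma>3: "(1 / \<sigma>) ^ 3 \<ge> 1" using \<sigma> by (intro one_le_power) simp
  \<comment> \<open>Large enough for all cases: \<open>n = 0\<close> needs 1, an invertible start
    \<open>(1 / \<sigma>) ^ 3\<close>, a delayed start
    \<open>K1 * ((1 / \<sigma>) ^ 3 * \<Lambda>)\<close>.\<close>
  define K where "K = (1 + K1) * ((1 / \<sigma>) ^ 3 * \<Lambda>)"
  have "(1 / \<sigma>) ^ 3 * 1 \<le> (1 / \<sigma>) ^ 3 * \<Lambda>" using \<Lambda> \<sigma>3 \<sigma> by (intro mult_left_mono) auto
  then have c1: "1 \<le> (1 / \<sigma>) ^ 3 * \<Lambda>" using \<sigma>3 by linarith
  have K: "K \<ge> (1 / \<sigma>) ^ 3" "K \<ge> 1" "K \<ge> K1 * ((1 / \<sigma>) ^ 3 * \<Lambda>)"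
  proof -
    have "K = (1 / \<sigma>) ^ 3 * \<Lambda> + K1 * ((1 / \<sigma>) ^ 3 * \<Lambda>)" by (simp only: K_def distrib_right mult_1)
    moreover have "(1 / \<sigma>) ^ 3 * 1 \<le> (1 / \<sigma>) ^ 3 * \<Lambda>" using \<Lambda> \<sigma>3 \<sigma> by (intro mult_left_mono) auto
    moreover have "K1 * ((1 / \<sigma>) ^ 3 * \<Lambda>) \<ge> 0" using K1(1) c1 by (intro mult_nonneg_nonneg[of K1]) linarith+
    ultimately show "K \<ge> (1 / \<sigma>) ^ 3" "K \<ge> 1" "K \<ge> K1 * ((1 / \<sigma>) ^ 3 * \<Lambda>)" using c1 by linarith+
  qed
  show ?thesis
  proof (rule that[of K])
    show "K > 0" using K by linarith
    fix \<omega> n v assume \<omega>: "\<omega> \<in> shift_space k P" and v: "v \<in> G (\<omega> 0)"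
    have letter: "\<omega> n \<in> {1..k}" for n using \<omega> unfolding shift_space_def by blast
    have weaken: "K' * (1 / \<Lambda>) ^ n * x \<le> K * (1 / \<Lambda>) ^ n * x" if "K' \<le> K" "x \<ge> 0" for K' x
      using that \<Lambda> by (intro mult_right_mono) auto
    show "det (C \<omega> n) * (norm v)\<^sup>2 \<le> K * (1 / \<Lambda>) ^ n * (norm (C \<omega> n *v v))\<^sup>2"
    proof (cases "\<omega> 0 \<in> Ainv")
      case True
      show ?thesis by (rule order_trans[OF growth_inv[OF \<omega> v True] weaken[OF K(1) zero_le_power2]])
    next
      case sing: False
      show ?thesis
      proof (cases n)
        case 0
        then show ?thesis using mult_right_mono[OF K(2), of "(norm v)\<^sup>2"] by simp
      next
        case (Suc m)
        let ?u = "M (\<omega> 1) *v v"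
        have T: "T (\<omega> 0) (\<omega> 1)" using shift_space_step[OF \<omega>, of 0] by simp
        have CS: "C \<omega> n = C (shift \<omega>) m ** M (\<omega> 1)" unfolding Suc by (rule cocycle_pow_Suc_shift)
        have Cv: "C \<omega> n *v v = C (shift \<omega>) m *v ?u" unfolding CS by (simp add: matrix_vector_mul_assoc)
        have dC: "det (C \<omega> n) = det (C (shift \<omega>) m) * det (M (\<omega> 1))" unfolding CS by (rule det_mul)
        show ?thesis
        proof (cases "\<omega> 1 \<in> Ainv")
          case False
          then have "\<omega> 1 \<in> Asing" using inv_or_sing letter by blast
          then have "det (C \<omega> n) = 0" unfolding dC using det_sing by simp
          then show ?thesis using K \<Lambda> by simp
        next
          case True
          have \<omega>': "shift \<omega> \<in> shift_space k P"
          proof -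
            have "\<omega> (n + 1) \<in> {1..k} \<and> P (\<omega> (n + 1 + 1)) (\<omega> (n + 1)) > 0" for n
              using \<omega> unfolding shift_space_def by blast
            then show ?thesis unfolding shift_space_def shift_def by blast
          qed
          have u: "?u \<in> G (shift \<omega> 0)" "shift \<omega> 0 \<in> Ainv" using G_step[OF T v] True by (auto simp: shift_def)
          have "x * (1 / x) ^ Suc m = (1 / x) ^ m" if "x \<ge> 1" for x :: real using that by simp
          then have pw: "(1 / \<Lambda>) ^ m = \<Lambda> * (1 / \<Lambda>) ^ n" unfolding Suc using \<Lambda> by metis
          have dm: "det (C (shift \<omega>) m) \<ge> 0"
            using \<omega>' det_nonneg by (intro det_cocycle_pow_nonneg) (auto simp: shift_space_def)
          have "det (C \<omega> n) * (norm v)\<^sup>2 = det (C (shift \<omega>) m) * (det (M (\<omega> 1)) * (norm v)\<^sup>2)" by (simp add: dC)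
          also have "\<dots> \<le> det (C (shift \<omega>) m) * (K1 * (norm ?u)\<^sup>2)"
            using dm K1(2)[OF letter] by (intro mult_left_mono) auto
          also have "\<dots> = K1 * (det (C (shift \<omega>) m) * (norm ?u)\<^sup>2)" by simp
          also have "\<dots> \<le> K1 * ((1 / \<sigma>) ^ 3 * (1 / \<Lambda>) ^ m * (norm (C (shift \<omega>) m *v ?u))\<^sup>2)"
            using growth_inv[OF \<omega>' u] K1(1) by (intro mult_left_mono) auto
          also have "\<dots> = K1 * ((1 / \<sigma>) ^ 3 * \<Lambda>) * (1 / \<Lambda>) ^ n * (norm (C \<omega> n *v v))\<^sup>2"
            by (simp only: pw Cv mult_ac)
          also have "\<dots> \<le> K * (1 / \<Lambda>) ^ n * (norm (C \<omega> n *v v))\<^sup>2" by (intro weaken K) simp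
          finally show ?thesis .
        qed
      qed
    qed
  qed
qed

text \<open>\<open>traj_btraj_angle\<close> covers invertible \<open>j\<close>. For singular
  \<open>j\<close> the forward line is a single one, and the bound comes from finiteness if
  \<open>h\<close> starts at a kernel, or from moving the letter \<open>i\<close> to the forward
  side.\<close>

lemma transversality:
  obtains dl where "dl > 0" "\<And>i j v h. T j i \<Longrightarrow> v \<in> G j \<Longrightarrow> h \<in> H i \<Longrightarrow> dl * norm v * norm h \<le> \<bar>wedge v h\<bar>"
proof -
  have fin: "finite Ainv" "finite {1..k}" using letters finite_subset[of Ainv "{1..k}"] by auto
  have "\<exists>K. \<forall>v. norm v \<le> K * norm (M j *v v)" if "j \<in> Ainv" for j
  proof -
    have d: "det (M j) > 0" by (rule det_inv[OF that])
    let ?o = "onorm (\<lambda>v. adj2 (M j) *v v)"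
    have "norm v \<le> ?o / det (M j) * norm (M j *v v)" for v
    proof -
      have "det (M j) * norm v = norm (adj2 (M j) *v (M j *v v))" using d by (simp add: adj2_mult_self)
      also have "\<dots> \<le> ?o * norm (M j *v v)" by (rule onorm[OF matrix_vector_mul_bounded_linear])
      finally show ?thesis using d by (simp add: field_simps)
    qed
    then show ?thesis by blast
  qed
  then obtain K1 where K1: "K1 > 0" "\<And>j v. j \<in> Ainv \<Longrightarrow> norm v \<le> K1 * norm (M j *v v)"
    using uniform_bound[OF fin(1), of "\<lambda>j v. norm v" "\<lambda>j v. norm (M j *v v)"] by (metis norm_ge_zero)
  have "\<exists>K. \<forall>v. norm (adj2 (M j) *v v) \<le> K * norm v" if "j \<in> {1..k}" for j
    using onorm[OF matrix_vector_mul_bounded_linear, of "adj2 (M j)"] by blast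
  then obtain K2 where K2: "K2 > 0" "\<And>j v. j \<in> {1..k} \<Longrightarrow> norm (adj2 (M j) *v v) \<le> K2 * norm v"
    using uniform_bound[OF fin(2), of "\<lambda>j v. norm (adj2 (M j) *v v)" "\<lambda>j v. norm v"] by (metis norm_ge_zero)
  define S where "S = {(j, i). j \<in> Asing \<and> i \<in> Asing \<and> T j i}"
  let ?w = "\<lambda>p. \<bar>wedge (dir (rho (fst p) s0)) (dir (kap (snd p) s0))\<bar>"
  have finS: "finite S"
    by (rule finite_subset[of _ "{1..k} \<times> {1..k}"]) (auto simp: S_def admissible_step_def)
  have "\<exists>K. \<forall>u::unit. 1 \<le> K * ?w p" if pS: "p \<in> S" for p
  proof -
    obtain j i where p: "p = (j, i)" "j \<in> Asing" "i \<in> Asing" "T j i" using pS by (auto simp: S_def)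
    have "wedge (dir (rho j s0)) (1 *\<^sub>R dir (kap i s0)) \<noteq> 0"
      by (rule traj_btraj_transversal[OF btraj.base[OF p(3)] traj.base[OF p(2)] p(4)]) (use eps in auto)
    then show ?thesis by (intro exI[of _ "1 / ?w p"]) (simp add: p(1))
  qed
  then obtain K3 where K3: "K3 > 0" "\<And>p. p \<in> S \<Longrightarrow> 1 \<le> K3 * ?w p"
    using uniform_bound[OF finS, of "\<lambda>p (u::unit). 1" "\<lambda>p u. ?w p"] by (metis abs_ge_zero)
  define dl where "dl = min \<sigma> (min (1 / K3) (\<sigma> / (K1 * K2)))"
  have dl: "0 < dl" "dl \<le> \<sigma>" "dl \<le> 1 / K3" "dl \<le> \<sigma> / (K1 * K2)"
    using \<sigma> K1 K2 K3 by (auto simp: dl_def)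
  have inv_case: "\<sigma> * norm v * norm h \<le> \<bar>wedge v h\<bar>" if t: "T j i" "v \<in> G j" "btraj i h" "j \<in> Ainv" for i j v h
  proof -
    obtain r f where v: "v = r *\<^sub>R dir (f s0)" "traj j f" using t(2) by (auto simp: G_def)
    have "\<bar>r\<bar> * (\<sigma> * norm h) \<le> \<bar>r\<bar> * \<bar>wedge (dir (f s0)) h\<bar>"
      by (intro mult_left_mono traj_btraj_angle[OF t(3) v(2) t(1,4)]) simp
    then show ?thesis by (simp add: v(1) abs_mult mult_ac)
  qed
  show ?thesis
  proof (rule that[OF dl(1)])
    fix i j v h assume T: "T j i" and v: "v \<in> G j" and "h \<in> H i"
    then have h: "btraj i h" by (simp add: H_def)
    have weaken: "dl * norm v * norm h \<le> x * norm v * norm h" if "dl \<le> x" for x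
      using that by (intro mult_right_mono) auto
    show "dl * norm v * norm h \<le> \<bar>wedge v h\<bar>"
    proof (cases "j \<in> Ainv")
      case True
      then show ?thesis using inv_case[OF T v h] weaken[OF dl(2)] by linarith
    next
      case False
      then have j: "j \<in> Asing" using T inv_or_sing by (auto simp: admissible_step_def)
      obtain r f where v': "v = r *\<^sub>R dir (f s0)" "traj j f" using v by (auto simp: G_def)
      \<comment> \<open>Only the base rule of \<open>traj\<close> ends in a singular letter.\<close>
      have f: "f = rho j" using v'(2) False by (cases rule: traj.cases) auto
      from h show ?thesis
      proof (cases rule: btraj.cases)
        case (base r')
        have "1 \<le> K3 * ?w (j, i)" by (rule K3(2)) (use j base T in \<open>auto simp: S_def\<close>)
        then have "1 / K3 \<le> ?w (j, i)" using K3(1) by (simp add: field_simps)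
        then have "\<bar>r\<bar> * \<bar>r'\<bar> * (1 / K3) \<le> \<bar>r\<bar> * \<bar>r'\<bar> * ?w (j, i)" by (intro mult_left_mono) auto
        then have "1 / K3 * norm v * norm h \<le> \<bar>wedge v h\<bar>"
          by (simp add: v'(1) f base(1) abs_mult mult_ac)
        then show ?thesis using weaken[OF dl(3)] by linarith
      next
        case (step i' h')
        \<comment> \<open>With \<open>i\<close> moved across by the adjugate, the forward vector
          ends in an invertible letter; \<open>K1\<close> and \<open>K2\<close> pay for the change
          of norms.\<close>
        have u: "M i *v v \<in> G i" by (rule G_step[OF T v])
        have "norm v * norm h \<le> (K1 * norm (M i *v v)) * (K2 * norm h')"
          unfolding step(1) using K1(2)[OF step(4), of v] K2(2)[OF inv_letter[OF step(4)], of h'] K1(1)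
          by (intro mult_mono) auto
        then have "\<sigma> / (K1 * K2) * (norm v * norm h) \<le> \<sigma> / (K1 * K2) * ((K1 * norm (M i *v v)) * (K2 * norm h'))"
          using \<sigma> K1(1) K2(1) by (intro mult_left_mono) auto
        also have "\<dots> = \<sigma> * norm (M i *v v) * norm h'" using K1(1) K2(1) by simp
        also have "\<dots> \<le> \<bar>wedge (M i *v v) h'\<bar>" by (rule inv_case[OF step(3) u step(2,4)])
        also have "\<dots> = \<bar>wedge v h\<bar>" unfolding step(1) wedge_adj2 ..
        finally have "\<sigma> / (K1 * K2) * norm v * norm h \<le> \<bar>wedge v h\<bar>" by (simp only: mult.assoc)
        then show ?thesis using weaken[OF dl(4)] by linarith
      qed
    qed
  qed
qed

theorem hyperbolic: "proj_unif_hyperbolic k P M"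
proof -
  obtain K where K: "K > 0" "\<And>\<omega> n v. \<omega> \<in> shift_space k P \<Longrightarrow> v \<in> G (\<omega> 0) \<Longrightarrow>
      det (C \<omega> n) * (norm v)\<^sup>2 \<le> K * (1 / \<Lambda>) ^ n * (norm (C \<omega> n *v v))\<^sup>2" by (rule growth) blast
  obtain dl where dl: "dl > 0" "\<And>i j v h. T j i \<Longrightarrow> v \<in> G j \<Longrightarrow> h \<in> H i \<Longrightarrow> dl * norm v * norm h \<le> \<bar>wedge v h\<bar>"
    by (rule transversality) blast
  have "1 < \<Lambda>" using \<sigma> by simp
  moreover have "0 < 1 / x \<and> 1 / x < 1" if "x > 1" for x :: real using that by (simp add: divide_less_eq)
  ultimately have lam: "0 < 1 / \<Lambda>" "1 / \<Lambda> < 1" by blast+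
  have "splitting_data k P M G H K (1 / \<Lambda>) dl"
  proof unfold_locales
    show "G j \<noteq> {}" if j: "j \<in> {1..k}" for j
    proof -
      obtain f where "traj j f" using traj_exists[OF j] by blast
      then have "1 *\<^sub>R dir (f s0) \<in> G j" by (intro G_I) auto
      then show ?thesis by blast
    qed
    show "H j \<noteq> {}" if "j \<in> {1..k}" for j using btraj_exists[OF that] by (auto simp: H_def)
    show "v \<noteq> 0" if "v \<in> G j" for j v using that by (auto simp: G_def)
    show "v \<noteq> 0" if "v \<in> H j" for j v using that btraj_nz by (auto simp: H_def)
    show "0 < 1 / \<Lambda>" "1 / \<Lambda> < 1" by (rule lam)+
  qed (use K dl det_nonneg in \<open>auto intro: G_step H_step simp: admissible_step_def\<close>)
  then show ?thesis by (rule splitting_data.splitting_hyperbolic)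
qed

end

section \<open>Null words occur almost surely\<close>

lemma mpow_path:
  assumes nn: "\<And>i j. i \<in> {1..k} \<Longrightarrow> j \<in> {1..k} \<Longrightarrow> P i j \<ge> 0"
  shows "mpow k P n i j > 0 \<Longrightarrow> i \<in> {1..k} \<Longrightarrow> j \<in> {1..k} \<Longrightarrow>
    \<exists>z. length z = n \<and> admissible_word k P (j # z) \<and> last (j # z) = i"
proof (induction n arbitrary: i)
  case 0
  then show ?case by (intro exI[of _ "[]"]) (auto simp: admissible_word_def split: if_splits)
next
  case (Suc n)
  have "\<exists>l\<in>{1..k}. P i l * mpow k P n l j > 0"
  proof (rule ccontr)
    assume "\<not> ?thesis"
    then have "(\<Sum>l\<in>{1..k}. P i l * mpow k P n l j) \<le> 0" by (intro sum_nonpos) (auto simp: not_less)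
    then show False using Suc.prems(1) by simp
  qed
  then obtain l where l: "l \<in> {1..k}" "P i l * mpow k P n l j > 0" by blast
  then have pos: "P i l > 0" "mpow k P n l j > 0" using nn[OF Suc.prems(2) l(1)] by (auto simp: zero_less_mult_iff)
  obtain z where z: "length z = n" "admissible_word k P (j # z)" "last (j # z) = l"
    using Suc.IH[OF pos(2) l(1) Suc.prems(3)] by blast
  have "admissible_word k P ((j # z) @ [i])"
    using z Suc.prems pos(1) by (intro admissible_word_append) (auto simp: admissible_word_def)
  then show ?case using z by (intro exI[of _ "z @ [i]"]) auto
qed

text \<open>Exponent 0 is allowed in \<open>primitive\<close>. A positive identity matrix leaves at
  most one state, and column sums then make \<open>P\<close> itself positive.\<close>

lemma primitive_positive_exponent:
  assumes "column_stochastic k P" "primitive k P"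
  obtains N where "\<And>i j. i \<in> {1..k} \<Longrightarrow> j \<in> {1..k} \<Longrightarrow> mpow k P (Suc N) i j > 0"
proof -
  obtain N where N: "\<And>i j. i \<in> {1..k} \<Longrightarrow> j \<in> {1..k} \<Longrightarrow> mpow k P N i j > 0"
    using assms(2) unfolding primitive_def by blast
  show ?thesis
  proof (cases N)
    case 0
    have "mpow k P (Suc 0) i j > 0" if ij: "i \<in> {1..k}" "j \<in> {1..k}" for i j
    proof -
      have all: "l = j" if "l \<in> {1..k}" for l using N[OF that ij(2)] 0 by (auto split: if_splits)
      then have eq: "{1..k} = {j}" using ij(2) by blast
      have "(\<Sum>l\<in>{1..k}. P l j) = 1" using assms(1) ij(2) unfolding column_stochastic_def by blast
      then have "P j j = 1" unfolding eq by simp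
      moreover have "mpow k P (Suc 0) i j = (\<Sum>l\<in>{j}. P i l * mpow k P 0 l j)" by (simp only: mpow.simps(2) eq)
      ultimately show ?thesis using all[OF ij(1)] by simp
    qed
    then show ?thesis by (rule that)
  next
    case (Suc m)
    then show ?thesis using N that by blast
  qed
qed

lemma primitive_connected:
  assumes "column_stochastic k P" "primitive k P" "i \<in> {1..k}" "j \<in> {1..k}"
  shows "(admissible_step k P)\<^sup>+\<^sup>+ i j"
proof -
  have nn: "\<And>i j. i \<in> {1..k} \<Longrightarrow> j \<in> {1..k} \<Longrightarrow> P i j \<ge> 0"
    using assms(1) unfolding column_stochastic_def by blast
  obtain N where "\<And>i j. i \<in> {1..k} \<Longrightarrow> j \<in> {1..k} \<Longrightarrow> mpow k P (Suc N) i j > 0"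
    by (rule primitive_positive_exponent[OF assms(1,2)]) blast
  then obtain z where z: "length z = Suc N" "admissible_word k P (i # z)" "last (i # z) = j"
    using mpow_path[of k P "Suc N" j i] nn assms by blast
  have "z \<noteq> [] \<Longrightarrow> admissible_word k P (i # z) \<Longrightarrow> (admissible_step k P)\<^sup>+\<^sup>+ i (last (i # z))" for z
  proof (induction z arbitrary: i)
    case (Cons a z)
    have t: "admissible_step k P i a" and a: "admissible_word k P (a # z)"
      using Cons.prems by (auto simp: admissible_word_iff admissible_step_def)
    show ?case
    proof (cases "z = []")
      case False
      then show ?thesis using tranclp_into_tranclp2[of "admissible_step k P", OF t Cons.IH[OF False a]] by simp
    qed (use t in auto)
  qed simp
  then show ?thesis using z by force
qed

section \<open>Cylinder probabilities and recurrence of a word\<close>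

definition weight :: "(nat \<Rightarrow> nat \<Rightarrow> real) \<Rightarrow> nat list \<Rightarrow> real" where
  "weight P w = (\<Prod>j<length w - 1. P (w ! (j + 1)) (w ! j))"

lemma weight_simps [simp]: "weight P [] = 1" "weight P [a] = 1" "weight P (a # b # w) = P b a * weight P (b # w)"
  by (simp_all add: weight_def prod.lessThan_Suc_shift del: prod.lessThan_Suc)

text \<open>The last letter of \<open>x\<close> is repeated so that the joining transition is
  counted.\<close>

lemma weight_append: "x \<noteq> [] \<Longrightarrow> weight P (x @ z) = weight P x * weight P (last x # z)"
proof (induction x)
  case (Cons a x)
  then show ?case by (cases x) (auto simp: mult.assoc)
qed simp

lemma weight_pos: "admissible_word k P w \<Longrightarrow> weight P w > 0"
  unfolding weight_def admissible_word_def by (intro prod_pos) auto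

lemma cylinder_disjoint:
  assumes "length x = length x'" "\<omega> \<in> cylinder a x" "\<omega> \<in> cylinder a x'"
  shows "x = x'"
  using assms by (intro nth_equalityI) (auto simp: cylinder_def)

lemma cylinder_append_subset: "cylinder a (x @ z) \<subseteq> cylinder a x"
  by (force simp: cylinder_def nth_append)

lemma cylinder_sets:
  assumes "sets \<mu> = sets (PiM (UNIV :: int set) (\<lambda>_. count_space (UNIV :: nat set)))"
  shows "cylinder a w \<in> sets \<mu>"
proof -
  let ?N = "PiM (UNIV :: int set) (\<lambda>_. count_space (UNIV :: nat set))"
  have sp: "space ?N = UNIV" by (simp add: space_PiM)
  have "{\<omega> \<in> space ?N. \<omega> (a + int j) = w ! j} \<in> sets ?N" for j
  proof -
    have "(\<lambda>\<omega>. \<omega> (a + int j)) \<in> measurable ?N (count_space UNIV)"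
      by (rule measurable_component_singleton) simp
    then have "(\<lambda>\<omega>. \<omega> (a + int j)) -` {w ! j} \<inter> space ?N \<in> sets ?N" by (rule measurable_sets) simp
    moreover have "(\<lambda>\<omega>. \<omega> (a + int j)) -` {w ! j} \<inter> space ?N = {\<omega> \<in> space ?N. \<omega> (a + int j) = w ! j}" by auto
    ultimately show ?thesis by simp
  qed
  then have "{\<omega> \<in> space ?N. \<forall>j\<in>{..<length w}. \<omega> (a + int j) = w ! j} \<in> sets ?N"
    by (intro sets.sets_Collect_finite_All) auto
  moreover have "{\<omega> \<in> space ?N. \<forall>j\<in>{..<length w}. \<omega> (a + int j) = w ! j} = cylinder a w"
    by (auto simp: cylinder_def sp)
  ultimately show ?thesis using assms by simp
qed

text \<open>From every state, the next block of length \<open>L\<close> ends with \<open>w\<close> with conditional probability at least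
  \<open>\<eta>\<close>, hence \<open>n\<close> blocks avoid \<open>w\<close> with probability at most \<open>(1 - \<eta>)^n\<close>.\<close>

lemma word_occurs_AE:
  assumes cs: "column_stochastic k P" and pr: "primitive k P" and mm: "markov_measure k P \<mu>"
    and w: "admissible_word k P w"
  shows "AE \<omega> in \<mu>. \<exists>m. \<omega> \<in> cylinder (int m + 1) w"
proof -
  interpret prob_space \<mu> using mm by (simp add: markov_measure_def)
  have sets\<mu>: "sets \<mu> = sets (PiM (UNIV :: int set) (\<lambda>_. count_space (UNIV :: nat set)))"
    using mm by (simp add: markov_measure_def)
  have cyl [simp]: "cylinder a x \<in> events" for a x by (rule cylinder_sets[OF sets\<mu>])
  obtain \<pi> where \<pi>: "\<And>i. i \<in> {1..k} \<Longrightarrow> \<pi> i > 0" "(\<Sum>i\<in>{1..k}. \<pi> i) = 1"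
    "\<And>a x. x \<noteq> [] \<Longrightarrow> set x \<subseteq> {1..k} \<Longrightarrow> prob (cylinder a x) = \<pi> (x ! 0) * weight P x"
    using mm unfolding markov_measure_def weight_def by blast
  have nn: "\<And>i j. i \<in> {1..k} \<Longrightarrow> j \<in> {1..k} \<Longrightarrow> P i j \<ge> 0"
    using cs unfolding column_stochastic_def by blast
  have w': "w \<noteq> []" "set w \<subseteq> {1..k}" using w by (auto simp: admissible_word_def)
  have w0: "hd w \<in> {1..k}" using w' hd_in_set[of w] by blast
  obtain N where N: "\<And>i j. i \<in> {1..k} \<Longrightarrow> j \<in> {1..k} \<Longrightarrow> mpow k P (Suc N) i j > 0"
    by (rule primitive_positive_exponent[OF cs pr]) blast
  \<comment> \<open>\<open>Suc N\<close> transitions lead from any state to \<open>hd w\<close>;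
    without that endpoint there are \<open>N\<close> connecting letters, followed by
    \<open>w\<close>.\<close>
  define L where "L = N + length w"
  have "\<exists>y. i \<in> {1..k} \<longrightarrow> length y = L \<and> admissible_word k P (i # y) \<and> drop N y = w" for i
  proof (cases "i \<in> {1..k}")
    case True
    obtain z where z: "length z = Suc N" "admissible_word k P (i # z)" "last (i # z) = hd w"
      using mpow_path[OF nn N[OF w0 True] w0 True] by blast
    define z' where "z' = butlast z"
    have "z \<noteq> []" using z(1) by auto
    then have zz: "z = z' @ [hd w]" "length z' = N"
      using z append_butlast_last_id[of z] by (auto simp: z'_def)
    have "i # z' @ w = (i # z) @ tl w" using zz(1) w'(1) by simp
    moreover have "admissible_word k P ((i # z) @ tl w)"
    proof (cases "tl w")
      case (Cons b l)
      then have "w = hd w # b # l" using w'(1) by (cases w) auto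
      then have "admissible_word k P (tl w) \<and> P (hd (tl w)) (hd w) > 0"
        using w unfolding Cons admissible_word_iff by (metis list.sel(1) list.simps(3) list.set(2) insert_subset successively.simps(3))
      then show ?thesis using z(2,3) by (intro admissible_word_append) auto
    qed (use z(2) in simp)
    ultimately show ?thesis using zz by (intro exI[of _ "z' @ w"]) (auto simp: L_def)
  qed blast
  then have "\<exists>y. \<forall>i. i \<in> {1..k} \<longrightarrow> length (y i) = L \<and> admissible_word k P (i # y i) \<and> drop N (y i) = w"
    by (rule choice[OF allI])
  then obtain y where y: "\<And>i. i \<in> {1..k} \<Longrightarrow> length (y i) = L" "\<And>i. i \<in> {1..k} \<Longrightarrow> admissible_word k P (i # y i)"
    "\<And>i. i \<in> {1..k} \<Longrightarrow> drop N (y i) = w" by blast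
  \<comment> \<open>The inserted 1 makes \<open>1 - \<eta>\<close> nonnegative.\<close>
  define \<eta> where "\<eta> = Min (insert 1 ((\<lambda>i. weight P (i # y i)) ` {1..k}))"
  have \<eta>: "0 < \<eta>" "\<eta> \<le> 1" "\<And>i. i \<in> {1..k} \<Longrightarrow> \<eta> \<le> weight P (i # y i)"
  proof -
    show "0 < \<eta>" unfolding \<eta>_def using weight_pos[OF y(2)] by (subst Min_gr_iff) auto
    show "\<eta> \<le> 1" unfolding \<eta>_def by (intro Min_le) auto
    show "\<eta> \<le> weight P (i # y i)" if "i \<in> {1..k}" for i
      unfolding \<eta>_def using that by (intro Min_le) auto
  qed
  \<comment> \<open>One initial letter followed by \<open>n\<close> blocks. The letter at
    \<open>b * L\<close> is the state before block \<open>b\<close> and selects the block to be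
    avoided.\<close>
  define S where "S n = {x. length x = n * L + 1 \<and> set x \<subseteq> {1..k} \<and>
    (\<forall>b<n. take L (drop (b * L + 1) x) \<noteq> y (x ! (b * L)))}" for n
  have finS: "finite (S n)" for n
    by (rule finite_subset[OF _ finite_lists_length_eq[of "{1..k}" "n * L + 1"]]) (auto simp: S_def)
  have union: "prob (\<Union>x\<in>A. cylinder 0 x) = (\<Sum>x\<in>A. prob (cylinder 0 x))"
    if A: "finite A" "\<And>x. x \<in> A \<Longrightarrow> length x = m" for A m
    using A cylinder_disjoint by (intro finite_measure_finite_Union) (auto simp: disjoint_family_on_def)
  define c where "c n = (\<Sum>x\<in>S n. prob (cylinder 0 x))" for n
  have c_le: "c n \<le> (1 - \<eta>) ^ n" for n
  proof (induction n)
    case 0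
    have "c 0 = prob (\<Union>x\<in>S 0. cylinder 0 x)"
      unfolding c_def by (rule union[OF finS, symmetric]) (auto simp: S_def)
    then show ?case by simp
  next
    case (Suc n)
    let ?m = "n * L + 1"
    have img: "take ?m ` S (Suc n) \<subseteq> S n"
    proof (intro subsetI)
      fix x' assume "x' \<in> take ?m ` S (Suc n)"
      then obtain x where x: "x' = take ?m x" "x \<in> S (Suc n)" by blast
      have len: "length x' = ?m" using x by (auto simp: S_def)
      have "take L (drop (b * L + 1) x') \<noteq> y (x' ! (b * L))" if b: "b < n" for b
      proof -
        have "b * L + L \<le> n * L" using b mult_le_mono1[of "Suc b" n L] by simp
        then have "take L (drop (b * L + 1) x') = take L (drop (b * L + 1) x)" "x' ! (b * L) = x ! (b * L)"
          unfolding x(1) by (auto simp: drop_take min_def)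
        then show ?thesis using x(2) b by (simp add: S_def)
      qed
      then show "x' \<in> S n" using len x(2) set_take_subset[of ?m x] unfolding x(1) by (auto simp: S_def)
    qed
    \<comment> \<open>Surviving extensions of \<open>x'\<close> miss the cylinder of
      \<open>x'\<close> followed by its prescribed block, which has conditional probability at least
      \<open>\<eta>\<close>.\<close>
    have fiber: "(\<Sum>x\<in>{x \<in> S (Suc n). take ?m x = x'}. prob (cylinder 0 x)) \<le> (1 - \<eta>) * prob (cylinder 0 x')"
      if x': "x' \<in> S n" for x'
    proof -
      let ?F = "{x \<in> S (Suc n). take ?m x = x'}" and ?l = "last x'"
      have x'': "length x' = ?m" "set x' \<subseteq> {1..k}" "x' \<noteq> []" using x' by (auto simp: S_def)
      have l: "?l \<in> {1..k}" "?l = x' ! (n * L)"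
        using x'' last_in_set[of x'] by (blast, simp add: last_conv_nth)
      have sub: "(\<Union>x\<in>?F. cylinder 0 x) \<subseteq> cylinder 0 x' - cylinder 0 (x' @ y ?l)"
      proof (intro subsetI)
        fix \<omega> assume "\<omega> \<in> (\<Union>x\<in>?F. cylinder 0 x)"
        then obtain x where x: "x \<in> S (Suc n)" "take ?m x = x'" "\<omega> \<in> cylinder 0 x" by blast
        have xz: "x = x' @ drop ?m x" using x(2) append_take_drop_id[of ?m x] by simp
        have "\<omega> \<in> cylinder 0 (x' @ drop ?m x)" using x(3) xz by simp
        then have "\<omega> \<in> cylinder 0 x'" by (rule subsetD[OF cylinder_append_subset])
        moreover have "\<omega> \<notin> cylinder 0 (x' @ y ?l)"
        proof
          assume "\<omega> \<in> cylinder 0 (x' @ y ?l)"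
          moreover have "length x = length (x' @ y ?l)" using x(1) x'' y(1)[OF l(1)] by (simp add: S_def)
          ultimately have "x = x' @ y ?l" using cylinder_disjoint x(3) by blast
          then have "take L (drop ?m x) = y (x ! (n * L))"
            using x'' y(1)[OF l(1)] l(2) by (simp add: nth_append)
          moreover have "\<forall>b<Suc n. take L (drop (b * L + 1) x) \<noteq> y (x ! (b * L))" using x(1) unfolding S_def by blast
          ultimately show False using lessI by blast
        qed
        ultimately show "\<omega> \<in> cylinder 0 x' - cylinder 0 (x' @ y ?l)" by blast
      qed
      have "set (?l # y ?l) \<subseteq> {1..k}" using y(2)[OF l(1)] unfolding admissible_word_def by blast
      then have p: "prob (cylinder 0 (x' @ y ?l)) = prob (cylinder 0 x') * weight P (?l # y ?l)"
        using x'' \<pi>(3)[of "x' @ y ?l" 0] \<pi>(3)[of x' 0] by (simp add: weight_append nth_append)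
      have "(\<Sum>x\<in>?F. prob (cylinder 0 x)) = prob (\<Union>x\<in>?F. cylinder 0 x)"
        by (rule union[symmetric, where m = "Suc n * L + 1"]) (simp add: finS, simp add: S_def)
      also have "\<dots> \<le> prob (cylinder 0 x' - cylinder 0 (x' @ y ?l))"
        using sub by (intro finite_measure_mono) auto
      also have "\<dots> = prob (cylinder 0 x') - prob (cylinder 0 (x' @ y ?l))"
        by (intro finite_measure_Diff cylinder_append_subset) auto
      also have "\<dots> \<le> (1 - \<eta>) * prob (cylinder 0 x')"
        unfolding p using mult_left_mono[OF \<eta>(3)[OF l(1)], of "prob (cylinder 0 x')"] by (simp add: algebra_simps)
      finally show ?thesis .
    qed
    have "c (Suc n) = (\<Sum>x'\<in>S n. \<Sum>x\<in>{x \<in> S (Suc n). take ?m x = x'}. prob (cylinder 0 x))"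
      unfolding c_def by (rule sum.group[OF finS finS img, symmetric])
    also have "\<dots> \<le> (\<Sum>x'\<in>S n. (1 - \<eta>) * prob (cylinder 0 x'))" by (intro sum_mono fiber)
    also have "\<dots> = (1 - \<eta>) * c n" by (simp add: c_def sum_distrib_left)
    also have "\<dots> \<le> (1 - \<eta>) * (1 - \<eta>) ^ n" using Suc \<eta> by (intro mult_left_mono) auto
    finally show ?case by simp
  qed
  define V where "V n = (\<Union>x\<in>S n. cylinder 0 x)" for n
  have V [simp]: "V n \<in> events" for n unfolding V_def using finS by (intro sets.finite_UN) auto
  have Vc: "prob (V n) = c n" for n
    unfolding V_def c_def by (rule union[OF finS]) (auto simp: S_def)
  have "prob (\<Inter>n. V n) \<le> 0"
  proof (rule tendsto_lowerbound)
    show "(\<lambda>n. (1 - \<eta>) ^ n) \<longlonglongrightarrow> 0" using \<eta> by (intro LIMSEQ_power_zero) auto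
    have "prob (\<Inter>n. V n) \<le> (1 - \<eta>) ^ n" for n
    proof -
      have "prob (\<Inter>n. V n) \<le> prob (V n)" by (intro finite_measure_mono) auto
      then show ?thesis using c_le[of n] Vc[of n] by linarith
    qed
    then show "\<forall>\<^sub>F n in sequentially. prob (\<Inter>n. V n) \<le> (1 - \<eta>) ^ n" by simp
  qed simp
  then have "(\<Inter>n. V n) \<in> null_sets \<mu>"
    by (intro null_setsI) (auto simp: emeasure_eq_measure measure_le_0_iff)
  then have ae1: "AE \<omega> in \<mu>. \<omega> \<notin> (\<Inter>n. V n)" by (rule AE_not_in)
  \<comment> \<open>The measure lives on all integer-indexed sequences of naturals; the stationary
    weights sum to 1, so almost surely only letters of the alphabet occur.\<close>
  have ae2: "AE \<omega> in \<mu>. \<forall>n. \<omega> n \<in> {1..k}"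
  proof (subst AE_all_countable, rule allI)
    fix n :: int
    have "prob (\<Union>i\<in>{1..k}. cylinder n [i]) = (\<Sum>i\<in>{1..k}. prob (cylinder n [i]))"
    proof (rule finite_measure_finite_Union)
      show "disjoint_family_on (\<lambda>i. cylinder n [i]) {1..k}" by (auto simp: disjoint_family_on_def cylinder_def)
    qed auto
    also have "\<dots> = (\<Sum>i\<in>{1..k}. \<pi> i)" by (intro sum.cong) (auto simp: \<pi>(3))
    finally have "prob (\<Union>i\<in>{1..k}. cylinder n [i]) = 1" using \<pi>(2) by simp
    then have "AE \<omega> in \<mu>. \<omega> \<in> (\<Union>i\<in>{1..k}. cylinder n [i])" by (subst prob_eq_1[symmetric]) auto
    then show "AE \<omega> in \<mu>. \<omega> n \<in> {1..k}" by (rule AE_mp) (auto simp: cylinder_def)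
  qed
  from ae1 ae2 show ?thesis
  proof eventually_elim
    case (elim \<omega>)
    then obtain n where n: "\<omega> \<notin> V n" by blast
    define x where "x = map (\<lambda>j. \<omega> (int j)) [0..<n * L + 1]"
    have len: "length x = n * L + 1" and nth: "\<And>j. j < n * L + 1 \<Longrightarrow> x ! j = \<omega> (int j)" by (simp_all add: x_def del: upt_Suc)
    have "\<omega> \<in> cylinder 0 x" by (auto simp: cylinder_def len nth)
    then have "x \<notin> S n" using n by (auto simp: V_def)
    moreover have "set x \<subseteq> {1..k}" using elim(2) by (auto simp: x_def)
    ultimately obtain b where b: "b < n" "take L (drop (b * L + 1) x) = y (x ! (b * L))" using len by (auto simp: S_def)
    have bL: "b * L + L \<le> n * L" using b(1) mult_le_mono1[of "Suc b" n L] by simp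
    have xb: "x ! (b * L) \<in> {1..k}" using nth[of "b * L"] bL elim(2) by auto
    have "drop N (take L (drop (b * L + 1) x)) = w" unfolding b(2) by (rule y(3)[OF xb])
    then have dw: "take (length w) (drop (b * L + 1 + N) x) = w" by (simp add: drop_take L_def add.commute add.left_commute)
    have "\<omega> (int (b * L + N) + 1 + int j) = w ! j" if j: "j < length w" for j
    proof -
      have lt: "b * L + 1 + N + j < n * L + 1" using bL j by (simp add: L_def)
      have "w ! j = take (length w) (drop (b * L + 1 + N) x) ! j" by (simp only: dw)
      also have "\<dots> = x ! (b * L + 1 + N + j)" using j lt len by simp
      also have "\<dots> = \<omega> (int (b * L + 1 + N + j))" by (rule nth[OF lt])
      finally show ?thesis by (simp add: algebra_simps)
    qed
    then have "\<omega> \<in> cylinder (int (b * L + N) + 1) w" by (simp add: cylinder_def)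
    then show ?case by blast
  qed
qed

text \<open>The cylinder starts at \<open>m + 1\<close> because the first \<open>m\<close> factors
  use the letters 1 to \<open>m\<close>.\<close>

lemma cocycle_pow_cylinder:
  "\<omega> \<in> cylinder (int m + 1) w \<Longrightarrow> cocycle_pow M \<omega> (m + length w) = word_prod M w ** cocycle_pow M \<omega> m"
proof (induction w rule: rev_induct)
  case Nil
  then show ?case by (simp add: word_prod_def)
next
  case (snoc i w)
  have "\<omega> (int m + 1 + int (length w)) = (w @ [i]) ! length w"
    using snoc.prems unfolding cylinder_def by (auto dest: spec[of _ "length w"])
  then have "\<omega> (int (Suc (m + length w))) = i" by (simp add: algebra_simps)
  moreover have "cocycle_pow M \<omega> (m + length w) = word_prod M w ** cocycle_pow M \<omega> m"
    using snoc cylinder_append_subset by blast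
  ultimately show ?case by (simp add: word_prod_append word_prod_singleton matrix_mul_assoc)
qed

text \<open>Once the null word has been read, the product is zero at all later times.\<close>

lemma top_lyapunov_of_null_word:
  assumes cs: "column_stochastic k P" and pr: "primitive k P" and null: "has_periodic_null_word k P M"
  shows "top_lyapunov_is k P M (-\<infinity>)"
  unfolding top_lyapunov_is_def
proof (intro allI impI)
  fix \<mu> assume mm: "markov_measure k P \<mu>"
  obtain w where w: "admissible_word k P w" "word_prod M w = 0" using null unfolding has_periodic_null_word_def by blast
  show "AE \<omega> in \<mu>. (\<lambda>n. elog (norm (cocycle_pow M \<omega> n)) / ereal (real n)) \<longlonglongrightarrow> -\<infinity>"
    using word_occurs_AE[OF cs pr mm w(1)]
  proof eventually_elim
    case (elim \<omega>)
    then obtain m where m: "\<omega> \<in> cylinder (int m + 1) w" by blast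
    have zero: "cocycle_pow M \<omega> n = 0" if "n \<ge> m + length w" for n
      using that
    proof (induction n rule: dec_induct)
      case base
      show ?case using cocycle_pow_cylinder[OF m, of M] by (simp add: w(2))
    qed simp
    have "elog (norm (cocycle_pow M \<omega> n)) / ereal (real n) = -\<infinity>" if "n \<ge> Suc (m + length w)" for n
      using zero[of n] that by (simp add: elog_def)
    then show ?case by (intro tendsto_eventually) (auto simp: eventually_sequentially)
  qed
qed

section \<open>The dichotomy\<close>

text \<open>Packaged as one predicate so that a lift for each letter can be chosen at once with
  \<open>bchoice\<close>.\<close>

definition letter_lift :: "real set \<Rightarrow> real \<Rightarrow> (real \<Rightarrow> real^2^2) \<Rightarrow> (real \<Rightarrow> real \<Rightarrow> real) \<Rightarrow> bool" where
  "letter_lift I c B F \<longleftrightarrow> continuous_on (I \<times> UNIV) (\<lambda>(s, \<theta>). F s \<theta>) \<and>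
    (\<forall>s\<in>I. \<forall>\<theta>. B s *v dir \<theta> = norm (B s *v dir \<theta>) *\<^sub>R dir (F s \<theta>)) \<and>
    (\<forall>s\<in>I. \<forall>s'\<in>I. \<forall>\<theta>. s \<le> s' \<longrightarrow> F s' \<theta> - F s \<theta> \<ge> c * (s' - s)) \<and>
    (\<forall>s\<in>I. \<forall>\<theta> \<theta>'. \<theta> \<le> \<theta>' \<longrightarrow> F s \<theta> \<le> F s \<theta>') \<and> (\<forall>s\<in>I. \<forall>\<theta>. F s (\<theta> + pi) \<ge> F s \<theta> + pi)"

definition angle_pair :: "real set \<Rightarrow> (real \<Rightarrow> real^2^2) \<Rightarrow> (real \<Rightarrow> real) \<times> (real \<Rightarrow> real) \<Rightarrow> bool" where
  "angle_pair I B p \<longleftrightarrow> continuous_on I (fst p) \<and> continuous_on I (snd p) \<and>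
    (\<forall>s\<in>I. \<forall>s'\<in>I. s \<le> s' \<longrightarrow> fst p s \<le> fst p s' \<and> snd p s' \<le> snd p s) \<and>
    (\<forall>s\<in>I. span {dir (fst p s)} = range (\<lambda>v. B s *v v) \<and> span {dir (snd p s)} = {v. B s *v v = 0})"

lemma winding_imp_hyperbolic:
  assumes cs: "column_stochastic k P" and pr: "primitive k P" and pw: "positively_winding k I B"
    and det: "\<And>s j. s \<in> I \<Longrightarrow> j \<in> {1..k} \<Longrightarrow> det (B s j) \<ge> 0"
    and sing: "i0 \<in> {1..k}" "rank (B s0 i0) = 1" and s0: "s0 \<in> I" and \<epsilon>: "\<epsilon> > 0"
    and no_null: "\<And>s. s \<in> I \<Longrightarrow> dist s s0 < \<epsilon> \<Longrightarrow> \<not> has_periodic_null_word k P (B s)"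
  shows "proj_unif_hyperbolic k P (B s0)"
proof -
  from pw[unfolded positively_winding_def] obtain Ainv Asing c where I: "open_interval I"
    and smooth': "\<forall>j\<in>{1..k}. smooth_on I (\<lambda>t. B t j)"
    and letters: "Ainv \<union> Asing = {1..k}" "Ainv \<inter> Asing = {}"
    and c: "c > 0" and inv_rate: "\<forall>j\<in>Ainv. \<forall>t\<in>I. invertible (B t j) \<and> (\<forall>v. v \<noteq> 0 \<longrightarrow>
      wedge (B t j *v v) (vector_derivative (\<lambda>s. B s j) (at t) *v v) / (norm (B t j *v v))\<^sup>2 \<ge> c)"
    and sings: "\<forall>i\<in>Asing. (\<forall>t\<in>I. rank (B t i) = 1) \<and> (\<exists>r \<kappa>. smooth_on I r \<and> smooth_on I \<kappa> \<and>
      (\<forall>t\<in>I. norm (r t) = 1 \<and> norm (\<kappa> t) = 1 \<and> span {r t} = range (\<lambda>v. B t i *v v) \<and>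
        span {\<kappa> t} = {v. B t i *v v = 0} \<and> wedge (r t) (vector_derivative r (at t)) \<ge> 0 \<and>
        wedge (\<kappa> t) (vector_derivative \<kappa> (at t)) \<le> 0))"
    by (elim conjE exE) (rule that; assumption)
  have smooth: "\<And>j. j \<in> {1..k} \<Longrightarrow> smooth_on I (\<lambda>t. B t j)" using smooth' by (rule bspec)
  have inv: "\<And>j t. j \<in> Ainv \<Longrightarrow> t \<in> I \<Longrightarrow> invertible (B t j)" using inv_rate by blast
  have rate: "\<And>j t v. j \<in> Ainv \<Longrightarrow> t \<in> I \<Longrightarrow> v \<noteq> 0 \<Longrightarrow>
      wedge (B t j *v v) (vector_derivative (\<lambda>s. B s j) (at t) *v v) / (norm (B t j *v v))\<^sup>2 \<ge> c"
    using inv_rate by blast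
  have inv_letter: "j \<in> {1..k}" if "j \<in> Ainv" for j using letters that by blast
  have "\<forall>j\<in>Ainv. \<exists>F. letter_lift I c (\<lambda>s. B s j) F"
  proof
    fix j assume j: "j \<in> Ainv"
    show "\<exists>F. letter_lift I c (\<lambda>s. B s j) F"
    proof (rule invertible_letter_lift[OF I smooth[OF inv_letter[OF j]] inv[OF j] det[OF _ inv_letter[OF j]] rate[OF j]])
      fix F assume F: "continuous_on (I \<times> UNIV) (\<lambda>(s, \<theta>). F s \<theta>)"
        "\<And>s \<theta>. s \<in> I \<Longrightarrow> B s j *v dir \<theta> = norm (B s j *v dir \<theta>) *\<^sub>R dir (F s \<theta>)"
        "\<And>s s' \<theta>. s \<in> I \<Longrightarrow> s' \<in> I \<Longrightarrow> s \<le> s' \<Longrightarrow> F s' \<theta> - F s \<theta> \<ge> c * (s' - s)"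
        "\<And>s \<theta> \<theta>'. s \<in> I \<Longrightarrow> \<theta> \<le> \<theta>' \<Longrightarrow> F s \<theta> \<le> F s \<theta>'"
        "\<And>s \<theta>. s \<in> I \<Longrightarrow> F s (\<theta> + pi) \<ge> F s \<theta> + pi"
      show ?thesis unfolding letter_lift_def by (intro exI[of _ F] conjI ballI allI impI F)
    qed
  qed
  from bchoice[OF this] obtain F where F: "\<forall>j\<in>Ainv. letter_lift I c (\<lambda>s. B s j) (F j)" by (rule exE)
  have "\<forall>i\<in>Asing. \<exists>p. angle_pair I (\<lambda>s. B s i) p"
  proof
    fix i assume i: "i \<in> Asing"
    from bspec[OF sings i] obtain r \<kappa> where r\<kappa>: "smooth_on I r" "smooth_on I \<kappa>"
      "\<forall>t\<in>I. norm (r t) = 1 \<and> norm (\<kappa> t) = 1 \<and> span {r t} = range (\<lambda>v. B t i *v v) \<and>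
        span {\<kappa> t} = {v. B t i *v v = 0} \<and> wedge (r t) (vector_derivative r (at t)) \<ge> 0 \<and>
        wedge (\<kappa> t) (vector_derivative \<kappa> (at t)) \<le> 0"
      by (elim conjE exE) (rule that; assumption)
    note pt = bspec[OF r\<kappa>(3)]
    have r: "norm (r t) = 1" "span {r t} = range (\<lambda>v. B t i *v v)" "wedge (r t) (vector_derivative r (at t)) \<ge> 0"
      and \<kappa>: "norm (\<kappa> t) = 1" "span {\<kappa> t} = {v. B t i *v v = 0}" "wedge (\<kappa> t) (vector_derivative \<kappa> (at t)) \<le> 0"
      if "t \<in> I" for t using pt[OF that] by - (elim conjE, assumption)+
    from unit_curve_angle[OF I r\<kappa>(1)] r(1) obtain \<rho> where \<rho>: "continuous_on I \<rho>"
      "\<forall>s\<in>I. r s = dir (\<rho> s) \<and> (\<rho> has_real_derivative wedge (r s) (vector_derivative r (at s))) (at s)"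
      by blast
    from unit_curve_angle[OF I r\<kappa>(2)] \<kappa>(1) obtain \<phi> where \<phi>: "continuous_on I \<phi>"
      "\<forall>s\<in>I. \<kappa> s = dir (\<phi> s) \<and> (\<phi> has_real_derivative wedge (\<kappa> s) (vector_derivative \<kappa> (at s))) (at s)"
      by blast
    have between: "x \<in> I" if "s \<in> I" "s' \<in> I" "s \<le> x" "x \<le> s'" for s s' x
      using open_interval_convex[OF I] that unfolding is_interval_1 by blast
    have up: "\<rho> s \<le> \<rho> s'" and down: "\<phi> s' \<le> \<phi> s" if "s \<in> I" "s' \<in> I" "s \<le> s'" for s s'
    proof -
      show "\<rho> s \<le> \<rho> s'"
        by (rule DERIV_nonneg_imp_nondecreasing[OF that(3)]) (use \<rho>(2) r(3) between[OF that(1,2)] in blast)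
      show "\<phi> s' \<le> \<phi> s"
        by (rule DERIV_nonpos_imp_nonincreasing[OF that(3)]) (use \<phi>(2) \<kappa>(3) between[OF that(1,2)] in blast)
    qed
    have "span {dir (\<rho> s)} = range (\<lambda>v. B s i *v v)" "span {dir (\<phi> s)} = {v. B s i *v v = 0}" if "s \<in> I" for s
      using r(2)[OF that] \<kappa>(2)[OF that] bspec[OF \<rho>(2) that] bspec[OF \<phi>(2) that] by simp_all
    with up down \<rho>(1) \<phi>(1) have "angle_pair I (\<lambda>s. B s i) (\<rho>, \<phi>)" unfolding angle_pair_def fst_conv snd_conv by blast
    then show "\<exists>p. angle_pair I (\<lambda>s. B s i) p" by (rule exI)
  qed
  from bchoice[OF this] obtain p where p: "\<forall>i\<in>Asing. angle_pair I (\<lambda>s. B s i) (p i)" by (rule exE)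
  \<comment> \<open>An invertible matrix of size 2 would have full rank; this supplies the singular
    letter that anchors all trajectories.\<close>
  have "i0 \<notin> Ainv"
  proof
    assume "i0 \<in> Ainv"
    then have "inj (\<lambda>v. B s0 i0 *v v)" using inv[OF _ s0] by (auto simp: invertible_left_inverse matrix_left_invertible_injective)
    then show False using sing(2) by (simp add: full_rank_injective[symmetric])
  qed
  then have Asing: "Asing \<noteq> {}" using sing(1) letters by blast
  obtain \<delta> where \<delta>: "\<delta> > 0" "ball s0 \<delta> \<subseteq> I"
    using s0 I unfolding open_interval_def by (meson open_contains_ball)
  \<comment> \<open>A quarter, so that the window of radius \<open>2 * eps\<close> fits strictly
    inside both radii.\<close>
  define eps where "eps = min \<epsilon> \<delta> / 4"
  have eps: "eps > 0" "2 * eps < \<epsilon>" "2 * eps < \<delta>" using \<epsilon> \<delta> by (auto simp: eps_def)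
  have near: "s \<in> I \<and> dist s s0 < \<epsilon>" if "s \<in> {s0 - 2 * eps..s0 + 2 * eps}" for s
    using that eps \<delta>(2) by (auto simp: dist_real_def subset_iff)
  have "winding_data k P B I Ainv Asing c eps s0 F (\<lambda>i. fst (p i)) (\<lambda>i. snd (p i))"
  proof unfold_locales
    show "(admissible_step k P)\<^sup>+\<^sup>+ i j" if "i \<in> {1..k}" "j \<in> {1..k}" for i j by (rule primitive_connected[OF cs pr that])
    show "{s0 - 2 * eps..s0 + 2 * eps} \<subseteq> I" using near by blast
    show "\<not> has_periodic_null_word k P (B s)" if "s \<in> {s0 - 2 * eps..s0 + 2 * eps}" for s
      using near[OF that] no_null by blast
    show "det (B s0 j) \<ge> 0" if "j \<in> {1..k}" for j by (rule det[OF s0 that])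
    show "invertible (B s0 j)" if "j \<in> Ainv" for j by (rule inv[OF that s0])
    show "continuous_on (I \<times> UNIV) (\<lambda>(s, \<theta>). F j s \<theta>)" if "j \<in> Ainv" for j
      using bspec[OF F that] unfolding letter_lift_def by (elim conjE)
    show "B s j *v dir \<theta> = norm (B s j *v dir \<theta>) *\<^sub>R dir (F j s \<theta>)" if "j \<in> Ainv" "s \<in> I" for j s \<theta>
      using bspec[OF F that(1)] that(2) unfolding letter_lift_def by blast
    show "F j s' \<theta> - F j s \<theta> \<ge> c * (s' - s)" if "j \<in> Ainv" "s \<in> I" "s' \<in> I" "s \<le> s'" for j s s' \<theta>
      using bspec[OF F that(1)] that(2-) unfolding letter_lift_def by blast
    show "F j s \<theta> \<le> F j s \<theta>'" if "j \<in> Ainv" "s \<in> I" "\<theta> \<le> \<theta>'" for j s \<theta> \<theta>'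
      using bspec[OF F that(1)] that(2-) unfolding letter_lift_def by blast
    show "F j s (\<theta> + pi) \<ge> F j s \<theta> + pi" if "j \<in> Ainv" "s \<in> I" for j s \<theta>
      using bspec[OF F that(1)] that(2-) unfolding letter_lift_def by blast
    show "continuous_on I (fst (p j))" "continuous_on I (snd (p j))" if "j \<in> Asing" for j
      using bspec[OF p that] unfolding angle_pair_def by - (elim conjE, assumption)+
    show "fst (p j) s \<le> fst (p j) s'" "snd (p j) s' \<le> snd (p j) s"
      if "j \<in> Asing" "s \<in> I" "s' \<in> I" "s \<le> s'" for j s s'
      using bspec[OF p that(1)] that(2-) unfolding angle_pair_def by blast+
    show "span {dir (fst (p j) s)} = range (\<lambda>v. B s j *v v)" "span {dir (snd (p j) s)} = {v. B s j *v v = 0}"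
      if "j \<in> Asing" "s \<in> I" for j s
      using bspec[OF p that(1)] that(2-) unfolding angle_pair_def by blast+
  qed (use eps(1) c letters Asing in auto)
  then show ?thesis by (rule winding_data.hyperbolic)
qed

theorem theorem4p7:
  fixes k :: nat and P :: "nat \<Rightarrow> nat \<Rightarrow> real"
    and \<Lambda> :: "(real^'m) set" and A :: "real^'m \<Rightarrow> nat \<Rightarrow> real^2^2"
  assumes "column_stochastic k P" and "primitive k P"
    and "open \<Lambda>"
    and "\<forall>j\<in>{1..k}. smooth_on \<Lambda> (\<lambda>x. A x j)"
    and "\<forall>x\<in>\<Lambda>. \<forall>j\<in>{1..k}. det (A x j) \<ge> 0"
    and "rich k \<Lambda> A"
    and "\<exists>i\<in>{1..k}. \<forall>x\<in>\<Lambda>. rank (A x i) = 1"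
  shows "\<forall>t\<in>\<Lambda>. proj_unif_hyperbolic k P (A t) \<or>
           (\<exists>ts :: nat \<Rightarrow> real^'m. (\<forall>n. ts n \<in> \<Lambda>) \<and> ts \<longlonglongrightarrow> t \<and>
              (\<forall>n. has_periodic_null_word k P (A (ts n))) \<and>
              (\<forall>n. top_lyapunov_is k P (A (ts n)) (-\<infinity>)))"
proof
  fix t assume t: "t \<in> \<Lambda>"
  obtain I \<alpha> where I: "open_interval I" and \<alpha>: "smooth_on I \<alpha>" "\<alpha> ` I \<subseteq> \<Lambda>" "t \<in> \<alpha> ` I"
    and pw: "positively_winding k I (\<lambda>s. A (\<alpha> s))"
    using assms(6) t unfolding rich_def by blast
  obtain s0 where s0: "s0 \<in> I" "t = \<alpha> s0" using \<alpha>(3) by blast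
  obtain i0 where i0: "i0 \<in> {1..k}" "\<forall>x\<in>\<Lambda>. rank (A x i0) = 1" using assms(7) by blast
  show "proj_unif_hyperbolic k P (A t) \<or>
           (\<exists>ts :: nat \<Rightarrow> real^'m. (\<forall>n. ts n \<in> \<Lambda>) \<and> ts \<longlonglongrightarrow> t \<and>
              (\<forall>n. has_periodic_null_word k P (A (ts n))) \<and>
              (\<forall>n. top_lyapunov_is k P (A (ts n)) (-\<infinity>)))"
  \<comment> \<open>The dichotomy is decided along the winding curve through \<open>t\<close> alone;
    nearby curve parameters with null words yield the sequence in \<open>\<Lambda>\<close>.\<close>
  proof (cases "\<exists>\<epsilon>>0. \<forall>s\<in>I. dist s s0 < \<epsilon> \<longrightarrow> \<not> has_periodic_null_word k P (A (\<alpha> s))")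
    case True
    then obtain \<epsilon> where \<epsilon>: "\<epsilon> > 0" "\<And>s. s \<in> I \<Longrightarrow> dist s s0 < \<epsilon> \<Longrightarrow> \<not> has_periodic_null_word k P (A (\<alpha> s))" by blast
    have "proj_unif_hyperbolic k P (A (\<alpha> s0))"
      by (rule winding_imp_hyperbolic[OF assms(1,2) pw _ i0(1) _ s0(1) \<epsilon>])
        (use assms(5) \<alpha>(2) i0(2) s0(1) in blast)+
    then show ?thesis using s0(2) by simp
  next
    case False
    have "\<exists>s. s \<in> I \<and> dist s s0 < inverse (real (Suc n)) \<and> has_periodic_null_word k P (A (\<alpha> s))" for n
      using False by (metis inverse_positive_iff_positive of_nat_0_less_iff zero_less_Suc)
    then obtain s where s: "\<And>n. s n \<in> I" "\<And>n. dist (s n) s0 < inverse (real (Suc n))"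
      "\<And>n. has_periodic_null_word k P (A (\<alpha> (s n)))" by metis
    have "s \<longlonglongrightarrow> s0"
      by (rule tendsto_dist_iff[THEN iffD2], rule tendsto_sandwich[OF _ _ tendsto_const LIMSEQ_inverse_real_of_nat])
        (use s(2) in \<open>auto intro!: always_eventually less_imp_le\<close>)
    moreover have "isCont \<alpha> s0"
      using smooth_on_imp_continuous_on[OF \<alpha>(1)] I s0(1) by (simp add: open_interval_def continuous_on_eq_continuous_at)
    ultimately have "(\<lambda>n. \<alpha> (s n)) \<longlonglongrightarrow> t" unfolding s0(2) by (rule isCont_tendsto_compose[rotated])
    then show ?thesis
      using s(1,3) \<alpha>(2) top_lyapunov_of_null_word[OF assms(1,2) s(3)] by (intro disjI2 exI[of _ "\<lambda>n. \<alpha> (s n)"]) auto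
  qed
qed

end
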